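(* Let $G$ be a finite group with a fixed representation on $\mathbb{R}^n$, and let $\sigma_1,\dots,\sigma_r$ be a fixed system of homogeneous generators of $\mathbb{R}[\mathbb{R}^n]^G$, $d_j=\deg\sigma_j$, $d=\max_jd_j$. Let $\Omega$ be a bounded open subset of $\mathbb{R}^m$ and let $f : \Omega \to \mathcal{A}_{G\circlearrowleft\mathbb{R}^n}(\mathbb{R}^n)$ be continuous. If $\Sigma \circ f \in C^{d-1,1}(\overline \Omega,\mathbb{R}^r)$, then for each relatively compact open $\Omega' \subseteq \Omega$ we have $f \in W^{1,\infty}(\Omega',\mathcal{A}_{G\circlearrowleft\mathbb{R}^n}(\mathbb{R}^n))$. Moreover, $$\|D f\|_{L^\infty(\Omega')} \le C \Big(1 + \max_{1 \le j \le r} \|\Sigma_j \circ f\|^{1/d_j}_{C^{d-1,1}(\overline \Omega)}\Big),$$ where $C=C(d,n,m,\Omega,\Omega')$ (for the fixed representation and generators).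
   Context: $\mathcal{A}_Q(\mathbb{R}^n)=\{\sum_{i=1}^Q\llbracket p_i\rrbracket: p_i\in\mathbb{R}^n\}$ is the space of unordered $Q$-tuples of points in $\mathbb{R}^n$, $\llbracket p\rrbracket$ being the Dirac mass at $p$, with the complete metric $d(\sum_i\llbracket p_i\rrbracket,\sum_i\llbracket q_i\rrbracket)=\min_{s\in \mathrm{S}_Q}(\sum_i|p_i-q_{s(i)}|^2)^{1/2}$. For a representation of a finite group $G$ on $\mathbb{R}^n$, $\mathcal{A}_{G\circlearrowleft\mathbb{R}^n}(\mathbb{R}^n)=\{\sum_{g\in G}\llbracket gp\rrbracket:p\in\mathbb{R}^n\}$, a closed subspace of $\mathcal{A}_{|G|}(\mathbb{R}^n)$. Let $\pi:\mathbb{R}^n\to\mathcal{A}_{G\circlearrowleft\mathbb{R}^n}(\mathbb{R}^n)$, $\pi(p)=\sum_{g\in G}\llbracket gp\rrbracket$, and $\sigma=(\sigma_1,\dots,\sigma_r):\mathbb{R}^n\to\mathbb{R}^r$. Since $\sigma$ separates orbits there is a bijection $\Sigma=(\Sigma_1,\dots,\Sigma_r):\mathcal{A}_{G\circlearrowleft\mathbb{R}^n}(\mathbb{R}^n)\to\sigma(\mathbb{R}^n)\subseteq\mathbb{R}^r$ with $\sigma=\Sigma\circ\pi$. Sobolev functions: for $\Omega\subseteq\mathbb{R}^m$ bounded open, a measurable $f:\Omega\to\mathcal{A}_Q(\mathbb{R}^n)$ is in $W^{1,p}(\Omega,\mathcal{A}_Q(\mathbb{R}^n))$ ($1\le p\le\infty$)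 if (1) $x\mapsto d(f(x),P)\in W^{1,p}(\Omega)$ for all $P\in\mathcal{A}_Q(\mathbb{R}^n)$, and (2) there are $\varphi_1,\dots,\varphi_m\in L^p(\Omega,\mathbb{R}^+)$ with $|\partial_jd(f,P)|\le\varphi_j$ a.e. in $\Omega$ for all $P$ and all $j$. The minimal such $\varphi_j$ is denoted $|\partial_jf|$ (equal a.e. to $\sup_\ell|\partial_jd(f,P_\ell)|$ for any countable dense $\{P_\ell\}$), $|Df|=(\sum_j|\partial_jf|^2)^{1/2}$, and $\|Df\|_{L^p}$ is the $L^p$-norm of $|Df|$. A function $f:\Omega\to\mathcal{A}_{G\circlearrowleft\mathbb{R}^n}(\mathbb{R}^n)$ is of class $W^{1,p}$ if it is so as a function into $\mathcal{A}_{|G|}(\mathbb{R}^n)$. $C^{k,1}(\overline\Omega)$: $C^k$ functions on $\Omega$ whose partial derivatives of order $\le k$ extend continuously to $\overline\Omega$ and are Lipschitz in $\Omega$, with norm $\max_{|\gamma|\le k}\sup_{\Omega}|\partial^\gamma f|+\max_{|\gamma|=k}\mathrm{Lip}_\Omega(\partial^\gamma f)$. *)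

theory Defs
  imports
    "HOL-Analysis.Analysis"
    "HOL-Probability.Essential_Supremum"
    "HOL-Combinatorics.List_Permutation"
    "HOL-Algebra.Group_Action"
begin

section \<open>Unordered \<open>Q\<close>-tuples\<close>

text \<open>
  A sum of \<open>Q\<close> Dirac masses is the multiset of its \<open>Q\<close> points.
\<close>

definition unordered_tuples :: "nat \<Rightarrow> 'a multiset set"
  where "unordered_tuples Q = {M. size M = Q}"

definition tuple_costs :: "'a::real_normed_vector multiset \<Rightarrow> 'a multiset \<Rightarrow> real set"
  where "tuple_costs M N =
    {L2_set (\<lambda>i. norm (xs ! i - ys ! s i)) {..<size M} | xs ys s.
       mset xs = M \<and> mset ys = N \<and> s permutes {..<size M}}"

text \<open>
  The value at multisets of different sizes is irrelevant; \<open>0\<close> makes the function nonnegative and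
  symmetric everywhere, as the locale \<open>Metric_space\<close> requires.
\<close>

definition tuple_dist :: "'a::real_normed_vector multiset \<Rightarrow> 'a multiset \<Rightarrow> real"
  where "tuple_dist M N = (if size M = size N then Min (tuple_costs M N) else 0)"

lemma tuple_costs_iff:
  assumes sz: "size M = size N" and xs0: "mset xs0 = M"
  shows "c \<in> tuple_costs M N \<longleftrightarrow>
    (\<exists>ys. mset ys = N \<and> c = L2_set (\<lambda>i. norm (xs0 ! i - ys ! i)) {..<size M})"
proof
  assume "c \<in> tuple_costs M N"
  then obtain xs ys s where *: "mset xs = M" "mset ys = N" "s permutes {..<size M}"
    "c = L2_set (\<lambda>i. norm (xs ! i - ys ! s i)) {..<size M}"
    unfolding tuple_costs_def by blast
  have len: "length xs = size M" "length ys = size M" "length xs0 = size M"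
    using * sz xs0 by (auto simp flip: size_mset)
  obtain p where p: "p permutes {..<length xs}" "permute_list p xs = xs0"
    using mset_eq_permutation[of xs0 xs] xs0 * by metis
  have sp: "s \<circ> p permutes {..<length ys}"
    using permutes_compose[OF p(1)] * len by simp
  have "L2_set (\<lambda>i. norm (xs ! i - ys ! s i)) {..<size M}
      = L2_set (\<lambda>i. norm (xs ! p i - ys ! s (p i))) {..<size M}"
    unfolding L2_set_def
    using sum.permute[of p "{..<size M}" "\<lambda>i. (norm (xs ! i - ys ! s i))\<^sup>2"] p len
    by (simp add: o_def)
  also have "\<dots> = L2_set (\<lambda>i. norm (xs0 ! i - permute_list (s \<circ> p) ys ! i)) {..<size M}"
    using p sp len
    by (intro L2_set_cong refl) (auto simp: permute_list_nth simp flip: p(2))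
  finally show "\<exists>ys. mset ys = N \<and> c = L2_set (\<lambda>i. norm (xs0 ! i - ys ! i)) {..<size M}"
    using * mset_permute_list[OF sp] by metis
next
  assume "\<exists>ys. mset ys = N \<and> c = L2_set (\<lambda>i. norm (xs0 ! i - ys ! i)) {..<size M}"
  then obtain ys where "mset ys = N" "c = L2_set (\<lambda>i. norm (xs0 ! i - ys ! id i)) {..<size M}"
    by auto
  then show "c \<in> tuple_costs M N"
    unfolding tuple_costs_def using xs0 permutes_id by blast
qed

lemma finite_tuple_costs: "size M = size N \<Longrightarrow> finite (tuple_costs M N)"
proof -
  assume sz: "size M = size N"
  obtain xs0 where xs0: "mset xs0 = M" using ex_mset by blast
  have "finite {ys. mset ys = N}"
    by (rule finite_subset[OF _ finite_lists_length_eq[of "set_mset N" "size N"]]) auto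
  moreover have "tuple_costs M N \<subseteq>
      (\<lambda>ys. L2_set (\<lambda>i. norm (xs0 ! i - ys ! i)) {..<size M}) ` {ys. mset ys = N}"
    using tuple_costs_iff[OF sz xs0] by blast
  ultimately show ?thesis by (meson finite_imageI finite_subset)
qed

lemma tuple_costs_nonempty: "tuple_costs M N \<noteq> {}"
proof -
  obtain xs ys where xs: "mset xs = M" and ys: "mset ys = N" using ex_mset by metis
  have "L2_set (\<lambda>i. norm (xs ! i - ys ! id i)) {..<size M} \<in> tuple_costs M N"
    unfolding tuple_costs_def using xs ys permutes_id by blast
  then show ?thesis by blast
qed

lemma tuple_dist_attained:
  assumes "size M = size N" "mset xs0 = M"
  obtains ys where "mset ys = N"
    "tuple_dist M N = L2_set (\<lambda>i. norm (xs0 ! i - ys ! i)) {..<size M}"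
proof -
  have "tuple_dist M N \<in> tuple_costs M N"
    using Min_in[OF finite_tuple_costs[OF assms(1)] tuple_costs_nonempty] assms(1)
    by (simp add: tuple_dist_def)
  then have "\<exists>ys. mset ys = N \<and>
      tuple_dist M N = L2_set (\<lambda>i. norm (xs0 ! i - ys ! i)) {..<size M}"
    using tuple_costs_iff[OF assms] by simp
  then show thesis
    using that by blast
qed

lemma tuple_dist_le:
  assumes "mset xs = M" "mset ys = N" "size M = size N"
  shows "tuple_dist M N \<le> L2_set (\<lambda>i. norm (xs ! i - ys ! i)) {..<size M}"
proof -
  have "L2_set (\<lambda>i. norm (xs ! i - ys ! i)) {..<size M} \<in> tuple_costs M N"
    using tuple_costs_iff[OF assms(3,1)] assms(2) by blast
  then show ?thesis
    using Min_le[OF finite_tuple_costs[OF assms(3)]] assms(3) by (simp add: tuple_dist_def)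
qed

lemma tuple_dist_commute_le: "size M = size N \<Longrightarrow> tuple_dist M N \<le> tuple_dist N M"
proof -
  assume sz: "size M = size N"
  obtain ys where ys: "mset ys = N" using ex_mset by blast
  obtain xs where xs: "mset xs = M"
    "tuple_dist N M = L2_set (\<lambda>i. norm (ys ! i - xs ! i)) {..<size N}"
    using tuple_dist_attained[OF sz[symmetric] ys] by blast
  show ?thesis
    using tuple_dist_le[OF xs(1) ys sz] xs(2) sz by (simp add: norm_minus_commute)
qed

lemma Metric_space_unordered_tuples: "Metric_space (unordered_tuples Q) tuple_dist"
proof
  fix M N :: "'a multiset"
  show "0 \<le> tuple_dist M N"
  proof (cases "size M = size N")
    case True
    obtain xs where xs: "mset xs = M" using ex_mset by blast
    obtain ys where "tuple_dist M N = L2_set (\<lambda>i. norm (xs ! i - ys ! i)) {..<size M}"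
      using tuple_dist_attained[OF True xs] by blast
    then show ?thesis by (simp add: L2_set_nonneg)
  qed (simp add: tuple_dist_def)
  show "tuple_dist M N = tuple_dist N M"
  proof (cases "size M = size N")
    case True
    then show ?thesis
      using tuple_dist_commute_le[of M N] tuple_dist_commute_le[of N M] by simp
  qed (simp add: tuple_dist_def)
next
  fix M N :: "'a multiset"
  assume "M \<in> unordered_tuples Q" "N \<in> unordered_tuples Q"
  then have sz: "size M = size N" by (simp add: unordered_tuples_def)
  obtain xs where xs: "mset xs = M" using ex_mset by blast
  obtain ys where ys: "mset ys = N"
    "tuple_dist M N = L2_set (\<lambda>i. norm (xs ! i - ys ! i)) {..<size M}"
    using tuple_dist_attained[OF sz xs] by blast
  have len: "length xs = size M" "length ys = size M"
    using xs ys sz by auto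
  show "tuple_dist M N = 0 \<longleftrightarrow> M = N"
  proof
    assume "tuple_dist M N = 0"
    then have "\<forall>i<size M. xs ! i = ys ! i"
      using ys(2) by (simp add: L2_set_eq_0_iff)
    then have "xs = ys" using len by (simp add: list_eq_iff_nth_eq)
    then show "M = N" using xs ys by simp
  next
    assume eq: "M = N"
    have "tuple_dist M N \<le> L2_set (\<lambda>i. norm (xs ! i - xs ! i)) {..<size M}"
      by (rule tuple_dist_le) (use xs eq in auto)
    also have "\<dots> = 0" by (simp add: L2_set_eq_0_iff)
    finally show "tuple_dist M N = 0"
      using ys(2) by (metis L2_set_nonneg antisym)
  qed
next
  fix M N P :: "'a multiset"
  assume *: "M \<in> unordered_tuples Q" "N \<in> unordered_tuples Q" "P \<in> unordered_tuples Q"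
  then have sz: "size M = size N" "size N = size P" "size M = size P"
    by (auto simp: unordered_tuples_def)
  obtain xs where xs: "mset xs = M" using ex_mset by blast
  obtain ys where ys: "mset ys = N"
    "tuple_dist M N = L2_set (\<lambda>i. norm (xs ! i - ys ! i)) {..<size M}"
    using tuple_dist_attained[OF sz(1) xs] by blast
  obtain zs where zs: "mset zs = P"
    "tuple_dist N P = L2_set (\<lambda>i. norm (ys ! i - zs ! i)) {..<size N}"
    using tuple_dist_attained[OF sz(2) ys(1)] by blast
  have "tuple_dist M P \<le> L2_set (\<lambda>i. norm (xs ! i - zs ! i)) {..<size M}"
    by (rule tuple_dist_le) (use xs zs sz in auto)
  also have "\<dots> \<le> L2_set (\<lambda>i. norm (xs ! i - ys ! i) + norm (ys ! i - zs ! i)) {..<size M}"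
    by (intro L2_set_mono) (auto intro: norm_diff_triangle_le)
  also have "\<dots> \<le> tuple_dist M N + tuple_dist N P"
    using L2_set_triangle_ineq ys(2) zs(2) sz by metis
  finally show "tuple_dist M P \<le> tuple_dist M N + tuple_dist N P" .
qed


section \<open>Representations, orbits and invariant polynomials\<close>

text \<open>
  The representation need not be faithful. A \<open>group_action\<close> on \<open>UNIV\<close> is a homomorphism into the
  bijections of the whole space.
\<close>

definition finite_group_rep ::
    "('g, 'z) monoid_scheme \<Rightarrow> ('g \<Rightarrow> real^'n \<Rightarrow> real^'n) \<Rightarrow> bool"
  where "finite_group_rep G \<rho> \<longleftrightarrow>
    finite (carrier G) \<and> group_action G UNIV \<rho> \<and> (\<forall>g\<in>carrier G. linear (\<rho> g))"

definition orbit_tuple ::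
    "('g, 'z) monoid_scheme \<Rightarrow> ('g \<Rightarrow> real^'n \<Rightarrow> real^'n) \<Rightarrow> real^'n \<Rightarrow> (real^'n) multiset"
  where "orbit_tuple G \<rho> p = image_mset (\<lambda>g. \<rho> g p) (mset_set (carrier G))"

definition orbit_tuples ::
    "('g, 'z) monoid_scheme \<Rightarrow> ('g \<Rightarrow> real^'n \<Rightarrow> real^'n) \<Rightarrow> (real^'n) multiset set"
  where "orbit_tuples G \<rho> = range (orbit_tuple G \<rho>)"

lemma orbit_tuples_subset: "orbit_tuples G \<rho> \<subseteq> unordered_tuples (card (carrier G))"
  by (auto simp: orbit_tuples_def orbit_tuple_def unordered_tuples_def)

lemma Metric_space_orbit_tuples: "Metric_space (orbit_tuples G \<rho>) tuple_dist"
  using Metric_space.subspace[OF Metric_space_unordered_tuples orbit_tuples_subset] .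

text \<open>
  The ring \<open>\<real>[\<real>\<^sup>n]\<close> is identified with the ring of polynomial functions; the field is infinite.
\<close>

definition invariant_polynomials ::
    "('g, 'z) monoid_scheme \<Rightarrow> ('g \<Rightarrow> real^'n \<Rightarrow> real^'n) \<Rightarrow> (real^'n \<Rightarrow> real) set"
  where "invariant_polynomials G \<rho> =
    {p. real_polynomial_function p \<and> (\<forall>g\<in>carrier G. \<forall>x. p (\<rho> g x) = p x)}"

inductive_set algebra_generated :: "('a \<Rightarrow> real) set \<Rightarrow> ('a \<Rightarrow> real) set"
  for S :: "('a \<Rightarrow> real) set"
where
  const: "(\<lambda>x. c) \<in> algebra_generated S"
| base: "p \<in> S \<Longrightarrow> p \<in> algebra_generated S"
| add: "\<lbrakk>p \<in> algebra_generated S; q \<in> algebra_generated S\<rbrakk>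
    \<Longrightarrow> (\<lambda>x. p x + q x) \<in> algebra_generated S"
| mult: "\<lbrakk>p \<in> algebra_generated S; q \<in> algebra_generated S\<rbrakk>
    \<Longrightarrow> (\<lambda>x. p x * q x) \<in> algebra_generated S"

definition homogeneous_polynomial :: "nat \<Rightarrow> (real^'n \<Rightarrow> real) \<Rightarrow> bool"
  where "homogeneous_polynomial k p \<longleftrightarrow>
    (\<exists>c. \<forall>x. p x = (\<Sum>\<alpha> | sum \<alpha> UNIV = k. c \<alpha> * (\<Prod>i\<in>UNIV. x $ i ^ \<alpha> i)))"

text \<open>
  As \<open>\<sigma> j \<noteq> 0\<close>, the number \<open>dg j\<close> is the degree of \<open>\<sigma> j\<close>. Constants are superfluous in a system
  of generators and are excluded, since the exponents \<open>1 / dg j\<close> must make sense.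
\<close>

definition homogeneous_generators ::
    "('g, 'z) monoid_scheme \<Rightarrow> ('g \<Rightarrow> real^'n \<Rightarrow> real^'n) \<Rightarrow>
     ('r::finite \<Rightarrow> real^'n \<Rightarrow> real) \<Rightarrow> ('r \<Rightarrow> nat) \<Rightarrow> bool"
  where "homogeneous_generators G \<rho> \<sigma> dg \<longleftrightarrow>
    (\<forall>j. homogeneous_polynomial (dg j) (\<sigma> j) \<and> \<sigma> j \<noteq> (\<lambda>x. 0) \<and> dg j \<ge> 1) \<and>
    algebra_generated (range \<sigma>) = invariant_polynomials G \<rho>"

text \<open>
  The component \<open>\<Sigma>\<^sub>j\<close> of the induced map \<open>\<Sigma>\<close>; the choice of the preimage does not matter, see the
  lemma below.
\<close>

definition induced_map ::
    "('g, 'z) monoid_scheme \<Rightarrow> ('g \<Rightarrow> real^'n \<Rightarrow> real^'n) \<Rightarrow>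
     ('r \<Rightarrow> real^'n \<Rightarrow> real) \<Rightarrow> 'r \<Rightarrow> (real^'n) multiset \<Rightarrow> real"
  where "induced_map G \<rho> \<sigma> j M = \<sigma> j (inv_into UNIV (orbit_tuple G \<rho>) M)"

lemma induced_map_orbit_tuple:
  assumes "finite_group_rep G \<rho>" "homogeneous_generators G \<rho> \<sigma> dg"
  shows "induced_map G \<rho> \<sigma> j (orbit_tuple G \<rho> p) = \<sigma> j p"
proof -
  interpret group_action G UNIV \<rho>
    using assms(1) by (simp add: finite_group_rep_def)
  interpret group_hom G "BijGroup UNIV" \<rho> by (rule group_hom)
  have fin: "finite (carrier G)" using assms(1) by (simp add: finite_group_rep_def)
  define q where "q = inv_into UNIV (orbit_tuple G \<rho>) (orbit_tuple G \<rho> p)"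
  have "orbit_tuple G \<rho> q = orbit_tuple G \<rho> p"
    unfolding q_def by (rule f_inv_into_f) simp
  then have "(\<lambda>g. \<rho> g q) ` carrier G = (\<lambda>g. \<rho> g p) ` carrier G"
    using fin by (metis orbit_tuple_def finite_set_mset_mset_set set_image_mset)
  moreover have "\<rho> \<one>\<^bsub>G\<^esub> p = p"
    by (metis id_eq_one UNIV_I restrict_apply)
  ultimately obtain g where g: "g \<in> carrier G" "p = \<rho> g q"
    by (metis (no_types, lifting) G.one_closed image_iff)
  have "\<sigma> j \<in> algebra_generated (range \<sigma>)"
    by (simp add: algebra_generated.base)
  then have "\<sigma> j \<in> invariant_polynomials G \<rho>"
    using assms(2) by (simp add: homogeneous_generators_def)
  then have "\<sigma> j p = \<sigma> j q"
    using g by (simp add: invariant_polynomials_def)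
  then show ?thesis
    unfolding induced_map_def q_def by (rule sym)
qed


section \<open>Functions of class \<open>C\<^sup>k\<close> and \<open>C\<^sup>k\<^sup>,\<^sup>1\<close>\<close>

definition pdiff :: "'m \<Rightarrow> (real^'m \<Rightarrow> real) \<Rightarrow> real^'m \<Rightarrow> real"
  where "pdiff i f x = deriv (\<lambda>t. f (x + t *\<^sub>R axis i 1)) 0"

text \<open>
  Partial derivatives of order \<open>k\<close> are indexed by lists of \<open>k\<close> directions instead of multi-indices
  of modulus \<open>k\<close>. For functions of class \<open>C\<^sup>k\<close> the order of the directions is irrelevant.
\<close>

abbreviation pdiffs :: "'m list \<Rightarrow> (real^'m \<Rightarrow> real) \<Rightarrow> real^'m \<Rightarrow> real"
  where "pdiffs is f \<equiv> foldr pdiff is f"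

definition Ck_on :: "nat \<Rightarrow> (real^'m) set \<Rightarrow> (real^'m \<Rightarrow> real) \<Rightarrow> bool"
  where "Ck_on k \<Omega> f \<longleftrightarrow>
    (\<forall>is. length is \<le> k \<longrightarrow> continuous_on \<Omega> (pdiffs is f)) \<and>
    (\<forall>is i. length is < k \<longrightarrow>
       (\<forall>x\<in>\<Omega>. (\<lambda>t. pdiffs is f (x + t *\<^sub>R axis i 1)) differentiable (at 0)))"

text \<open>The space \<open>C\<^sup>k\<^sup>,\<^sup>1\<close> of the closure of the open set \<open>\<Omega>\<close>.\<close>

definition Ck1_closure :: "nat \<Rightarrow> (real^'m) set \<Rightarrow> (real^'m \<Rightarrow> real) \<Rightarrow> bool"
  where "Ck1_closure k \<Omega> f \<longleftrightarrow> Ck_on k \<Omega> f \<and>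
    (\<forall>is. length is \<le> k \<longrightarrow>
       (\<exists>h. continuous_on (closure \<Omega>) h \<and> (\<forall>x\<in>\<Omega>. h x = pdiffs is f x)) \<and>
       (\<exists>L. L-lipschitz_on \<Omega> (pdiffs is f)))"

definition Lip_const :: "(real^'m) set \<Rightarrow> (real^'m \<Rightarrow> real) \<Rightarrow> real"
  where "Lip_const \<Omega> f = Inf {L. L-lipschitz_on \<Omega> f}"

definition Ck1_norm :: "nat \<Rightarrow> (real^'m) set \<Rightarrow> (real^'m \<Rightarrow> real) \<Rightarrow> real"
  where "Ck1_norm k \<Omega> f =
    Max ((\<lambda>is. SUP x\<in>\<Omega>. \<bar>pdiffs is f x\<bar>) ` {is. length is \<le> k}) +
    Max ((\<lambda>is. Lip_const \<Omega> (pdiffs is f)) ` {is. length is = k})"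


section \<open>Sobolev functions of class \<open>W\<^sup>1\<^sup>,\<^sup>\<infinity>\<close>\<close>

definition Linf_norm :: "(real^'m) set \<Rightarrow> (real^'m \<Rightarrow> real) \<Rightarrow> ennreal"
  where "Linf_norm \<Omega> u = esssup (lebesgue_on \<Omega>) (\<lambda>x. ennreal \<bar>u x\<bar>)"

definition Linf :: "(real^'m) set \<Rightarrow> (real^'m \<Rightarrow> real) set"
  where "Linf \<Omega> = {u \<in> borel_measurable (lebesgue_on \<Omega>). Linf_norm \<Omega> u < \<infinity>}"

definition test_functions :: "(real^'m) set \<Rightarrow> (real^'m \<Rightarrow> real) set"
  where "test_functions \<Omega> =
    {\<phi>. (\<forall>k. Ck_on k UNIV \<phi>) \<and> compact (closure {x. \<phi> x \<noteq> 0}) \<and> closure {x. \<phi> x \<noteq> 0} \<subseteq> \<Omega>}"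

definition locally_integrable :: "(real^'m) set \<Rightarrow> (real^'m \<Rightarrow> real) \<Rightarrow> bool"
  where "locally_integrable \<Omega> u \<longleftrightarrow>
    (\<forall>K. compact K \<and> K \<subseteq> \<Omega> \<longrightarrow> set_integrable lebesgue K u)"

definition has_weak_pdiff ::
    "(real^'m) set \<Rightarrow> 'm \<Rightarrow> (real^'m \<Rightarrow> real) \<Rightarrow> (real^'m \<Rightarrow> real) \<Rightarrow> bool"
  where "has_weak_pdiff \<Omega> j u v \<longleftrightarrow>
    locally_integrable \<Omega> u \<and> locally_integrable \<Omega> v \<and>
    (\<forall>\<phi>\<in>test_functions \<Omega>.
       (LINT x:\<Omega>|lebesgue. u x * pdiff j \<phi> x) = - (LINT x:\<Omega>|lebesgue. v x * \<phi> x))"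

definition W1inf :: "(real^'m) set \<Rightarrow> (real^'m \<Rightarrow> real) set"
  where "W1inf \<Omega> = {u \<in> Linf \<Omega>. \<forall>j. \<exists>v\<in>Linf \<Omega>. has_weak_pdiff \<Omega> j u v}"

text \<open>
  The functions \<open>\<phi>\<close> admissible as \<open>\<phi>\<^sub>j\<close> in the definition of a Sobolev function with values in
  unordered \<open>Q\<close>-tuples. Weak derivatives are determined almost everywhere, so it does not matter
  which one is chosen.
\<close>

definition dominates_pdiff ::
    "(real^'m) set \<Rightarrow> nat \<Rightarrow> (real^'m \<Rightarrow> (real^'n) multiset) \<Rightarrow> 'm \<Rightarrow> (real^'m \<Rightarrow> real) \<Rightarrow> bool"
  where "dominates_pdiff \<Omega> Q f j \<phi> \<longleftrightarrow>
    \<phi> \<in> Linf \<Omega> \<and> (\<forall>x\<in>\<Omega>. 0 \<le> \<phi> x) \<and>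
    (\<forall>P\<in>unordered_tuples Q. \<forall>v. has_weak_pdiff \<Omega> j (\<lambda>x. tuple_dist (f x) P) v \<longrightarrow>
       (AE x in lebesgue_on \<Omega>. \<bar>v x\<bar> \<le> \<phi> x))"

definition W1inf_tuples ::
    "(real^'m) set \<Rightarrow> nat \<Rightarrow> (real^'m \<Rightarrow> (real^'n) multiset) set"
  where "W1inf_tuples \<Omega> Q =
    {f. f \<in> lebesgue_on \<Omega> \<rightarrow>\<^sub>M
          sigma (unordered_tuples Q)
            {U. openin (Metric_space.mtopology (unordered_tuples Q) tuple_dist) U} \<and>
        (\<forall>P\<in>unordered_tuples Q. (\<lambda>x. tuple_dist (f x) P) \<in> W1inf \<Omega>) \<and>
        (\<forall>j. \<exists>\<phi>. dominates_pdiff \<Omega> Q f j \<phi>)}"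

definition W1inf_orbit_tuples ::
    "('g, 'z) monoid_scheme \<Rightarrow> ('g \<Rightarrow> real^'n \<Rightarrow> real^'n) \<Rightarrow>
     (real^'m) set \<Rightarrow> (real^'m \<Rightarrow> (real^'n) multiset) set"
  where "W1inf_orbit_tuples G \<rho> \<Omega> =
    {f \<in> W1inf_tuples \<Omega> (card (carrier G)). f ` \<Omega> \<subseteq> orbit_tuples G \<rho>}"

text \<open>
  The minimal dominating function \<open>|\<partial>\<^sub>jf|\<close>, determined almost everywhere.
\<close>

definition tuple_pdiff_norm ::
    "(real^'m) set \<Rightarrow> nat \<Rightarrow> (real^'m \<Rightarrow> (real^'n) multiset) \<Rightarrow> 'm \<Rightarrow> real^'m \<Rightarrow> real"
  where "tuple_pdiff_norm \<Omega> Q f j = (SOME \<phi>. dominates_pdiff \<Omega> Q f j \<phi> \<and>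
    (\<forall>\<psi>. dominates_pdiff \<Omega> Q f j \<psi> \<longrightarrow> (AE x in lebesgue_on \<Omega>. \<phi> x \<le> \<psi> x)))"

definition tuple_diff_norm ::
    "(real^'m) set \<Rightarrow> nat \<Rightarrow> (real^'m \<Rightarrow> (real^'n) multiset) \<Rightarrow> real^'m \<Rightarrow> real"
  where "tuple_diff_norm \<Omega> Q f x = sqrt (\<Sum>j\<in>UNIV. (tuple_pdiff_norm \<Omega> Q f j x)\<^sup>2)"

end

theory Submission
  imports Defs "HOL-Computational_Algebra.Polynomial"
begin

text \<open>
  On each line parallel to an axis choose an arbitrary lift \<open>p\<close> of \<open>f\<close>. Locally, the orbit distance
  of \<open>p t\<close> and \<open>p 0\<close> is at most \<open>C \<bar>t\<bar>\<close>, where \<open>C\<close> depends only on the \<open>C\<^sup>d\<^sup>-\<^sup>1\<^sup>,\<^sup>1\<close>-bounds of the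
  invariants along the line; this is shown by induction on the order of the group. After splitting
  off the linear invariants (the fixed part), let \<open>N x\<close> be the sum of the squared norms of the points of the orbit of \<open>x\<close>. If
  \<open>N (p 0) = 0\<close>, then \<open>N (p t)\<close> is quadratically small. Otherwise Glaeser's inequality makes \<open>N (p t)\<close>
  comparable to \<open>r\<^sup>2 = N (p 0)\<close> for \<open>\<bar>t\<bar> \<le> c r\<close>, and, as all degrees are at most \<open>d\<close>, interpolation bounds
  the invariants of the rescaled lift \<open>p (c r s) / r\<close>, which starts on the unit sphere of \<open>N\<close>. Near
  a point \<open>v\<close> of that sphere orbits of \<open>G\<close> are orbits of the stabilizer of \<open>v\<close>, a proper subgroup.
  Its invariants are generated by the homogeneous parts, of degree at most \<open>d\<close>, of the expansions
  of the generators at \<open>v\<close>, and each of them is a simple root of a polynomial whose coefficients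
  are \<open>G\<close>-invariant, so that it has the same regularity along the lift.

  The distances to fixed tuples are thus uniformly Lipschitz along the axes; weak cluster points
  of their difference quotients are bounded weak derivatives.
\<close>


section \<open>Functions of class \<open>C\<^sup>k\<^sup>,\<^sup>1\<close> on an interval\<close>

text \<open>The lifts are arbitrary selections and may jump, so the key estimate compares a lift
  only with its value at one point: the constant is uniform, while the radius may depend on the
  lift. This weak form survives the induction, and it suffices at the end, because increments of a
  real function that are controlled around every point of a segment by one constant add up along the
  segment. For the same reason all bounds are quantified as "there is \<open>N\<close> such that for
  all curves": compactness and induction only ever see the order and \<open>M\<close>. The degree
  bound \<open>d\<close> has two effects. Expansions at \<open>v\<close> do not exceed it, so the
  order d - 1 is the same for every stabilizer; and rescaling by a radius r gains r^d in the top
  Lipschitz constant while homogeneity costs at most r^e with e \<le> d. The exponents 1 / d_j come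
  from dividing the lift by a single number that makes all invariants bounded by 1; this number then
  enters the estimate linearly.\<close>

abbreviation unit_interval :: "real set" where "unit_interval \<equiv> {-1<..<1}"

text \<open>One number \<open>M\<close> bounds the derivatives of order at most \<open>k\<close> and
  the Lipschitz constant of the last one; Lipschitz bounds in lower orders follow from the bound on
  the next derivative. The derivative is an existential witness instead of \<open>deriv\<close>, so
  only its values inside the interval matter.\<close>

primrec ck1 :: "nat \<Rightarrow> real \<Rightarrow> (real \<Rightarrow> real) \<Rightarrow> bool" where
  "ck1 0 M u \<longleftrightarrow> (\<forall>t\<in>unit_interval. \<bar>u t\<bar> \<le> M) \<and>
     (\<forall>s\<in>unit_interval. \<forall>t\<in>unit_interval. \<bar>u s - u t\<bar> \<le> M * \<bar>s - t\<bar>)"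
| "ck1 (Suc k) M u \<longleftrightarrow> (\<forall>t\<in>unit_interval. \<bar>u t\<bar> \<le> M) \<and>
     (\<exists>u'. (\<forall>t\<in>unit_interval. (u has_real_derivative u' t) (at t)) \<and> ck1 k M u')"

lemma ck1_0I:
  assumes "\<And>t. t \<in> unit_interval \<Longrightarrow> \<bar>u t\<bar> \<le> M"
    "\<And>s t. s \<in> unit_interval \<Longrightarrow> t \<in> unit_interval \<Longrightarrow> \<bar>u s - u t\<bar> \<le> M * \<bar>s - t\<bar>"
  shows "ck1 0 M u"
  unfolding ck1.simps using assms by blast

lemma ck1_SucI:
  assumes "\<And>t. t \<in> unit_interval \<Longrightarrow> \<bar>u t\<bar> \<le> M"
    "\<And>t. t \<in> unit_interval \<Longrightarrow> (u has_real_derivative u' t) (at t)" "ck1 k M u'"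
  shows "ck1 (Suc k) M u"
  unfolding ck1.simps using assms by blast

lemma ck1_bounded: "ck1 k M u \<Longrightarrow> t \<in> unit_interval \<Longrightarrow> \<bar>u t\<bar> \<le> M"
  by (cases k) auto

lemma ck1_nonneg: "ck1 k M u \<Longrightarrow> 0 \<le> M"
  using ck1_bounded[of k M u 0] by auto

lemma derivative_bound_imp_lip:
  assumes "\<And>t. t \<in> unit_interval \<Longrightarrow> (u has_real_derivative u' t) (at t)"
    and "\<And>t. t \<in> unit_interval \<Longrightarrow> \<bar>u' t\<bar> \<le> M"
    and "s \<in> unit_interval" "t \<in> unit_interval"
  shows "\<bar>u s - u t\<bar> \<le> M * \<bar>s - t\<bar>"
  using field_differentiable_bound[of unit_interval u u' M s t] assms
  by (auto simp: has_field_derivative_at_within)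

lemma ck1_SucE:
  assumes "ck1 (Suc k) M u"
  obtains u' where "\<And>t. t \<in> unit_interval \<Longrightarrow> (u has_real_derivative u' t) (at t)" "ck1 k M u'"
  using assms unfolding ck1.simps by blast

lemma ck1_lip:
  assumes "ck1 k M u" and st: "s \<in> unit_interval" "t \<in> unit_interval"
  shows "\<bar>u s - u t\<bar> \<le> M * \<bar>s - t\<bar>"
proof (cases k)
  case 0
  then show ?thesis using assms by simp
next
  case (Suc l)
  then have "ck1 (Suc l) M u" using assms by simp
  then obtain u' where u': "\<And>t. t \<in> unit_interval \<Longrightarrow> (u has_real_derivative u' t) (at t)" "ck1 l M u'"
    using ck1_SucE by blast
  show ?thesis by (rule derivative_bound_imp_lip[OF u'(1) ck1_bounded[OF u'(2)] st])
qed

lemma ck1_SucD: "ck1 (Suc k) M u \<Longrightarrow> ck1 k M u"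
proof (induction k arbitrary: u)
  case 0
  then show ?case using ck1_lip[OF 0] by auto
next
  case (Suc k)
  obtain u' where "\<forall>t\<in>unit_interval. (u has_real_derivative u' t) (at t)" "ck1 (Suc k) M u'"
    using Suc.prems by auto
  then show ?case using Suc by auto
qed

lemma ck1_mono: "ck1 k M u \<Longrightarrow> M \<le> N \<Longrightarrow> ck1 k N u"
proof (induction k arbitrary: u)
  case 0
  have "\<bar>u s - u t\<bar> \<le> N * \<bar>s - t\<bar>" if "s \<in> unit_interval" "t \<in> unit_interval" for s t
    using ck1_lip[OF 0(1) that] mult_right_mono[OF 0(2), of "\<bar>s - t\<bar>"] by linarith
  then show ?case using ck1_bounded[OF 0(1)] 0(2) order_trans by (intro ck1_0I) blast+
next
  case (Suc k)
  obtain u' where u': "\<And>t. t \<in> unit_interval \<Longrightarrow> (u has_real_derivative u' t) (at t)" "ck1 k M u'"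
    using ck1_SucE[OF Suc.prems(1)] by blast
  have "\<bar>u t\<bar> \<le> N" if "t \<in> unit_interval" for t
    using ck1_bounded[OF Suc.prems(1) that] Suc.prems(2) by linarith
  then show ?case by (rule ck1_SucI[OF _ u'(1) Suc.IH[OF u'(2) Suc.prems(2)]])
qed

lemma ck1_cong: "ck1 k M u \<Longrightarrow> (\<And>t. t \<in> unit_interval \<Longrightarrow> u t = v t) \<Longrightarrow> ck1 k M v"
proof (cases k)
  case (Suc l)
  assume u: "ck1 k M u" and eq: "\<And>t. t \<in> unit_interval \<Longrightarrow> u t = v t"
  obtain u' where u': "\<forall>t\<in>unit_interval. (u has_real_derivative u' t) (at t)" "ck1 l M u'"
    using u Suc by auto
  have "(v has_real_derivative u' t) (at t)" if "t \<in> unit_interval" for t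
    by (rule has_field_derivative_transform_within_open[of u _ _ unit_interval]) (use u' that eq in auto)
  moreover have "\<bar>v t\<bar> \<le> M" if "t \<in> unit_interval" for t
    using ck1_bounded[OF u that] eq[OF that] by simp
  ultimately show ?thesis using u'(2) unfolding Suc by (intro ck1_SucI)
qed auto

lemma ck1_const: "\<bar>c\<bar> \<le> M \<Longrightarrow> ck1 k M (\<lambda>_. c)"
proof (induction k arbitrary: c)
  case (Suc k)
  have "ck1 k M (\<lambda>_. 0)" using Suc by auto
  then show ?case using Suc.prems by (auto intro!: exI[of _ "\<lambda>_. 0"])
qed auto

lemma ck1_add: "ck1 k M u \<Longrightarrow> ck1 k N v \<Longrightarrow> ck1 k (M + N) (\<lambda>t. u t + v t)"
proof (induction k arbitrary: u v)
  case 0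
  have b: "\<bar>u t + v t\<bar> \<le> M + N" if "t \<in> unit_interval" for t
    using 0 that by (auto intro!: order_trans[OF abs_triangle_ineq] add_mono)
  have "\<bar>u s + v s - (u t + v t)\<bar> \<le> (M + N) * \<bar>s - t\<bar>"
    if "s \<in> unit_interval" "t \<in> unit_interval" for s t
    using ck1_lip[OF 0(1) that] ck1_lip[OF 0(2) that] by (simp add: algebra_simps)
  with b show ?case by simp
next
  case (Suc k)
  obtain u' v' where
    "\<forall>t\<in>unit_interval. (u has_real_derivative u' t) (at t)" "ck1 k M u'"
    "\<forall>t\<in>unit_interval. (v has_real_derivative v' t) (at t)" "ck1 k N v'"
    using Suc.prems by auto
  then have "\<forall>t\<in>unit_interval. ((\<lambda>t. u t + v t) has_real_derivative u' t + v' t) (at t)"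
      "ck1 k (M + N) (\<lambda>t. u' t + v' t)"
    using Suc.IH by (auto intro: DERIV_add)
  moreover have "\<bar>u t + v t\<bar> \<le> M + N" if "t \<in> unit_interval" for t
    using ck1_bounded[OF Suc.prems(1) that] ck1_bounded[OF Suc.prems(2) that] by linarith
  ultimately show ?case by (auto simp del: greaterThanLessThan_iff)
qed

text \<open>Leibniz' rule replaces one product by two, so the factor doubles with each order; the
  initial 2 comes from the two terms in the Lipschitz estimate of a product.\<close>

lemma ck1_mult: "ck1 k M u \<Longrightarrow> ck1 k N v \<Longrightarrow> ck1 k (2 ^ Suc k * M * N) (\<lambda>t. u t * v t)"
proof (induction k arbitrary: u v)
  case 0
  have nn: "0 \<le> M" "0 \<le> N" using 0 ck1_nonneg by blast+
  have b: "\<bar>u t * v t\<bar> \<le> M * N" if "t \<in> unit_interval" for t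
    using ck1_bounded[OF 0(1) that] ck1_bounded[OF 0(2) that] nn by (simp add: abs_mult mult_mono)
  have "\<bar>u s * v s - u t * v t\<bar> \<le> 2 * M * N * \<bar>s - t\<bar>"
    if st: "s \<in> unit_interval" "t \<in> unit_interval" for s t
  proof -
    have "u s * v s - u t * v t = u s * (v s - v t) + (u s - u t) * v t" by (simp add: algebra_simps)
    also have "\<bar>\<dots>\<bar> \<le> \<bar>u s\<bar> * \<bar>v s - v t\<bar> + \<bar>u s - u t\<bar> * \<bar>v t\<bar>"
      by (metis abs_mult abs_triangle_ineq)
    also have "\<dots> \<le> M * (N * \<bar>s - t\<bar>) + (M * \<bar>s - t\<bar>) * N"
      using ck1_bounded[OF 0(1) st(1)] ck1_lip[OF 0(1) st] ck1_bounded[OF 0(2) st(2)] ck1_lip[OF 0(2) st] nn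
      by (intro add_mono mult_mono) auto
    finally show ?thesis by (simp add: algebra_simps)
  qed
  moreover have "M * N \<le> 2 * M * N" using nn by simp
  then have "\<bar>u t * v t\<bar> \<le> 2 * M * N" if "t \<in> unit_interval" for t
    using b[OF that] by linarith
  ultimately show ?case by simp
next
  case (Suc k)
  have nn: "0 \<le> M" "0 \<le> N" using Suc.prems ck1_nonneg by blast+
  obtain u' v' where
    *: "\<forall>t\<in>unit_interval. (u has_real_derivative u' t) (at t)" "ck1 k M u'"
    "\<forall>t\<in>unit_interval. (v has_real_derivative v' t) (at t)" "ck1 k N v'"
    using Suc.prems by auto
  have 1: "\<forall>t\<in>unit_interval. ((\<lambda>t. u t * v t) has_real_derivative u' t * v t + v' t * u t) (at t)"
    using * by (auto intro: DERIV_mult)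
  have 2: "ck1 k (2 ^ Suc (Suc k) * M * N) (\<lambda>t. u' t * v t + v' t * u t)"
    using ck1_add[OF Suc.IH[OF *(2) ck1_SucD[OF Suc.prems(2)]] Suc.IH[OF ck1_SucD[OF Suc.prems(1)] *(4)]]
    by (simp add: algebra_simps)
  have "\<bar>u t * v t\<bar> \<le> 1 * (M * N)" if "t \<in> unit_interval" for t
    using ck1_bounded[OF Suc.prems(1) that] ck1_bounded[OF Suc.prems(2) that] nn
    by (simp add: abs_mult mult_mono)
  moreover have "1 * (M * N) \<le> 2 ^ Suc (Suc k) * (M * N)"
    using nn by (intro mult_right_mono one_le_power) auto
  ultimately have "\<bar>u t * v t\<bar> \<le> 2 ^ Suc (Suc k) * M * N" if "t \<in> unit_interval" for t
    using that by (smt (verit) mult.assoc)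
  then show ?case using 1 2 by (intro ck1_SucI) blast+
qed

lemma ck1_cmult: "ck1 k M u \<Longrightarrow> ck1 k (\<bar>c\<bar> * M) (\<lambda>t. c * u t)"
proof (induction k arbitrary: u)
  case 0
  have "\<bar>c * u s - c * u t\<bar> \<le> \<bar>c\<bar> * M * \<bar>s - t\<bar>"
    if st: "s \<in> unit_interval" "t \<in> unit_interval" for s t
    using ck1_lip[OF 0 st] by (simp add: abs_mult mult_left_mono mult.assoc flip: right_diff_distrib)
  then show ?case using 0 by (auto simp: abs_mult mult_left_mono)
next
  case (Suc k)
  obtain u' where
    *: "\<forall>t\<in>unit_interval. (u has_real_derivative u' t) (at t)" "ck1 k M u'"
    using Suc.prems by auto
  then have "\<forall>t\<in>unit_interval. ((\<lambda>t. c * u t) has_real_derivative c * u' t) (at t)"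
    by (auto intro!: derivative_eq_intros)
  moreover have "\<forall>t\<in>unit_interval. \<bar>c * u t\<bar> \<le> \<bar>c\<bar> * M"
    using ck1_bounded[OF Suc.prems] by (auto simp: abs_mult mult_left_mono)
  ultimately show ?case using Suc.IH[OF *(2)] by (intro ck1_SucI) blast+
qed

lemma ck1_sum:
  assumes "finite J" "\<And>i. i \<in> J \<Longrightarrow> ck1 k M (f i)"
  shows "ck1 k (real (card J) * M) (\<lambda>t. \<Sum>i\<in>J. f i t)"
  using assms
proof (induction J)
  case empty
  show ?case by (simp add: ck1_const)
next
  case (insert j J)
  have "ck1 k (M + real (card J) * M) (\<lambda>t. f j t + (\<Sum>i\<in>J. f i t))"
    by (rule ck1_add) (use insert in auto)
  then show ?case using insert by (simp add: algebra_simps)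
qed

text \<open>The bound is chosen before \<open>u\<close>. Here and below, constants depend on the
  order, on \<open>M\<close> and on the polynomials involved, never on the curve.\<close>

lemma ck1_power: "\<exists>N. \<forall>u. ck1 k M u \<longrightarrow> ck1 k N (\<lambda>t. u t ^ i)"
proof (induction i)
  case 0
  show ?case using ck1_const[of 1 1 k] by auto
next
  case (Suc i)
  then obtain N where "\<forall>u. ck1 k M u \<longrightarrow> ck1 k N (\<lambda>t. u t ^ i)" by blast
  then have "\<forall>u. ck1 k M u \<longrightarrow> ck1 k (2 ^ Suc k * M * N) (\<lambda>t. u t ^ Suc i)"
    using ck1_mult[where k=k and M=M and N=N] by auto
  then show ?case by blast
qed

text \<open>The derivative of 1/u is -u'/u^2, which contains 1/u to one order less, so induction and
  \<open>ck1_mult\<close> apply. The lower bound \<open>c\<close> keeps the constant independent of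
  \<open>u\<close>.\<close>

lemma ck1_inverse:
  assumes "0 < c"
  shows "\<exists>N. \<forall>u. ck1 k M u \<longrightarrow> (\<forall>t\<in>unit_interval. c \<le> \<bar>u t\<bar>) \<longrightarrow> ck1 k N (\<lambda>t. inverse (u t))"
proof (induction k)
  case 0
  show ?case
  proof (intro exI allI impI)
    fix u assume u: "ck1 0 M u" and c: "\<forall>t\<in>unit_interval. c \<le> \<bar>u t\<bar>"
    have M: "0 \<le> M" using u ck1_nonneg by blast
    have b: "\<bar>inverse (u t)\<bar> \<le> inverse c" if "t \<in> unit_interval" for t
    proof -
      have "inverse \<bar>u t\<bar> \<le> inverse c" using c that assms by (intro le_imp_inverse_le) auto
      then show ?thesis by simp
    qed
    have "\<bar>inverse (u s) - inverse (u t)\<bar> \<le> inverse c * M * inverse c * \<bar>s - t\<bar>"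
      if st: "s \<in> unit_interval" "t \<in> unit_interval" for s t
    proof -
      have "u s \<noteq> 0" "u t \<noteq> 0" using c st assms by force+
      then have "\<bar>inverse (u s) - inverse (u t)\<bar> = \<bar>inverse (u s)\<bar> * \<bar>u s - u t\<bar> * \<bar>inverse (u t)\<bar>"
        by (simp add: inverse_diff_inverse abs_mult)
      also have "\<dots> \<le> inverse c * (M * \<bar>s - t\<bar>) * inverse c"
        using b[OF st(1)] b[OF st(2)] ck1_lip[OF u st] assms M by (intro mult_mono) auto
      finally show ?thesis by (simp add: mult_ac)
    qed
    moreover have "inverse c * M * inverse c * \<bar>s - t\<bar> \<le> (inverse c + inverse c * M * inverse c) * \<bar>s - t\<bar>" for s t
      using assms by (intro mult_right_mono) auto
    ultimately have "\<bar>inverse (u s) - inverse (u t)\<bar> \<le> (inverse c + inverse c * M * inverse c) * \<bar>s - t\<bar>"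
      if "s \<in> unit_interval" "t \<in> unit_interval" for s t
      using that order_trans by blast
    moreover have "inverse c \<le> inverse c + inverse c * M * inverse c" using assms M by simp
    then have "\<bar>inverse (u t)\<bar> \<le> inverse c + inverse c * M * inverse c" if "t \<in> unit_interval" for t
      using b[OF that] by linarith
    ultimately show "ck1 0 (inverse c + inverse c * M * inverse c) (\<lambda>t. inverse (u t))"
      unfolding ck1.simps(1) by blast
  qed
next
  case (Suc k)
  then obtain N where N: "\<And>u. ck1 k M u \<Longrightarrow> (\<forall>t\<in>unit_interval. c \<le> \<bar>u t\<bar>) \<Longrightarrow> ck1 k N (\<lambda>t. inverse (u t))"
    by blast
  define N2 where "N2 = 2 ^ Suc k * N * (2 ^ Suc k * (\<bar>-1\<bar> * M) * N)"
  show ?case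
  proof (intro exI allI impI)
    fix u assume u: "ck1 (Suc k) M u" and c: "\<forall>t\<in>unit_interval. c \<le> \<bar>u t\<bar>"
    obtain u' where
      *: "\<forall>t\<in>unit_interval. (u has_real_derivative u' t) (at t)" "ck1 k M u'"
      using u by auto
    have iu: "ck1 k N (\<lambda>t. inverse (u t))" using N[OF ck1_SucD[OF u] c] .
    have "ck1 k N2 (\<lambda>t. inverse (u t) * ((- 1 * u' t) * inverse (u t)))"
      unfolding N2_def by (rule ck1_mult[OF iu ck1_mult[OF ck1_cmult[OF *(2)] iu]])
    then have 1: "ck1 k (max N2 (inverse c)) (\<lambda>t. inverse (u t) * ((- 1 * u' t) * inverse (u t)))"
      by (rule ck1_mono) simp
    have 2: "((\<lambda>t. inverse (u t)) has_real_derivative inverse (u t) * ((- 1 * u' t) * inverse (u t))) (at t)"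
      if "t \<in> unit_interval" for t
    proof -
      have "u t \<noteq> 0" using c that assms by force
      then show ?thesis using *(1) that by (auto intro!: derivative_eq_intros)
    qed
    have b: "\<bar>inverse (u t)\<bar> \<le> max N2 (inverse c)" if "t \<in> unit_interval" for t
    proof -
      have "inverse \<bar>u t\<bar> \<le> inverse c" using c that assms by (intro le_imp_inverse_le) auto
      then have "\<bar>inverse (u t)\<bar> \<le> inverse c" by simp
      then show ?thesis by linarith
    qed
    show "ck1 (Suc k) (max N2 (inverse c)) (\<lambda>t. inverse (u t))"
      by (rule ck1_SucI[OF b 2 1])
  qed
qed

lemma scaled_unit_interval:
  assumes "0 \<le> \<kappa>" "\<kappa> \<le> 1" "t \<in> unit_interval"
  shows "\<kappa> * t \<in> unit_interval"
proof -
  have "\<bar>\<kappa> * t\<bar> \<le> 1 * \<bar>t\<bar>" unfolding abs_mult using assms by (intro mult_right_mono) auto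
  moreover have "\<bar>t\<bar> < 1" using assms(3) by (simp add: abs_less_iff)
  ultimately have "\<bar>\<kappa> * t\<bar> < 1" by linarith
  then show ?thesis by (simp add: abs_less_iff)
qed

text \<open>The chain rule multiplies the derivatives by powers of \<open>\<kappa> \<le> 1\<close>,
  so no bound grows and \<open>M\<close> is kept.\<close>

lemma ck1_rescale:
  assumes "0 \<le> \<kappa>" "\<kappa> \<le> 1"
  shows "ck1 k M u \<Longrightarrow> ck1 k M (\<lambda>t. u (\<kappa> * t))"
proof -
  note in_I = scaled_unit_interval[OF assms]
  show "ck1 k M u \<Longrightarrow> ck1 k M (\<lambda>t. u (\<kappa> * t))"
  proof (induction k arbitrary: u)
    case 0
    have "\<bar>u (\<kappa> * s) - u (\<kappa> * t)\<bar> \<le> M * \<bar>s - t\<bar>"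
      if st: "s \<in> unit_interval" "t \<in> unit_interval" for s t
    proof -
      have "\<bar>u (\<kappa> * s) - u (\<kappa> * t)\<bar> \<le> M * \<bar>\<kappa> * s - \<kappa> * t\<bar>"
        by (rule ck1_lip[OF 0 in_I[OF st(1)] in_I[OF st(2)]])
      also have "\<bar>\<kappa> * s - \<kappa> * t\<bar> = \<kappa> * \<bar>s - t\<bar>"
        using assms by (simp add: abs_mult flip: right_diff_distrib)
      also have "M * (\<kappa> * \<bar>s - t\<bar>) \<le> M * (1 * \<bar>s - t\<bar>)"
        using assms ck1_nonneg[OF 0] by (intro mult_left_mono mult_right_mono) auto
      finally show ?thesis by simp
    qed
    then show ?case using ck1_bounded[OF 0 in_I] by (intro ck1_0I)
  next
    case (Suc k)
    obtain u' where
      *: "\<forall>t\<in>unit_interval. (u has_real_derivative u' t) (at t)" "ck1 k M u'"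
      using Suc.prems by auto
    show ?case
    proof (rule ck1_SucI[where u' = "\<lambda>t. \<kappa> * u' (\<kappa> * t)"])
      show "((\<lambda>t. u (\<kappa> * t)) has_real_derivative \<kappa> * u' (\<kappa> * t)) (at t)" if "t \<in> unit_interval" for t
        using DERIV_chain2[OF bspec[OF *(1) in_I[OF that]] DERIV_cmult_Id[of \<kappa> t]]
        by (simp add: mult.commute)
      show "ck1 k M (\<lambda>t. \<kappa> * u' (\<kappa> * t))"
      proof (rule ck1_mono[OF ck1_cmult[OF Suc.IH[OF *(2)]]])
        show "\<bar>\<kappa>\<bar> * M \<le> M"
          using assms ck1_nonneg[OF *(2)] mult_right_mono[of \<kappa> 1 M] by simp
      qed
      show "\<bar>u (\<kappa> * t)\<bar> \<le> M" if "t \<in> unit_interval" for t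
        using ck1_bounded[OF Suc.prems in_I[OF that]] .
    qed
  qed
qed

text \<open>Only the highest derivative is controlled, \<open>U\<close> being the chain of
  derivatives. Division by powers of a small radius destroys bounds on the lower derivatives,
  whereas this constant gains the full power of the scaling factor; the lower bounds are recovered
  by interpolation.\<close>

definition top_lip :: "nat \<Rightarrow> real \<Rightarrow> (real \<Rightarrow> real) \<Rightarrow> bool" where
  "top_lip k L u \<longleftrightarrow> (\<exists>U. U 0 = u \<and>
     (\<forall>i<k. \<forall>t\<in>unit_interval. (U i has_real_derivative U (Suc i) t) (at t)) \<and>
     (\<forall>s\<in>unit_interval. \<forall>t\<in>unit_interval. \<bar>U k s - U k t\<bar> \<le> L * \<bar>s - t\<bar>))"

lemma top_lip_mono: "top_lip k L u \<Longrightarrow> L \<le> L' \<Longrightarrow> top_lip k L' u"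
proof -
  assume "top_lip k L u" and L: "L \<le> L'"
  then obtain U where U: "U 0 = u"
     "\<forall>i<k. \<forall>t\<in>unit_interval. (U i has_real_derivative U (Suc i) t) (at t)"
     "\<And>s t. s\<in>unit_interval \<Longrightarrow> t\<in>unit_interval \<Longrightarrow> \<bar>U k s - U k t\<bar> \<le> L * \<bar>s - t\<bar>"
    unfolding top_lip_def by blast
  have "\<bar>U k s - U k t\<bar> \<le> L' * \<bar>s - t\<bar>" if "s \<in> unit_interval" "t \<in> unit_interval" for s t
    using U(3)[OF that] mult_right_mono[OF L, of "\<bar>s - t\<bar>"] by linarith
  then show ?thesis unfolding top_lip_def using U(1,2) by blast
qed

lemma ck1_imp_top_lip: "ck1 k M u \<Longrightarrow> top_lip k M u"
proof (induction k arbitrary: u)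
  case 0
  then show ?case unfolding top_lip_def by (intro exI[of _ "\<lambda>_. u"]) auto
next
  case (Suc k)
  obtain u' where u': "\<And>t. t \<in> unit_interval \<Longrightarrow> (u has_real_derivative u' t) (at t)" "ck1 k M u'"
    using ck1_SucE[OF Suc.prems(1)] by blast
  obtain U where U: "U 0 = u'"
     "\<forall>i<k. \<forall>t\<in>unit_interval. (U i has_real_derivative U (Suc i) t) (at t)"
     "\<forall>s\<in>unit_interval. \<forall>t\<in>unit_interval. \<bar>U k s - U k t\<bar> \<le> M * \<bar>s - t\<bar>"
    using Suc.IH[OF u'(2)] unfolding top_lip_def by blast
  define V where "V = case_nat u U"
  have "V 0 = u" "V (Suc k) = U k" by (simp_all add: V_def)
  moreover have "(V i has_real_derivative V (Suc i) t) (at t)" if "i < Suc k" "t \<in> unit_interval" for i t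
  proof (cases i)
    case 0
    then show ?thesis using u'(1)[OF that(2)] U(1) by (simp add: V_def)
  next
    case (Suc j)
    then show ?thesis using U(2) that by (simp add: V_def)
  qed
  ultimately show ?case unfolding top_lip_def using U(3) by (intro exI[of _ V]) simp
qed

text \<open>Each of the \<open>k\<close> differentiations gives a factor \<open>\<kappa>\<close> and
  the Lipschitz condition gives one more. In the application \<open>Suc k\<close> is the degree
  bound \<open>d\<close>.\<close>

lemma top_lip_rescale:
  assumes "0 \<le> \<kappa>" "\<kappa> \<le> 1" "top_lip k L u"
  shows "top_lip k (\<bar>a\<bar> * \<kappa> ^ Suc k * L) (\<lambda>t. a * u (\<kappa> * t))"
proof -
  obtain U where U: "U 0 = u"
     "\<forall>i<k. \<forall>t\<in>unit_interval. (U i has_real_derivative U (Suc i) t) (at t)"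
     "\<forall>s\<in>unit_interval. \<forall>t\<in>unit_interval. \<bar>U k s - U k t\<bar> \<le> L * \<bar>s - t\<bar>"
    using assms(3) unfolding top_lip_def by blast
  note in_I = scaled_unit_interval[OF assms(1,2)]
  define V where "V i t = a * \<kappa> ^ i * U i (\<kappa> * t)" for i t
  have "(V i has_real_derivative V (Suc i) t) (at t)" if "i < k" "t \<in> unit_interval" for i t
    using DERIV_cmult[OF DERIV_chain2[OF U(2)[rule_format, OF that(1) in_I[OF that(2)]]
       DERIV_cmult_Id[of \<kappa> t]], of "a * \<kappa> ^ i"]
    unfolding V_def by (simp add: mult_ac)
  moreover have "\<bar>V k s - V k t\<bar> \<le> \<bar>a\<bar> * \<kappa> ^ Suc k * L * \<bar>s - t\<bar>"
    if st: "s \<in> unit_interval" "t \<in> unit_interval" for s t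
  proof -
    have "\<bar>V k s - V k t\<bar> = \<bar>a\<bar> * \<kappa> ^ k * \<bar>U k (\<kappa> * s) - U k (\<kappa> * t)\<bar>"
      unfolding V_def using assms(1) by (simp add: abs_mult flip: right_diff_distrib)
    also have "\<dots> \<le> \<bar>a\<bar> * \<kappa> ^ k * (L * \<bar>\<kappa> * s - \<kappa> * t\<bar>)"
      using U(3) in_I[OF st(1)] in_I[OF st(2)] assms(1) by (intro mult_left_mono) auto
    also have "\<bar>\<kappa> * s - \<kappa> * t\<bar> = \<kappa> * \<bar>s - t\<bar>"
      using assms(1) by (simp add: abs_mult flip: right_diff_distrib)
    finally show ?thesis by (simp add: mult_ac)
  qed
  moreover have "V 0 = (\<lambda>t. a * u (\<kappa> * t))" using U(1) by (auto simp: V_def)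
  ultimately show ?thesis unfolding top_lip_def by (intro exI[of _ V]) blast
qed

text \<open>By induction the derivative of order \<open>k\<close> is small at some point of each
  outer third of the interval. These points are at least l/3 apart, and the mean value theorem
  between them yields a point where the next derivative is small.\<close>

lemma derivative_small_somewhere:
  fixes A :: real
  shows "\<And>l::real. 0 < l \<Longrightarrow> \<exists>C. \<forall>(U::nat \<Rightarrow> real \<Rightarrow> real) a.
    (\<forall>i<k. \<forall>t\<in>{a..a+l}. (U i has_real_derivative U (Suc i) t) (at t)) \<longrightarrow>
    (\<forall>t\<in>{a..a+l}. \<bar>U 0 t\<bar> \<le> A) \<longrightarrow> (\<exists>\<xi>\<in>{a..a+l}. \<bar>U k \<xi>\<bar> \<le> C)"
proof (induction k)
  case 0
  then show ?case by (intro exI[of _ A] allI impI) (auto intro!: bexI)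
next
  case (Suc k)
  have l3: "0 < l / 3" using Suc.prems by simp
  obtain C where C: "\<And>(U::nat \<Rightarrow> real \<Rightarrow> real) a.
    \<lbrakk>\<And>i t. i < k \<Longrightarrow> t \<in> {a..a+l/3} \<Longrightarrow> (U i has_real_derivative U (Suc i) t) (at t);
    \<And>t. t \<in> {a..a+l/3} \<Longrightarrow> \<bar>U 0 t\<bar> \<le> A\<rbrakk> \<Longrightarrow> (\<exists>\<xi>\<in>{a..a+l/3}. \<bar>U k \<xi>\<bar> \<le> C)"
    using Suc.IH[OF l3] by blast
  show ?case
  proof (intro exI allI impI)
    fix U :: "nat \<Rightarrow> real \<Rightarrow> real" and a
    assume d: "\<forall>i<Suc k. \<forall>t\<in>{a..a+l}. (U i has_real_derivative U (Suc i) t) (at t)"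
      and A: "\<forall>t\<in>{a..a+l}. \<bar>U 0 t\<bar> \<le> A"
    have l: "0 < l" by fact
    have "\<exists>\<xi>\<in>{a..a+l/3}. \<bar>U k \<xi>\<bar> \<le> C"
      by (rule C) (use d A l in auto)
    then obtain x where x: "x \<in> {a..a+l/3}" "\<bar>U k x\<bar> \<le> C" by blast
    have "\<exists>\<xi>\<in>{a+2*l/3..a+2*l/3+l/3}. \<bar>U k \<xi>\<bar> \<le> C"
      by (rule C) (use d A l in auto)
    then obtain y where y: "y \<in> {a+2*l/3..a+2*l/3+l/3}" "\<bar>U k y\<bar> \<le> C" by blast
    have xy: "x < y" "l / 3 \<le> y - x" using x(1) y(1) l by auto
    obtain z where z: "x < z" "z < y" "U k y - U k x = (y - x) * U (Suc k) z"
      using MVT2[OF xy(1), of "U k" "U (Suc k)"] d x(1) y(1) by auto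
    have "l / 3 * \<bar>U (Suc k) z\<bar> \<le> (y - x) * \<bar>U (Suc k) z\<bar>"
      using xy by (intro mult_right_mono) auto
    also have "\<dots> = \<bar>U k y - U k x\<bar>" using z(3) xy by (simp add: abs_mult)
    also have "\<dots> \<le> 2 * C" using x(2) y(2) by linarith
    finally have "\<bar>U (Suc k) z\<bar> \<le> 2 * C / (l / 3)"
      using l by (simp add: field_simps)
    then show "\<exists>\<xi>\<in>{a..a+l}. \<bar>U (Suc k) \<xi>\<bar> \<le> 2 * C / (l / 3)"
      using z x(1) y(1) by (intro bexI[of _ z]) auto
  qed
qed

text \<open>The top derivative is small at one point and Lipschitz, hence bounded. Its bound is a
  Lipschitz constant one order lower, where the induction hypothesis applies; this is why
  \<open>B\<close> is generalised.\<close>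

lemma derivatives_interpolate:
  "\<exists>C. \<forall>U::nat \<Rightarrow> real \<Rightarrow> real.
    (\<forall>i<k. \<forall>t\<in>unit_interval. (U i has_real_derivative U (Suc i) t) (at t)) \<longrightarrow>
    (\<forall>s\<in>unit_interval. \<forall>t\<in>unit_interval. \<bar>U k s - U k t\<bar> \<le> B * \<bar>s - t\<bar>) \<longrightarrow>
    (\<forall>t\<in>unit_interval. \<bar>U 0 t\<bar> \<le> A) \<longrightarrow>
    (\<forall>i\<le>k. \<forall>t\<in>unit_interval. \<bar>U i t\<bar> \<le> C)"
proof (induction k arbitrary: B)
  case 0
  then show ?case by auto
next
  case (Suc k)
  obtain C1 where C1: "\<And>(U::nat \<Rightarrow> real \<Rightarrow> real) a.
    \<lbrakk>\<forall>i<Suc k. \<forall>t\<in>{a..a+1}. (U i has_real_derivative U (Suc i) t) (at t);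
    \<forall>t\<in>{a..a+1}. \<bar>U 0 t\<bar> \<le> A\<rbrakk> \<Longrightarrow> (\<exists>\<xi>\<in>{a..a+1}. \<bar>U (Suc k) \<xi>\<bar> \<le> C1)"
    using derivative_small_somewhere[of 1 "Suc k" A] by (metis zero_less_one)
  \<comment> \<open>2 is the length of the interval, over which the Lipschitz condition spreads the
    bound from a single point.\<close>
  define D where "D = C1 + 2 * \<bar>B\<bar>"
  obtain C2 where C2: "\<And>U::nat \<Rightarrow> real \<Rightarrow> real.
    \<lbrakk>\<forall>i<k. \<forall>t\<in>unit_interval. (U i has_real_derivative U (Suc i) t) (at t);
    \<forall>s\<in>unit_interval. \<forall>t\<in>unit_interval. \<bar>U k s - U k t\<bar> \<le> D * \<bar>s - t\<bar>;
    \<forall>t\<in>unit_interval. \<bar>U 0 t\<bar> \<le> A\<rbrakk> \<Longrightarrow>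
    (\<forall>i\<le>k. \<forall>t\<in>unit_interval. \<bar>U i t\<bar> \<le> C2)"
    using Suc.IH[of D] by blast
  show ?case
  proof (intro exI allI impI ballI)
    fix U :: "nat \<Rightarrow> real \<Rightarrow> real" and i t
    assume d: "\<forall>i<Suc k. \<forall>t\<in>unit_interval. (U i has_real_derivative U (Suc i) t) (at t)"
      and B: "\<forall>s\<in>unit_interval. \<forall>t\<in>unit_interval. \<bar>U (Suc k) s - U (Suc k) t\<bar> \<le> B * \<bar>s - t\<bar>"
      and A: "\<forall>t\<in>unit_interval. \<bar>U 0 t\<bar> \<le> A"
      and i: "i \<le> Suc k" and t: "t \<in> unit_interval"
    have "\<exists>\<xi>\<in>{-1/2..-1/2+1}. \<bar>U (Suc k) \<xi>\<bar> \<le> C1"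
      by (rule C1) (use d A in auto)
    then obtain z where z: "z \<in> {-1/2..-1/2+1}" "\<bar>U (Suc k) z\<bar> \<le> C1" by blast
    have zI: "z \<in> unit_interval" using z(1) by auto
    have D: "\<bar>U (Suc k) s\<bar> \<le> D" if s: "s \<in> unit_interval" for s
    proof -
      have "\<bar>U (Suc k) s - U (Suc k) z\<bar> \<le> B * \<bar>s - z\<bar>" using B s zI by blast
      also have "\<dots> \<le> \<bar>B\<bar> * 2" using s zI by (intro mult_mono) auto
      finally show ?thesis using z(2) unfolding D_def by linarith
    qed
    have "\<forall>i\<le>k. \<forall>t\<in>unit_interval. \<bar>U i t\<bar> \<le> C2"
    proof (rule C2)
      show "\<forall>i<k. \<forall>t\<in>unit_interval. (U i has_real_derivative U (Suc i) t) (at t)" using d by simp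
      show "\<forall>s\<in>unit_interval. \<forall>t\<in>unit_interval. \<bar>U k s - U k t\<bar> \<le> D * \<bar>s - t\<bar>"
        using derivative_bound_imp_lip[of "U k" "U (Suc k)" D] d D by blast
      show "\<forall>t\<in>unit_interval. \<bar>U 0 t\<bar> \<le> A" using A .
    qed
    then show "\<bar>U i t\<bar> \<le> max D C2"
      using D[OF t] i t le_Suc_eq by (metis max.coboundedI1 max.coboundedI2)
  qed
qed

lemma derivatives_bounded_imp_ck1:
  "\<lbrakk>\<forall>i<k. \<forall>t\<in>unit_interval. (U i has_real_derivative U (Suc i) t) (at t);
    \<forall>i\<le>k. \<forall>t\<in>unit_interval. \<bar>U i t\<bar> \<le> M;
    \<forall>s\<in>unit_interval. \<forall>t\<in>unit_interval. \<bar>U k s - U k t\<bar> \<le> M * \<bar>s - t\<bar>\<rbrakk> \<Longrightarrow> ck1 k M (U 0)"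
proof (induction k arbitrary: U)
  case 0
  then show ?case by simp
next
  case (Suc k)
  have "ck1 k M (U (Suc 0))"
    by (rule Suc.IH[of "\<lambda>i. U (Suc i)"]) (use Suc.prems in auto)
  then show ?case using Suc.prems by (intro ck1_SucI[of "U 0" M "U (Suc 0)"]) auto
qed

lemma top_lip_bounded_imp_ck1:
  "\<exists>C. \<forall>u. top_lip k B u \<longrightarrow> (\<forall>t\<in>unit_interval. \<bar>u t\<bar> \<le> A) \<longrightarrow> ck1 k C u"
proof -
  obtain C where C: "\<And>U::nat \<Rightarrow> real \<Rightarrow> real.
    \<lbrakk>\<forall>i<k. \<forall>t\<in>unit_interval. (U i has_real_derivative U (Suc i) t) (at t);
    \<forall>s\<in>unit_interval. \<forall>t\<in>unit_interval. \<bar>U k s - U k t\<bar> \<le> B * \<bar>s - t\<bar>;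
    \<forall>t\<in>unit_interval. \<bar>U 0 t\<bar> \<le> A\<rbrakk> \<Longrightarrow>
    (\<forall>i\<le>k. \<forall>t\<in>unit_interval. \<bar>U i t\<bar> \<le> C)"
    using derivatives_interpolate[of k B A] by blast
  show ?thesis
  proof (intro exI allI impI)
    fix u assume u: "top_lip k B u" and A: "\<forall>t\<in>unit_interval. \<bar>u t\<bar> \<le> A"
    obtain U where U: "U 0 = u"
     "\<forall>i<k. \<forall>t\<in>unit_interval. (U i has_real_derivative U (Suc i) t) (at t)"
     "\<forall>s\<in>unit_interval. \<forall>t\<in>unit_interval. \<bar>U k s - U k t\<bar> \<le> B * \<bar>s - t\<bar>"
      using u unfolding top_lip_def by blast
    have b: "\<forall>i\<le>k. \<forall>t\<in>unit_interval. \<bar>U i t\<bar> \<le> C"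
      using C[of U, OF U(2,3)] A U(1) by blast
    have "ck1 k (max C B) (U 0)"
    proof (rule derivatives_bounded_imp_ck1[of k U, OF U(2)])
      show "\<forall>i\<le>k. \<forall>t\<in>unit_interval. \<bar>U i t\<bar> \<le> max C B" using b by (meson max.coboundedI1)
      have "B * \<bar>s - t\<bar> \<le> max C B * \<bar>s - t\<bar>" for s t by (intro mult_right_mono) auto
      then show "\<forall>s\<in>unit_interval. \<forall>t\<in>unit_interval. \<bar>U k s - U k t\<bar> \<le> max C B * \<bar>s - t\<bar>"
        using U(3) order_trans by blast
    qed
    then show "ck1 k (max C B) u" using U(1) by simp
  qed
qed

text \<open>A nonnegative function cannot be steep where it is small: if (u' 0)^2 exceeded 4 M u(0),
  the quadratic upper bound from Taylor's formula would be negative at its minimum.\<close>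

lemma glaeser:
  assumes u: "ck1 (Suc k) M u" and nn: "\<And>t. t \<in> unit_interval \<Longrightarrow> 0 \<le> u t" and M: "0 < M"
    and t: "t \<in> unit_interval"
  shows "\<bar>u t - u 0\<bar> \<le> 2 * sqrt (M * u 0) * \<bar>t\<bar> + M * t\<^sup>2"
proof -
  obtain u' where u': "\<And>t. t \<in> unit_interval \<Longrightarrow> (u has_real_derivative u' t) (at t)" "ck1 k M u'"
    using ck1_SucE[OF u] by blast
  have taylor: "\<bar>u s - u 0 - u' 0 * s\<bar> \<le> M * s\<^sup>2" if s: "s \<in> unit_interval" for s
  proof -
    have "\<exists>z\<in>unit_interval. \<bar>z\<bar> \<le> \<bar>s\<bar> \<and> u s - u 0 = s * u' z"
    proof (cases "s = 0")
      case False
      then consider "0 < s" | "s < 0" by linarith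
      then show ?thesis
      proof cases
        case 1
        obtain z where "0 < z" "z < s" "u s - u 0 = (s - 0) * u' z"
          using MVT2[OF 1, of u u'] u'(1) s by auto
        then show ?thesis using s by (intro bexI[of _ z]) auto
      next
        case 2
        obtain z where "s < z" "z < 0" "u 0 - u s = (0 - s) * u' z"
          using MVT2[OF 2, of u u'] u'(1) s by auto
        then show ?thesis using s by (intro bexI[of _ z]) auto
      qed
    qed auto
    then obtain z where z: "z \<in> unit_interval" "\<bar>z\<bar> \<le> \<bar>s\<bar>" "u s - u 0 = s * u' z" by blast
    have "\<bar>u s - u 0 - u' 0 * s\<bar> = \<bar>s\<bar> * \<bar>u' z - u' 0\<bar>"
      unfolding z(3) by (simp add: algebra_simps flip: abs_mult)
    also have "\<bar>u' z - u' 0\<bar> \<le> M * \<bar>z - 0\<bar>" using ck1_lip[OF u'(2) z(1), of 0] by simp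
    also have "M * \<bar>z - 0\<bar> \<le> M * \<bar>s\<bar>" using z(2) M by simp
    finally show ?thesis by (simp add: mult_left_mono mult.left_commute power2_eq_square)
  qed
  have d: "\<bar>u' 0\<bar> \<le> M" using ck1_bounded[OF u'(2), of 0] by simp
  \<comment> \<open>The minimum of the quadratic \<open>u 0 + u' 0 * s + M * s\<^sup>2\<close>. It
    lies in the interval because \<open>ck1\<close> bounds \<open>u' 0\<close> by the same
    \<open>M\<close> as the Lipschitz constant of \<open>u'\<close>.\<close>
  define s where "s = - u' 0 / (2 * M)"
  have "\<bar>s\<bar> \<le> 1 / 2" using d M by (simp add: s_def abs_mult field_simps)
  then have s: "s \<in> unit_interval" by (auto simp: abs_le_iff)
  have "0 \<le> u s" using nn[OF s] .
  also have "u s \<le> u 0 + u' 0 * s + M * s\<^sup>2" using taylor[OF s] by linarith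
  also have "\<dots> = u 0 - (u' 0)\<^sup>2 / (4 * M)" using M by (simp add: s_def power2_eq_square field_simps)
  finally have "(u' 0)\<^sup>2 \<le> 4 * (M * u 0)" using M by (simp add: field_simps)
  then have "\<bar>u' 0\<bar> \<le> sqrt (4 * (M * u 0))" by (simp add: real_le_rsqrt)
  also have "\<dots> = 2 * sqrt (M * u 0)" by (simp add: real_sqrt_mult)
  finally have "\<bar>u' 0 * t\<bar> \<le> 2 * sqrt (M * u 0) * \<bar>t\<bar>" by (simp add: abs_mult mult_right_mono)
  then show ?thesis using taylor[OF t] by linarith
qed

section \<open>Simple roots of polynomials with C^{k,1} coefficients\<close>

lemma ck1_powers: "\<exists>P. \<forall>u. ck1 k M u \<longrightarrow> (\<forall>i\<le>D. ck1 k P (\<lambda>t. u t ^ i))"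
proof -
  obtain P where P: "\<And>i u. ck1 k M u \<Longrightarrow> ck1 k (P i) (\<lambda>t. u t ^ i)"
    using ck1_power[of k M] by metis
  have "ck1 k (Max (P ` {..D})) (\<lambda>t. u t ^ i)" if "ck1 k M u" "i \<le> D" for u i
    by (rule ck1_mono[OF P[OF that(1)]]) (use that in auto)
  then show ?thesis by blast
qed

text \<open>Implicit differentiation at a continuous root. With Caratheodory's factor
  \<open>g\<close> of the polynomial at time \<open>t\<close>, the equation at time \<open>s\<close>
  says that (y s - y t) g(y s) is minus the sum of (a_i s - a_i t) (y s)^i. Divide by s - t;
  \<open>g\<close> is continuous and nonzero at \<open>y t\<close>.\<close>

lemma has_derivative_root:
  fixes a a' :: "nat \<Rightarrow> real \<Rightarrow> real"
  assumes S: "open S" "t \<in> S"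
    and root: "\<And>s. s \<in> S \<Longrightarrow> (\<Sum>i\<le>D. a i s * y s ^ i) = 0"
    and cont: "isCont y t"
    and a': "\<And>i. i \<le> D \<Longrightarrow> (a i has_real_derivative a' i t) (at t)"
    and nz: "(\<Sum>i\<le>D. a i t * (real i * y t ^ (i - 1))) \<noteq> 0"
  shows "(y has_real_derivative
      - (\<Sum>i\<le>D. a' i t * y t ^ i) / (\<Sum>i\<le>D. a i t * (real i * y t ^ (i - 1)))) (at t)"
proof -
  define p where "p z = (\<Sum>i\<le>D. a i t * z ^ i)" for z
  have "(p has_real_derivative (\<Sum>i\<le>D. a i t * (real i * y t ^ (i - 1)))) (at (y t))"
    unfolding p_def
  proof (rule DERIV_sum)
    show "((\<lambda>z. a i t * z ^ i) has_real_derivative a i t * (real i * y t ^ (i - 1))) (at (y t))" for i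
      using DERIV_cmult[OF DERIV_pow[of i "y t"], of "a i t"] by simp
  qed
  then obtain g where g: "\<And>z. p z - p (y t) = g z * (z - y t)" "isCont g (y t)"
      "g (y t) = (\<Sum>i\<le>D. a i t * (real i * y t ^ (i - 1)))"
    unfolding CARAT_DERIV by blast
  have gy: "(\<lambda>s. g (y s)) \<midarrow>t\<rightarrow> g (y t)"
    using isCont_o2[OF cont g(2)] by (simp add: isCont_def)
  have lim: "((\<lambda>s. - (\<Sum>i\<le>D. (a i s - a i t) / (s - t) * y s ^ i) / g (y s)) \<longlongrightarrow>
      - (\<Sum>i\<le>D. a' i t * y t ^ i) / g (y t)) (at t)"
  proof (intro tendsto_divide tendsto_minus tendsto_sum tendsto_mult tendsto_power gy)
    show "((\<lambda>s. (a i s - a i t) / (s - t)) \<longlongrightarrow> a' i t) (at t)" if "i \<in> {..D}" for i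
      using a' that unfolding has_field_derivative_iff by simp
    show "y \<midarrow>t\<rightarrow> y t" using cont by (simp add: isCont_def)
    show "g (y t) \<noteq> 0" using nz g(3) by simp
  qed
  have ev: "eventually (\<lambda>s. - (\<Sum>i\<le>D. (a i s - a i t) / (s - t) * y s ^ i) / g (y s)
      = (y s - y t) / (s - t)) (at t)"
  proof -
    have 1: "eventually (\<lambda>s. g (y s) \<noteq> 0) (at t)"
      using tendsto_imp_eventually_ne[OF gy] nz g(3) by simp
    have 2: "eventually (\<lambda>s. s \<in> S) (at t)" using S by (rule eventually_at_in_open')
    have 3: "eventually (\<lambda>s. s \<noteq> t) (at t)" by (simp add: eventually_at_filter)
    from 1 2 3 show ?thesis
    proof eventually_elim
      case (elim s)
      have "(y s - y t) * g (y s) = p (y s) - p (y t)" using g(1)[of "y s"] by (simp add: mult.commute)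
      also have "\<dots> = p (y s) - (\<Sum>i\<le>D. a i s * y s ^ i)"
        using root[OF S(2)] root[OF elim(2)] by (simp add: p_def)
      also have "\<dots> = - (\<Sum>i\<le>D. (a i s - a i t) * y s ^ i)"
        by (simp add: p_def left_diff_distrib sum_subtractf)
      finally have "(y s - y t) * g (y s) = - (\<Sum>i\<le>D. (a i s - a i t) * y s ^ i)" .
      moreover have "(\<Sum>i\<le>D. (a i s - a i t) / (s - t) * y s ^ i) = (\<Sum>i\<le>D. (a i s - a i t) * y s ^ i) / (s - t)"
        by (simp add: sum_divide_distrib)
      moreover have "(y s - y t) / (s - t) = (y s - y t) * g (y s) / (s - t) / g (y s)"
        using elim(1) by simp
      ultimately show ?case by simp
    qed
  qed
  show ?thesis
    unfolding has_field_derivative_iff g(3)[symmetric] by (rule Lim_transform_eventually[OF lim ev])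
qed

text \<open>The two-point hypothesis takes the place of continuity of the root, which is not known
  for an arbitrary lift: as \<open>y s\<close> is a root at time \<open>s\<close>, the right-hand
  side measures only the change of the coefficients, and \<open>y\<close> is Lipschitz. The formula
  for the derivative of a simple root then raises the order step by step.\<close>

lemma ck1_root:
  assumes c: "0 < c"
  shows "\<exists>N. \<forall>a y. (\<forall>i\<le>D. ck1 k M (a i)) \<longrightarrow> (\<forall>t\<in>unit_interval. \<bar>y t\<bar> \<le> M) \<longrightarrow>
    (\<forall>t\<in>unit_interval. (\<Sum>i\<le>D. a i t * y t ^ i) = 0) \<longrightarrow>
    (\<forall>s\<in>unit_interval. \<forall>t\<in>unit_interval. c * \<bar>y s - y t\<bar> \<le> \<bar>\<Sum>i\<le>D. a i t * y s ^ i\<bar>) \<longrightarrow>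
    (\<forall>t\<in>unit_interval. c \<le> \<bar>\<Sum>i\<le>D. a i t * (real i * y t ^ (i - 1))\<bar>) \<longrightarrow> ck1 k N y"
proof (induction k)
  case 0
  define N where "N = max M ((\<Sum>i\<le>D. M * M ^ i) / c)"
  show ?case
  proof (intro exI allI impI ck1_0I)
    fix a y
    assume a: "\<forall>i\<le>D. ck1 0 M (a i)" and y: "\<forall>t\<in>unit_interval. \<bar>y t\<bar> \<le> M"
      and root: "\<forall>t\<in>unit_interval. (\<Sum>i\<le>D. a i t * y t ^ i) = 0"
      and low: "\<forall>s\<in>unit_interval. \<forall>t\<in>unit_interval. c * \<bar>y s - y t\<bar> \<le> \<bar>\<Sum>i\<le>D. a i t * y s ^ i\<bar>"
    show "\<bar>y t\<bar> \<le> N" if "t \<in> unit_interval" for t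
      using y that by (simp add: N_def max.coboundedI1)
    have M: "0 \<le> M" using a ck1_nonneg by blast
    fix s t assume st: "s \<in> unit_interval" "t \<in> unit_interval"
    have "c * \<bar>y s - y t\<bar> \<le> \<bar>(\<Sum>i\<le>D. a i t * y s ^ i) - (\<Sum>i\<le>D. a i s * y s ^ i)\<bar>"
      using low root st by simp
    also have "\<dots> = \<bar>\<Sum>i\<le>D. (a i t - a i s) * y s ^ i\<bar>"
      by (simp add: left_diff_distrib sum_subtractf)
    also have "\<dots> \<le> (\<Sum>i\<le>D. \<bar>a i t - a i s\<bar> * \<bar>y s\<bar> ^ i)"
      by (rule order_trans[OF sum_abs]) (simp add: abs_mult power_abs)
    also have "\<dots> \<le> (\<Sum>i\<le>D. (M * \<bar>s - t\<bar>) * M ^ i)"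
    proof (intro sum_mono mult_mono power_mono)
      fix i assume "i \<in> {..D}"
      then show "\<bar>a i t - a i s\<bar> \<le> M * \<bar>s - t\<bar>"
        using a ck1_lip[of 0 M "a i" t s] st by (auto simp: abs_minus_commute)
    qed (use y st M in auto)
    also have "\<dots> = (\<Sum>i\<le>D. M * M ^ i) * \<bar>s - t\<bar>" unfolding sum_distrib_right by (intro sum.cong) (simp_all add: mult_ac)
    finally have "\<bar>y s - y t\<bar> \<le> (\<Sum>i\<le>D. M * M ^ i) / c * \<bar>s - t\<bar>"
      using c by (simp add: field_simps)
    also have "\<dots> \<le> N * \<bar>s - t\<bar>" by (intro mult_right_mono) (auto simp: N_def)
    finally show "\<bar>y s - y t\<bar> \<le> N * \<bar>s - t\<bar>" .
  qed
next
  case (Suc k)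
  then obtain N1 where N1: "\<And>a y. \<lbrakk>\<forall>i\<le>D. ck1 k M (a i); \<forall>t\<in>unit_interval. \<bar>y t\<bar> \<le> M;
    \<forall>t\<in>unit_interval. (\<Sum>i\<le>D. a i t * y t ^ i) = 0;
    \<forall>s\<in>unit_interval. \<forall>t\<in>unit_interval. c * \<bar>y s - y t\<bar> \<le> \<bar>\<Sum>i\<le>D. a i t * y s ^ i\<bar>;
    \<forall>t\<in>unit_interval. c \<le> \<bar>\<Sum>i\<le>D. a i t * (real i * y t ^ (i - 1))\<bar>\<rbrakk> \<Longrightarrow> ck1 k N1 y"
    by blast
  obtain P where P: "\<And>u i. ck1 k N1 u \<Longrightarrow> i \<le> D \<Longrightarrow> ck1 k P (\<lambda>t. u t ^ i)"
    using ck1_powers[of k N1 D] by blast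
  define K where "K = real (card {..D}) * (2 ^ Suc k * M * P)"
  define L where "L = real (card {..D}) * (2 ^ Suc k * M * (real D * P))"
  obtain R where R: "\<And>u. ck1 k L u \<Longrightarrow> (\<forall>t\<in>unit_interval. c \<le> \<bar>u t\<bar>) \<Longrightarrow> ck1 k R (\<lambda>t. inverse (u t))"
    using ck1_inverse[OF c, of k L] by blast
  define N where "N = max M (2 ^ Suc k * (\<bar>-1\<bar> * K) * R)"
  show ?case
  proof (intro exI allI impI)
    fix a y
    assume a: "\<forall>i\<le>D. ck1 (Suc k) M (a i)" and y: "\<forall>t\<in>unit_interval. \<bar>y t\<bar> \<le> M"
      and root: "\<forall>t\<in>unit_interval. (\<Sum>i\<le>D. a i t * y t ^ i) = 0"
      and low: "\<forall>s\<in>unit_interval. \<forall>t\<in>unit_interval. c * \<bar>y s - y t\<bar> \<le> \<bar>\<Sum>i\<le>D. a i t * y s ^ i\<bar>"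
      and der: "\<forall>t\<in>unit_interval. c \<le> \<bar>\<Sum>i\<le>D. a i t * (real i * y t ^ (i - 1))\<bar>"
    have a0: "ck1 k M (a i)" if "i \<le> D" for i using a that ck1_SucD by blast
    have yk: "ck1 k N1 y" using N1[OF _ y root low der] a0 by blast
    have P0: "0 \<le> P" using ck1_nonneg[OF P[OF yk, of 0]] by simp
    have M0: "0 \<le> M" using ck1_nonneg[OF a0[of 0]] by simp
    have "\<forall>i. \<exists>a'. i \<le> D \<longrightarrow> (\<forall>t\<in>unit_interval. (a i has_real_derivative a' t) (at t)) \<and> ck1 k M a'"
      using a unfolding ck1.simps(2) by blast
    then obtain a' where a': "\<And>i t. i \<le> D \<Longrightarrow> t \<in> unit_interval \<Longrightarrow> (a i has_real_derivative a' i t) (at t)"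
        "\<And>i. i \<le> D \<Longrightarrow> ck1 k M (a' i)"
      by metis
    have num: "ck1 k K (\<lambda>t. \<Sum>i\<le>D. a' i t * y t ^ i)"
      unfolding K_def
    proof (rule ck1_sum)
      show "ck1 k (2 ^ Suc k * M * P) (\<lambda>t. a' i t * y t ^ i)" if "i \<in> {..D}" for i
        using ck1_mult[OF a'(2) P[OF yk]] that by simp
    qed simp
    have den: "ck1 k L (\<lambda>t. \<Sum>i\<le>D. a i t * (real i * y t ^ (i - 1)))"
      unfolding L_def
    proof (rule ck1_sum)
      show "ck1 k (2 ^ Suc k * M * (real D * P)) (\<lambda>t. a i t * (real i * y t ^ (i - 1)))" if i: "i \<in> {..D}" for i
      proof (rule ck1_mono[OF ck1_mult[OF a0 ck1_cmult[OF P[OF yk]]]])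
        show "2 ^ Suc k * M * (\<bar>real i\<bar> * P) \<le> 2 ^ Suc k * M * (real D * P)"
          using i P0 M0 by (intro mult_left_mono mult_right_mono) auto
      qed (use i in auto)
    qed simp
    have inv: "ck1 k R (\<lambda>t. inverse (\<Sum>i\<le>D. a i t * (real i * y t ^ (i - 1))))"
      using R[OF den der] .
    have quot: "ck1 k N (\<lambda>t. - (\<Sum>i\<le>D. a' i t * y t ^ i) / (\<Sum>i\<le>D. a i t * (real i * y t ^ (i - 1))))"
    proof (rule ck1_cong[OF ck1_mono[OF ck1_mult[OF ck1_cmult[OF num, of "-1"] inv]]])
      show "2 ^ Suc k * (\<bar>-1\<bar> * K) * R \<le> N" unfolding N_def by (rule max.cobounded2)
    qed (simp add: divide_inverse)
    have cont: "isCont y t" if t: "t \<in> unit_interval" for t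
    proof -
      have "N1-lipschitz_on unit_interval y"
        using ck1_lip[OF yk] ck1_nonneg[OF yk] by (intro lipschitz_onI) (auto simp: dist_real_def)
      then have "continuous_on unit_interval y" by (rule lipschitz_on_continuous_on)
      then show ?thesis using t by (simp add: continuous_on_eq_continuous_at)
    qed
    show "ck1 (Suc k) N y"
    proof (rule ck1_SucI[OF _ _ quot])
      show "\<bar>y t\<bar> \<le> N" if "t \<in> unit_interval" for t
        using y that by (simp add: N_def max.coboundedI1)
      show "(y has_real_derivative - (\<Sum>i\<le>D. a' i t * y t ^ i) /
          (\<Sum>i\<le>D. a i t * (real i * y t ^ (i - 1)))) (at t)" if t: "t \<in> unit_interval" for t
      proof (rule has_derivative_root[of unit_interval])
        show "(\<Sum>i\<le>D. a i t * (real i * y t ^ (i - 1))) \<noteq> 0" using der t c by force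
      qed (use t root cont a'(1) in auto)
    qed
  qed
qed


section \<open>Homogeneous parts of polynomial functions\<close>

lemmas rpf_linear = real_polynomial_function.intros(1)
  and rpf_const = real_polynomial_function.intros(2)
  and rpf_add = real_polynomial_function.intros(3)
  and rpf_mult = real_polynomial_function.intros(4)

text \<open>Homogeneous components are obtained without coordinates, as coefficients of the
  restriction of \<open>f\<close> to the ray through \<open>y\<close>. A real polynomial is
  determined by its values, which justifies \<open>THE\<close> for polynomial functions.\<close>

definition ray_poly :: "('a::real_normed_vector \<Rightarrow> real) \<Rightarrow> 'a \<Rightarrow> real poly" where
  "ray_poly f y = (THE P. \<forall>t. poly P t = f (t *\<^sub>R y))"

definition hom_part :: "nat \<Rightarrow> ('a::real_normed_vector \<Rightarrow> real) \<Rightarrow> 'a \<Rightarrow> real" where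
  "hom_part i f y = coeff (ray_poly f y) i"

lemma ray_poly_eqI:
  assumes "\<And>t. poly P t = f (t *\<^sub>R y)"
  shows "ray_poly f y = P"
  unfolding ray_poly_def
  by (rule the_equality) (use assms in \<open>auto simp: poly_eq_poly_eq_iff[symmetric] fun_eq_iff\<close>)

lemma poly_ray_poly:
  assumes "real_polynomial_function f"
  shows "poly (ray_poly f y) t = f (t *\<^sub>R y)"
proof -
  have "\<exists>P. \<forall>t. poly P t = f (t *\<^sub>R y)"
    using assms
  proof induction
    case (linear f)
    then show ?case
      by (intro exI[of _ "[:0, f y:]"]) (simp add: linear_simps)
  next
    case (const c)
    show ?case by (intro exI[of _ "[:c:]"]) simp
  next
    case (add f g)
    then obtain P Q where "\<forall>t. poly P t = f (t *\<^sub>R y)" "\<forall>t. poly Q t = g (t *\<^sub>R y)" by blast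
    then show ?case by (intro exI[of _ "P + Q"]) simp
  next
    case (mult f g)
    then obtain P Q where "\<forall>t. poly P t = f (t *\<^sub>R y)" "\<forall>t. poly Q t = g (t *\<^sub>R y)" by blast
    then show ?case by (intro exI[of _ "P * Q"]) simp
  qed
  then obtain P where P: "\<forall>t. poly P t = f (t *\<^sub>R y)" ..
  then have "ray_poly f y = P" by (intro ray_poly_eqI) simp
  then show ?thesis using P by simp
qed

lemma ray_poly_linear: "bounded_linear f \<Longrightarrow> ray_poly f y = [:0, f y:]"
  by (rule ray_poly_eqI) (simp add: linear_simps)

lemma ray_poly_const: "ray_poly (\<lambda>_. c) y = [:c:]"
  by (rule ray_poly_eqI) simp

lemma ray_poly_add:
  "real_polynomial_function f \<Longrightarrow> real_polynomial_function g \<Longrightarrow>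
    ray_poly (\<lambda>x. f x + g x) y = ray_poly f y + ray_poly g y"
  by (rule ray_poly_eqI) (simp add: poly_ray_poly)

lemma ray_poly_mult:
  "real_polynomial_function f \<Longrightarrow> real_polynomial_function g \<Longrightarrow>
    ray_poly (\<lambda>x. f x * g x) y = ray_poly f y * ray_poly g y"
  by (rule ray_poly_eqI) (simp add: poly_ray_poly)

text \<open>Ray polynomials of a product multiply, so the parts of a product are Cauchy products of
  the parts of the factors.\<close>

lemma real_polynomial_function_hom_part:
  "real_polynomial_function f \<Longrightarrow> real_polynomial_function (hom_part i f)"
proof (induction arbitrary: i rule: real_polynomial_function.induct)
  case (linear f)
  have "hom_part i f = (if i = 1 then f else (\<lambda>_. 0))"
    using linear by (auto simp: hom_part_def fun_eq_iff ray_poly_linear coeff_pCons split: nat.split)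
  then show ?case using linear by auto
next
  case (const c)
  have "hom_part i (\<lambda>_::'a. c) = (\<lambda>_. if i = 0 then c else 0)"
    by (auto simp: hom_part_def fun_eq_iff ray_poly_const coeff_pCons split: nat.split)
  then show ?case by auto
next
  case (add f g)
  have "hom_part i (\<lambda>x. f x + g x) = (\<lambda>y. hom_part i f y + hom_part i g y)"
    using add.hyps by (simp add: hom_part_def fun_eq_iff ray_poly_add)
  then show ?case using add.IH by auto
next
  case (mult f g)
  have "hom_part i (\<lambda>x. f x * g x) = (\<lambda>y. \<Sum>j\<le>i. hom_part j f y * hom_part (i - j) g y)"
    using mult.hyps by (simp add: hom_part_def fun_eq_iff ray_poly_mult coeff_mult)
  then show ?case using mult.IH by (simp only:) (intro real_polynomial_function_sum finite_atMost rpf_mult)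
qed

text \<open>Uniformity in \<open>y\<close> is the point: a polynomial function is then a sum of
  homogeneous parts over one finite index range for all points.\<close>

lemma degree_ray_poly_bounded:
  "real_polynomial_function f \<Longrightarrow> \<exists>n. \<forall>y. degree (ray_poly f y) \<le> n"
proof (induction rule: real_polynomial_function.induct)
  case (linear f)
  then show ?case by (intro exI[of _ 1]) (simp add: ray_poly_linear)
next
  case (const c)
  show ?case by (simp add: ray_poly_const)
next
  case (add f g)
  then obtain m n where "\<forall>y. degree (ray_poly f y) \<le> m" "\<forall>y. degree (ray_poly g y) \<le> n" by blast
  then have "\<forall>y. degree (ray_poly (\<lambda>x. f x + g x) y) \<le> max m n"
    using add.hyps by (metis degree_add_le_max max.mono order_trans ray_poly_add)
  then show ?case by blast
next
  case (mult f g)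
  then obtain m n where "\<forall>y. degree (ray_poly f y) \<le> m" "\<forall>y. degree (ray_poly g y) \<le> n" by blast
  then have "\<forall>y. degree (ray_poly (\<lambda>x. f x * g x) y) \<le> m + n"
    using mult.hyps by (auto simp: ray_poly_mult intro: order_trans[OF degree_mult_le] add_mono)
  then show ?case by blast
qed

lemma hom_part_scaleR:
  assumes "real_polynomial_function f"
  shows "hom_part i f (c *\<^sub>R y) = c ^ i * hom_part i f y"
proof -
  have "ray_poly f (c *\<^sub>R y) = pcompose (ray_poly f y) [:0, c:]"
    by (rule ray_poly_eqI) (simp add: poly_pcompose poly_ray_poly[OF assms])
  then show ?thesis by (simp add: hom_part_def coeff_pcompose_linear)
qed

lemma sum_hom_part:
  assumes "real_polynomial_function f" "\<And>i. n < i \<Longrightarrow> hom_part i f y = 0"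
  shows "f y = (\<Sum>i\<le>n. hom_part i f y)"
proof -
  have deg: "degree (ray_poly f y) \<le> n"
    by (rule degree_le) (use assms(2) in \<open>auto simp: hom_part_def\<close>)
  have "f y = poly (ray_poly f y) 1" using poly_ray_poly[OF assms(1), of y 1] by simp
  also have "\<dots> = (\<Sum>i\<le>degree (ray_poly f y). hom_part i f y)"
    by (simp add: poly_altdef hom_part_def)
  also have "\<dots> = (\<Sum>i\<le>n. hom_part i f y)"
    by (rule sum.mono_neutral_left) (use deg in \<open>auto simp: hom_part_def coeff_eq_0\<close>)
  finally show ?thesis .
qed

text \<open>The product rule at the origin: the linear part of f g is f(0) times that of g plus g(0)
  times that of f. Generators of degree one will thereby be recognised as linear
  functionals.\<close>

lemma linear_hom_part_1:
  assumes "real_polynomial_function f"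
  shows "linear (hom_part 1 f)"
  using assms
proof induction
  case (linear f)
  then have "hom_part 1 f = f" by (simp add: hom_part_def fun_eq_iff ray_poly_linear)
  then show ?case using linear by (simp add: bounded_linear.linear)
next
  case (const c)
  have "hom_part 1 (\<lambda>_::'a. c) = (\<lambda>_. 0)" by (simp add: hom_part_def fun_eq_iff ray_poly_const)
  then show ?case by (simp add: module_hom_zero)
next
  case (add f g)
  have "hom_part 1 (\<lambda>x. f x + g x) = (\<lambda>y. hom_part 1 f y + hom_part 1 g y)"
    using add.hyps by (simp add: hom_part_def fun_eq_iff ray_poly_add)
  then show ?case using add.IH by (simp add: linear_compose_add)
next
  case (mult f g)
  have h0: "coeff (ray_poly h y) 0 = h 0" if "real_polynomial_function h" for h :: "'a \<Rightarrow> real" and y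
    using poly_ray_poly[OF that, of y 0] by (simp add: poly_0_coeff_0)
  have "hom_part 1 (\<lambda>x. f x * g x) = (\<lambda>y. f 0 *\<^sub>R hom_part 1 g y + g 0 *\<^sub>R hom_part 1 f y)"
    using mult.hyps by (simp add: hom_part_def fun_eq_iff ray_poly_mult coeff_mult h0)
  then show ?case using mult.IH by (simp only:) (intro linear_compose_add linear_compose_scale_right)
qed

lemma polynomial_function_translate: "polynomial_function (\<lambda>y::'a::euclidean_space. v + y)"
  by (intro polynomial_function_add polynomial_function_const polynomial_function_id)

lemma real_polynomial_function_translate:
  fixes f :: "'a::euclidean_space \<Rightarrow> real"
  assumes "real_polynomial_function f"
  shows "real_polynomial_function (\<lambda>y. f (v + y))"
  using real_polynomial_function_compose[OF polynomial_function_translate[of v] assms]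
  by (simp add: o_def)

lemma real_polynomial_function_linear_compose:
  fixes f :: "'a::euclidean_space \<Rightarrow> real" and g :: "'a \<Rightarrow> 'a"
  assumes "real_polynomial_function f" "linear g"
  shows "real_polynomial_function (\<lambda>y. f (g y))"
  using real_polynomial_function_compose[OF polynomial_function_bounded_linear assms(1), of g] assms(2)
  by (simp add: o_def linear_conv_bounded_linear)

text \<open>Compare the expansions of \<open>f (v + t y) = t^e f (y + v / t)\<close> in \<open>t\<close> and in \<open>1 / t\<close>.\<close>
lemma hom_part_translate_eq_0:
  fixes f :: "'a::euclidean_space \<Rightarrow> real"
  assumes f: "real_polynomial_function f" and hom: "\<And>c x. f (c *\<^sub>R x) = c ^ e * f x" and "e < i"
  shows "hom_part i (\<lambda>y. f (v + y)) y = 0"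
proof -
  define P where "P = ray_poly (\<lambda>y. f (v + y)) y"
  define Q where "Q = ray_poly (\<lambda>x. f (y + x)) v"
  have P: "poly P t = f (v + t *\<^sub>R y)" for t
    unfolding P_def by (rule poly_ray_poly[OF real_polynomial_function_translate[OF f]])
  have Q: "poly Q t = f (y + t *\<^sub>R v)" for t
    unfolding Q_def by (rule poly_ray_poly[OF real_polynomial_function_translate[OF f]])
  \<comment> \<open>Multiplication by t^(deg Q) clears the denominators of Q(1/t) and produces the
    reflected polynomial; comparing degrees on both sides then bounds the degree of \<open>P\<close>
    by \<open>e\<close>.\<close>
  have eq: "poly (monom 1 (degree Q) * P) t = poly (monom 1 e * reflect_poly Q) t" if "t \<noteq> 0" for t
  proof -
    have "v + t *\<^sub>R y = t *\<^sub>R (y + inverse t *\<^sub>R v)" using that by (simp add: algebra_simps)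
    then have "poly P t = t ^ e * poly Q (inverse t)" unfolding P Q by (simp only: hom)
    then show ?thesis using that by (simp add: poly_monom poly_reflect_poly_nz)
  qed
  have "monom 1 (degree Q) * P = monom 1 e * reflect_poly Q"
  proof (rule ccontr)
    assume "monom 1 (degree Q) * P \<noteq> monom 1 e * reflect_poly Q"
    then have "finite {t. poly (monom 1 (degree Q) * P - monom 1 e * reflect_poly Q) t = 0}"
      by (intro poly_roots_finite) simp
    moreover have "UNIV - {0} \<subseteq> {t. poly (monom 1 (degree Q) * P - monom 1 e * reflect_poly Q) t = 0}"
      using eq by auto
    ultimately have "finite (UNIV - {0::real})" using finite_subset by blast
    then show False by (simp add: infinite_UNIV_char_0)
  qed
  moreover have "degree (monom 1 e * reflect_poly Q) \<le> e + degree Q"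
    by (rule order_trans[OF degree_mult_le]) (simp add: degree_monom_eq degree_reflect_poly_le)
  moreover have "degree (monom 1 (degree Q) * P) = degree Q + degree P" if "P \<noteq> 0"
    using that by (simp add: degree_mult_eq degree_monom_eq)
  ultimately have "P = 0 \<or> degree P \<le> e" by fastforce
  then show ?thesis using assms(3) unfolding hom_part_def P_def[symmetric] by (auto intro: coeff_eq_0)
qed

section \<open>Generators for the invariants of a stabilizer\<close>

lemma algebra_generated_sum:
  assumes "finite J" "\<And>i. i \<in> J \<Longrightarrow> f i \<in> algebra_generated S"
  shows "(\<lambda>x. \<Sum>i\<in>J. f i x) \<in> algebra_generated S"
  using assms
proof (induction J)
  case empty
  show ?case using algebra_generated.const[of 0 S] by simp
next
  case (insert j J)
  then show ?case using algebra_generated.add[of "f j" S "\<lambda>x. \<Sum>i\<in>J. f i x"] by simp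
qed

definition invariants :: "('a::euclidean_space \<Rightarrow> 'a) set \<Rightarrow> ('a \<Rightarrow> real) set" where
  "invariants G = {p. real_polynomial_function p \<and> (\<forall>g\<in>G. \<forall>x. p (g x) = p x)}"

definition generating_system :: "('a::euclidean_space \<Rightarrow> 'a) set \<Rightarrow> nat \<Rightarrow> ('a \<Rightarrow> real) set \<Rightarrow> bool" where
  "generating_system G d S \<longleftrightarrow> finite S \<and> (\<forall>\<sigma>\<in>S. \<exists>e\<le>d. \<forall>c x. \<sigma> (c *\<^sub>R x) = c ^ e * \<sigma> x) \<and>
    algebra_generated S = invariants G"

text \<open>The homogeneous parts of the Taylor expansions of the generators at \<open>v\<close>.
  Cutting at degree \<open>d\<close> loses nothing, as the parts of higher degree vanish.\<close>

definition slice_generators :: "'a::euclidean_space \<Rightarrow> nat \<Rightarrow> ('a \<Rightarrow> real) set \<Rightarrow> ('a \<Rightarrow> real) set" where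
  "slice_generators v d S = (\<lambda>(\<sigma>, i). hom_part i (\<lambda>y. \<sigma> (v + y))) ` (S \<times> {..d})"

lemma algebra_generated_subset_invariants:
  assumes "S \<subseteq> invariants G"
  shows "algebra_generated S \<subseteq> invariants G"
proof
  fix p assume "p \<in> algebra_generated S"
  then show "p \<in> invariants G"
    by induction (use assms in \<open>auto simp: invariants_def\<close>)
qed

text \<open>Expansion at \<open>v\<close> respects sums and turns products into Cauchy products, so
  it stays polynomial in the expanded generators. The first conjunct is carried through the
  induction because ray polynomials add and multiply for polynomial functions.\<close>

lemma hom_part_translate_in_algebra:
  fixes S :: "('a::euclidean_space \<Rightarrow> real) set"
  assumes S: "\<And>\<sigma>. \<sigma> \<in> S \<Longrightarrow> real_polynomial_function \<sigma>"
    and hom: "\<And>\<sigma>. \<sigma> \<in> S \<Longrightarrow> \<exists>e\<le>d. \<forall>c x. \<sigma> (c *\<^sub>R x) = c ^ e * \<sigma> x"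
    and q: "q \<in> algebra_generated S"
  shows "real_polynomial_function q \<and>
    hom_part i (\<lambda>y. q (v + y)) \<in> algebra_generated (slice_generators v d S)"
  using q
proof (induction arbitrary: i)
  case (const c)
  have "hom_part i (\<lambda>y::'a. c) = (\<lambda>_. if i = 0 then c else 0)"
    by (auto simp: hom_part_def fun_eq_iff ray_poly_const coeff_pCons split: nat.split)
  then show ?case using algebra_generated.const by auto
next
  case (base p)
  show ?case
  proof (cases "i \<le> d")
    case True
    then have "hom_part i (\<lambda>y. p (v + y)) \<in> slice_generators v d S"
      unfolding slice_generators_def using base by force
    then show ?thesis using S[OF base] algebra_generated.base by blast
  next
    case False
    obtain e where e: "e \<le> d" "\<And>c x. p (c *\<^sub>R x) = c ^ e * p x" using hom[OF base] by blast
    have "hom_part i (\<lambda>y. p (v + y)) = (\<lambda>_. 0)"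
      using hom_part_translate_eq_0[OF S[OF base] e(2)] False e(1) by fastforce
    then show ?thesis using S[OF base] algebra_generated.const by auto
  qed
next
  case (add p q)
  have "hom_part i (\<lambda>y. p (v + y) + q (v + y)) =
      (\<lambda>y. hom_part i (\<lambda>y. p (v + y)) y + hom_part i (\<lambda>y. q (v + y)) y)"
    using add.IH by (simp add: hom_part_def fun_eq_iff ray_poly_add real_polynomial_function_translate)
  moreover have "real_polynomial_function (\<lambda>x. p x + q x)"
    using add.IH by (intro rpf_add) simp_all
  moreover have "(\<lambda>y. hom_part i (\<lambda>y. p (v + y)) y + hom_part i (\<lambda>y. q (v + y)) y)
      \<in> algebra_generated (slice_generators v d S)"
    using add.IH by (intro algebra_generated.add) simp_all
  ultimately show ?case by simp
next
  case (mult p q)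
  have "hom_part i (\<lambda>y. p (v + y) * q (v + y)) =
      (\<lambda>y. \<Sum>j\<le>i. hom_part j (\<lambda>y. p (v + y)) y * hom_part (i - j) (\<lambda>y. q (v + y)) y)"
    using mult.IH by (simp add: hom_part_def fun_eq_iff ray_poly_mult real_polynomial_function_translate coeff_mult)
  moreover have "real_polynomial_function (\<lambda>x. p x * q x)"
    using mult.IH by (intro rpf_mult) simp_all
  moreover have "(\<lambda>y. \<Sum>j\<le>i. hom_part j (\<lambda>y. p (v + y)) y * hom_part (i - j) (\<lambda>y. q (v + y)) y)
      \<in> algebra_generated (slice_generators v d S)"
    using mult.IH by (intro algebra_generated_sum algebra_generated.mult) simp_all
  ultimately show ?case by simp
qed

lemma real_polynomial_function_norm_squared:
  fixes w :: "'a::euclidean_space"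
  shows "real_polynomial_function (\<lambda>x. (norm (x - w))\<^sup>2)"
proof -
  have "(norm (x - w))\<^sup>2 = (\<Sum>b\<in>Basis. (x \<bullet> b - w \<bullet> b)\<^sup>2)" for x
    unfolding power2_norm_eq_inner
    by (rule trans[OF euclidean_inner]) (simp add: power2_eq_square inner_diff_left)
  moreover have "real_polynomial_function (\<lambda>x. x \<bullet> b)" for b :: 'a
    by (intro rpf_linear bounded_linear_inner_left)
  then have "real_polynomial_function (\<lambda>x. \<Sum>b\<in>Basis. (x \<bullet> b - w \<bullet> b)\<^sup>2)"
    by (intro real_polynomial_function_sum real_polynomial_function_power
        real_polynomial_function_diff rpf_const finite_Basis) blast
  ultimately show ?thesis by simp
qed

text \<open>The group is a set of maps, not an abstract carrier with an action: a stabilizer is then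
  a subset of the same type and again an instance, which permits induction on
  \<open>card G\<close>.\<close>

locale finite_linear_group =
  fixes G :: "('a::euclidean_space \<Rightarrow> 'a) set"
  assumes finite_G [simp]: "finite G"
    and id_in: "id \<in> G"
    and linear_G: "g \<in> G \<Longrightarrow> linear g"
    and comp_in: "g \<in> G \<Longrightarrow> h \<in> G \<Longrightarrow> g \<circ> h \<in> G"
    and left_inv: "g \<in> G \<Longrightarrow> \<exists>h\<in>G. h \<circ> g = id"
begin

lemma inverse_exists:
  assumes "g \<in> G"
  obtains h where "h \<in> G" "h \<circ> g = id" "g \<circ> h = id"
proof -
  obtain h where h: "h \<in> G" "h \<circ> g = id" using left_inv[OF assms] by blast
  obtain k where k: "k \<circ> h = id" using left_inv[OF h(1)] by blast
  have "k = g" using h(2) k by (metis comp_assoc comp_id id_comp)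
  then show ?thesis using that h k by blast
qed

lemma card_pos: "0 < card G"
  using id_in by (auto simp: card_gt_0_iff)

lemma bij_betw_comp_right:
  assumes "g \<in> G"
  shows "bij_betw (\<lambda>h. h \<circ> g) G G"
proof -
  obtain k where k: "k \<in> G" "k \<circ> g = id" "g \<circ> k = id" using inverse_exists[OF assms] .
  show ?thesis
    by (rule bij_betw_byWitness[of _ "\<lambda>h. h \<circ> k"])
      (use k assms comp_in in \<open>auto simp: comp_assoc\<close>)
qed

lemma bij_betw_comp_left:
  assumes "g \<in> G"
  shows "bij_betw (\<lambda>h. g \<circ> h) G G"
proof -
  obtain k where k: "k \<in> G" "k \<circ> g = id" "g \<circ> k = id" using inverse_exists[OF assms] .
  show ?thesis
    by (rule bij_betw_byWitness[of _ "\<lambda>h. k \<circ> h"])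
      (use k assms comp_in in \<open>auto simp flip: comp_assoc\<close>)
qed

lemma sum_translate:
  assumes "g \<in> G"
  shows "(\<Sum>h\<in>G. F (h \<circ> g)) = (\<Sum>h\<in>G. F h)"
  using sum.reindex_bij_betw[OF bij_betw_comp_right[OF assms]] .

lemma sum_orbit_invariant:
  assumes "real_polynomial_function F"
  shows "(\<lambda>x. \<Sum>g\<in>G. F (g x)) \<in> invariants G"
proof -
  have "(\<Sum>g\<in>G. F (g (h x))) = (\<Sum>g\<in>G. F (g x))" if "h \<in> G" for h x
    using sum_translate[OF that, of "\<lambda>g. F (g x)"] by simp
  moreover have "real_polynomial_function (\<lambda>x. \<Sum>g\<in>G. F (g x))"
    by (rule real_polynomial_function_sum[OF finite_G])
      (rule real_polynomial_function_linear_compose[OF assms linear_G])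
  ultimately show ?thesis unfolding invariants_def by simp
qed

lemma prod_orbit_invariant:
  assumes "real_polynomial_function F"
  shows "(\<lambda>x. \<Prod>g\<in>G. F (g x)) \<in> invariants G"
proof -
  have "(\<Prod>g\<in>G. F (g (h x))) = (\<Prod>g\<in>G. F (g x))" if "h \<in> G" for h x
    using prod.reindex_bij_betw[OF bij_betw_comp_right[OF that], of "\<lambda>g. F (g x)"] by simp
  moreover have "real_polynomial_function (\<lambda>x. \<Prod>g\<in>G. F (g x))"
    by (rule real_polynomial_function_prod[OF finite_G])
      (rule real_polynomial_function_linear_compose[OF assms linear_G])
  ultimately show ?thesis unfolding invariants_def by simp
qed

definition stabilizer :: "'a \<Rightarrow> ('a \<Rightarrow> 'a) set" where
  "stabilizer v = {g \<in> G. g v = v}"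

lemma finite_linear_group_stabilizer: "finite_linear_group (stabilizer v)"
proof (rule finite_linear_group.intro)
  show "\<exists>h\<in>stabilizer v. h \<circ> g = id" if "g \<in> stabilizer v" for g
  proof -
    have g: "g \<in> G" "g v = v" using that by (auto simp: stabilizer_def)
    obtain h where h: "h \<in> G" "h \<circ> g = id" using left_inv[OF g(1)] by blast
    then have "h v = v" using g(2) by (metis comp_apply id_apply)
    then show ?thesis using h by (auto simp: stabilizer_def)
  qed
  show "linear g" if "g \<in> stabilizer v" for g
    using that linear_G by (simp add: stabilizer_def)
qed (auto simp: stabilizer_def id_in comp_in)

text \<open>
  Average \<open>\<tau> (x - v) e(x)\<close> over \<open>G\<close>, where \<open>e - 1\<close> vanishes to high order at \<open>v\<close> and
  \<open>e\<close> vanishes to high order at the other points of the orbit of \<open>v\<close>.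
\<close>
lemma stabilizer_invariant_approx:
  assumes \<tau>: "\<tau> \<in> invariants (stabilizer v)"
  obtains q where "q \<in> invariants G" "\<And>i y. i < K \<Longrightarrow> hom_part i (\<lambda>y. q (v + y)) y = hom_part i \<tau> y"
proof -
  define W where "W = (\<lambda>g. g v) ` G - {v}"
  have finW: "finite W" by (simp add: W_def)
  have \<tau>p: "real_polynomial_function \<tau>" using \<tau> by (simp add: invariants_def)
  define m where "m x = (\<Prod>w\<in>W. (norm (x - w))\<^sup>2 / (norm (v - w))\<^sup>2)" for x
  have mp: "real_polynomial_function m"
    unfolding m_def
    by (intro real_polynomial_function_prod real_polynomial_function_divide
        real_polynomial_function_norm_squared finW)
  have mv: "m v = 1" unfolding m_def by (rule prod.neutral) (auto simp: W_def)
  have mw: "m w = 0" if "w \<in> W" for w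
    unfolding m_def by (rule prod_zero[OF finW]) (use that in auto)
  \<comment> \<open>At \<open>v\<close> the function 1 - m^K vanishes, so its K-th power vanishes to
    order K and \<open>e\<close> equals 1 up to that order. At a point of \<open>W\<close> already
    m^K vanishes to order K, and 1 - (1 - z)^K is divisible by z.\<close>
  define e where "e x = 1 - (1 - m x ^ K) ^ K" for x
  have ep: "real_polynomial_function e"
    unfolding e_def by (intro real_polynomial_function_diff real_polynomial_function_power mp rpf_const)
  define F where "F x = \<tau> (x - v) * e x" for x
  have Fp: "real_polynomial_function F"
    unfolding F_def using real_polynomial_function_translate[OF \<tau>p, of "- v"]
    by (intro rpf_mult ep) simp
  define H where "H = stabilizer v"
  have HG: "H \<subseteq> G" and finH: "finite H" by (auto simp: H_def stabilizer_def)
  have cH: "0 < card H"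
    unfolding H_def by (rule finite_linear_group.card_pos[OF finite_linear_group_stabilizer])
  have Fgp: "real_polynomial_function (\<lambda>y. F (g (v + y)))" if "g \<in> G" for g
    by (rule real_polynomial_function_translate[OF real_polynomial_function_linear_compose[OF Fp linear_G[OF that]]])
  define E where "E g y = 1 - (1 - ray_poly (\<lambda>y. m (g (v + y))) y ^ K) ^ K" for g y
  have E: "poly (E g y) t = e (g (v + t *\<^sub>R y))" if "g \<in> G" for g y t
    unfolding E_def e_def
    using poly_ray_poly[OF real_polynomial_function_translate[OF real_polynomial_function_linear_compose[OF mp linear_G[OF that]]]]
    by simp
  have M0: "poly (ray_poly (\<lambda>y. m (g (v + y))) y) 0 = m (g v)" if "g \<in> G" for g y
    using poly_ray_poly[OF real_polynomial_function_translate[OF real_polynomial_function_linear_compose[OF mp linear_G[OF that]]]]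
    by simp
  have coeff0: "coeff p i = 0" if "[:0, 1:] ^ K dvd p" "i < K" for p :: "real poly" and i
  proof -
    have "monom 1 K dvd p" using that(1) by (simp add: monom_altdef)
    then show ?thesis using that(2) by (simp add: monom_1_dvd_iff')
  qed
  have inH: "coeff (ray_poly (\<lambda>y. F (g (v + y))) y) i = hom_part i \<tau> y" if g: "g \<in> H" and i: "i < K" for g y i
  proof -
    have gG: "g \<in> G" and gv: "g v = v" using g by (auto simp: H_def stabilizer_def)
    have "F (g (v + t *\<^sub>R y)) = poly (ray_poly \<tau> y * E g y) t" for t
    proof -
      have "g (v + t *\<^sub>R y) - v = g (t *\<^sub>R y)" using gv linear_G[OF gG] by (simp add: linear_add)
      moreover have "\<tau> (g (t *\<^sub>R y)) = \<tau> (t *\<^sub>R y)" using \<tau> g by (simp add: invariants_def H_def)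
      ultimately show ?thesis by (simp add: F_def E[OF gG] poly_ray_poly[OF \<tau>p])
    qed
    then have 1: "ray_poly (\<lambda>y. F (g (v + y))) y = ray_poly \<tau> y * E g y"
      by (intro ray_poly_eqI) simp
    have "poly (1 - ray_poly (\<lambda>y. m (g (v + y))) y ^ K) 0 = 0"
      using M0[OF gG] gv mv by simp
    then have "[:0, 1:] dvd 1 - ray_poly (\<lambda>y. m (g (v + y))) y ^ K"
      unfolding poly_eq_0_iff_dvd by simp
    then have "[:0, 1:] ^ K dvd (1 - ray_poly (\<lambda>y. m (g (v + y))) y ^ K) ^ K"
      by (rule dvd_power_same)
    then have "[:0, 1:] ^ K dvd ray_poly \<tau> y * (E g y - 1)" by (simp add: E_def)
    from coeff0[OF this i] show ?thesis unfolding 1 hom_part_def by (simp add: algebra_simps)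
  qed
  have notH: "coeff (ray_poly (\<lambda>y. F (g (v + y))) y) i = 0" if g: "g \<in> G - H" and i: "i < K" for g y i
  proof -
    have gG: "g \<in> G" and gv: "g v \<in> W" using g by (auto simp: H_def stabilizer_def W_def)
    define A where "A = ray_poly (\<lambda>y. \<tau> (g (v + y) - v)) y"
    have "real_polynomial_function (\<lambda>y. \<tau> (- v + g (v + y)))"
      by (rule real_polynomial_function_translate[OF real_polynomial_function_linear_compose[OF
          real_polynomial_function_translate[OF \<tau>p] linear_G[OF gG]]])
    then have A: "poly A t = \<tau> (g (v + t *\<^sub>R y) - v)" for t
      unfolding A_def by (simp add: poly_ray_poly)
    have 1: "ray_poly (\<lambda>y. F (g (v + y))) y = A * E g y"
      by (intro ray_poly_eqI) (simp add: A E[OF gG] F_def)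
    have "[:0, 1:] dvd ray_poly (\<lambda>y. m (g (v + y))) y"
      using M0[OF gG] mw[OF gv] poly_eq_0_iff_dvd[of "ray_poly (\<lambda>y. m (g (v + y))) y" 0] by simp
    then have "[:0, 1:] ^ K dvd ray_poly (\<lambda>y. m (g (v + y))) y ^ K"
      by (rule dvd_power_same)
    also have "\<dots> dvd E g y"
      unfolding E_def
      using one_diff_power_eq[of "1 - ray_poly (\<lambda>y. m (g (v + y))) y ^ K" K] by simp
    finally show ?thesis unfolding 1 using coeff0 i by (metis dvd_mult)
  qed
  \<comment> \<open>Exactly the elements of \<open>H\<close> contribute to orders below
    \<open>K\<close>, each with the same part of \<open>\<tau>\<close>; hence this
    normalisation.\<close>
  define q where "q x = (1 / card H) * (\<Sum>g\<in>G. F (g x))" for x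
  show thesis
  proof
    show "q \<in> invariants G"
    proof -
      have "real_polynomial_function q"
        using sum_orbit_invariant[OF Fp] unfolding q_def invariants_def
        by (intro rpf_mult[OF rpf_const]) simp
      then show ?thesis using sum_orbit_invariant[OF Fp] by (simp add: q_def invariants_def)
    qed
    fix i y assume i: "i < K"
    have "ray_poly (\<lambda>y. q (v + y)) y = [:1 / card H:] * (\<Sum>g\<in>G. ray_poly (\<lambda>y. F (g (v + y))) y)"
      by (rule ray_poly_eqI) (simp add: q_def poly_sum poly_ray_poly[OF Fgp])
    then have "hom_part i (\<lambda>y. q (v + y)) y = (1 / card H) * (\<Sum>g\<in>G. coeff (ray_poly (\<lambda>y. F (g (v + y))) y) i)"
      by (simp add: hom_part_def coeff_sum)
    also have "(\<Sum>g\<in>G. coeff (ray_poly (\<lambda>y. F (g (v + y))) y) i) = (\<Sum>g\<in>H. hom_part i \<tau> y)"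
      by (rule sum.mono_neutral_cong_right) (use HG finH inH notH i in auto)
    finally show "hom_part i (\<lambda>y. q (v + y)) y = hom_part i \<tau> y" using cH by simp
  qed
qed

text \<open>An invariant of the stabilizer is the sum of its homogeneous parts, and each part is
  also a part of the expansion at \<open>v\<close> of one common G-invariant \<open>q\<close>.
  Writing \<open>q\<close> in the generators of \<open>G\<close> expresses these parts through the
  expanded generators.\<close>

lemma generating_system_stabilizer:
  assumes S: "generating_system G d S"
  shows "generating_system (stabilizer v) d (slice_generators v d S)"
proof -
  have SI: "S \<subseteq> invariants G" and gen: "algebra_generated S = invariants G"
    using S algebra_generated.base unfolding generating_system_def by blast+
  have Sp: "real_polynomial_function \<sigma>" if "\<sigma> \<in> S" for \<sigma> using SI that by (auto simp: invariants_def)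
  have hom: "\<exists>e\<le>d. \<forall>c x. \<sigma> (c *\<^sub>R x) = c ^ e * \<sigma> x" if "\<sigma> \<in> S" for \<sigma>
    using S that by (auto simp: generating_system_def)
  have inv: "hom_part i (\<lambda>y. \<sigma> (v + y)) \<in> invariants (stabilizer v)" if "\<sigma> \<in> S" for \<sigma> i
  proof -
    have "ray_poly (\<lambda>y. \<sigma> (v + y)) (g y) = ray_poly (\<lambda>y. \<sigma> (v + y)) y" if g: "g \<in> stabilizer v" for g y
    proof (rule ray_poly_eqI)
      fix t
      have gG: "g \<in> G" and gv: "g v = v" using g by (auto simp: stabilizer_def)
      have "v + t *\<^sub>R g y = g (v + t *\<^sub>R y)"
        using linear_G[OF gG] gv by (simp add: linear_add linear_scale)
      moreover have "\<sigma> (g (v + t *\<^sub>R y)) = \<sigma> (v + t *\<^sub>R y)"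
        using SI \<open>\<sigma> \<in> S\<close> gG by (auto simp: invariants_def)
      ultimately show "poly (ray_poly (\<lambda>y. \<sigma> (v + y)) y) t = \<sigma> (v + t *\<^sub>R g y)"
        by (simp add: poly_ray_poly[OF real_polynomial_function_translate[OF Sp[OF \<open>\<sigma> \<in> S\<close>]]])
    qed
    then show ?thesis
      using real_polynomial_function_hom_part[OF real_polynomial_function_translate[OF Sp[OF that]]]
      by (auto simp: invariants_def hom_part_def)
  qed
  have "algebra_generated (slice_generators v d S) \<subseteq> invariants (stabilizer v)"
    by (rule algebra_generated_subset_invariants) (use inv in \<open>auto simp: slice_generators_def\<close>)
  moreover have "\<tau> \<in> algebra_generated (slice_generators v d S)" if \<tau>: "\<tau> \<in> invariants (stabilizer v)" for \<tau>
  proof -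
    have \<tau>p: "real_polynomial_function \<tau>" using \<tau> by (simp add: invariants_def)
    obtain n where n: "\<And>y. degree (ray_poly \<tau> y) \<le> n" using degree_ray_poly_bounded[OF \<tau>p] by blast
    \<comment> \<open>\<open>Suc n\<close> because the approximation is exact only for orders
      strictly below \<open>K\<close>.\<close>
    obtain q where q: "q \<in> invariants G"
        "\<And>i y. i < Suc n \<Longrightarrow> hom_part i (\<lambda>y. q (v + y)) y = hom_part i \<tau> y"
      using stabilizer_invariant_approx[OF \<tau>, of "Suc n"] by blast
    have "\<tau> y = (\<Sum>i\<le>n. hom_part i (\<lambda>y. q (v + y)) y)" for y
    proof -
      have "\<tau> y = (\<Sum>i\<le>n. hom_part i \<tau> y)"
      proof (rule sum_hom_part[OF \<tau>p])
        show "hom_part i \<tau> y = 0" if "n < i" for i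
          unfolding hom_part_def using n[of y] that by (intro coeff_eq_0) linarith
      qed
      then show ?thesis using q(2) by simp
    qed
    then have "\<tau> = (\<lambda>y. \<Sum>i\<le>n. hom_part i (\<lambda>y. q (v + y)) y)" by blast
    moreover have "\<dots> \<in> algebra_generated (slice_generators v d S)"
    proof (rule algebra_generated_sum)
      show "(\<lambda>y. hom_part i (\<lambda>y. q (v + y)) y) \<in> algebra_generated (slice_generators v d S)" for i
        using hom_part_translate_in_algebra[of S d q i v] Sp hom q(1) gen by simp
    qed simp
    ultimately show ?thesis by simp
  qed
  moreover have "\<exists>e\<le>d. \<forall>c x. \<tau> (c *\<^sub>R x) = c ^ e * \<tau> x" if "\<tau> \<in> slice_generators v d S" for \<tau>
  proof -
    obtain \<sigma> i where "\<sigma> \<in> S" "i \<le> d" "\<tau> = hom_part i (\<lambda>y. \<sigma> (v + y))"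
      using \<open>\<tau> \<in> slice_generators v d S\<close> unfolding slice_generators_def by auto
    then show ?thesis
      using hom_part_scaleR[OF real_polynomial_function_translate[OF Sp]] by blast
  qed
  moreover have "finite (slice_generators v d S)"
    using S by (auto simp: slice_generators_def generating_system_def)
  ultimately show ?thesis unfolding generating_system_def by blast
qed

end


section \<open>Lipschitz lifts over invariants\<close>

text \<open>\<open>N\<close> is read off from the way \<open>q\<close> is built from the generators,
  before the curve \<open>p\<close> is given.\<close>

lemma ck1_algebra:
  assumes "q \<in> algebra_generated S"
  shows "\<exists>N. \<forall>p. (\<forall>\<sigma>\<in>S. ck1 k M (\<lambda>t. \<sigma> (p t))) \<longrightarrow> ck1 k N (\<lambda>t. q (p t))"
  using assms
proof induction
  case (const c)
  show ?case using ck1_const[of c "\<bar>c\<bar>" k] by blast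
next
  case (base q)
  then show ?case by blast
next
  case (add q r)
  then obtain N1 N2 where
    "\<And>p. \<forall>\<sigma>\<in>S. ck1 k M (\<lambda>t. \<sigma> (p t)) \<Longrightarrow> ck1 k N1 (\<lambda>t. q (p t))"
    "\<And>p. \<forall>\<sigma>\<in>S. ck1 k M (\<lambda>t. \<sigma> (p t)) \<Longrightarrow> ck1 k N2 (\<lambda>t. r (p t))" by metis
  then show ?case by (intro exI[of _ "N1 + N2"] allI impI ck1_add) auto
next
  case (mult q r)
  then obtain N1 N2 where
    "\<And>p. \<forall>\<sigma>\<in>S. ck1 k M (\<lambda>t. \<sigma> (p t)) \<Longrightarrow> ck1 k N1 (\<lambda>t. q (p t))"
    "\<And>p. \<forall>\<sigma>\<in>S. ck1 k M (\<lambda>t. \<sigma> (p t)) \<Longrightarrow> ck1 k N2 (\<lambda>t. r (p t))" by metis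
  then show ?case by (intro exI[of _ "2 ^ Suc k * N1 * N2"] allI impI ck1_mult) auto
qed

lemma ck1_invariant:
  assumes "generating_system G d S" "q \<in> invariants G"
  shows "\<exists>N. \<forall>p. (\<forall>\<sigma>\<in>S. ck1 k M (\<lambda>t. \<sigma> (p t))) \<longrightarrow> ck1 k N (\<lambda>t. q (p t))"
  using ck1_algebra[of q S k M] assms by (simp add: generating_system_def)

text \<open>Up to sign these are the elementary symmetric functions of the members of
  \<open>F\<close>, computed by multiplying in one linear factor at a time.\<close>

lemma real_polynomial_function_coeff_prod:
  assumes "finite F" "\<And>\<phi>. \<phi> \<in> F \<Longrightarrow> real_polynomial_function \<phi>"
  shows "real_polynomial_function (\<lambda>x. coeff (\<Prod>\<phi>\<in>F. [:- \<phi> x, 1:]) i)"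
  using assms
proof (induction F arbitrary: i)
  case empty
  show ?case unfolding prod.empty by (rule rpf_const)
next
  case (insert \<phi> F)
  have *: "coeff (\<Prod>\<phi>\<in>insert \<phi> F. [:- \<phi> x, 1:]) i =
      - \<phi> x * coeff (\<Prod>\<phi>\<in>F. [:- \<phi> x, 1:]) i +
      (if i = 0 then 0 else 1) * coeff (\<Prod>\<phi>\<in>F. [:- \<phi> x, 1:]) (i - 1)" for x
    using insert.hyps by (simp add: coeff_pCons split: nat.split)
  show ?case unfolding *
    by (intro rpf_add rpf_mult rpf_const real_polynomial_function_minus insert) (use insert in auto)
qed

lemma degree_prod_linear_le: "finite F \<Longrightarrow> degree (\<Prod>\<phi>\<in>F. [:- f \<phi>, 1 :: real:]) \<le> card F"
proof (induction F rule: finite_induct)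
  case (insert x F)
  have "degree ([:- f x, 1:] * (\<Prod>\<phi>\<in>F. [:- f \<phi>, 1:])) \<le> 1 + card F"
    by (rule order_trans[OF degree_mult_le]) (use insert in simp)
  then show ?case using insert by simp
qed simp

lemma poly_sum_atMost:
  assumes "degree (p :: real poly) \<le> D"
  shows "poly p z = (\<Sum>i\<le>D. coeff p i * z ^ i)"
  unfolding poly_altdef
  by (rule sum.mono_neutral_left) (use assms in \<open>auto simp: coeff_eq_0\<close>)

lemma poly_pderiv_sum_atMost:
  assumes "degree (p :: real poly) \<le> D"
  shows "poly (pderiv p) z = (\<Sum>i\<le>D. coeff p i * (real i * z ^ (i - 1)))"
proof -
  have "((\<lambda>z. \<Sum>i\<le>D. coeff p i * z ^ i) has_real_derivative (\<Sum>i\<le>D. coeff p i * (real i * z ^ (i - 1)))) (at z)"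
  proof (rule DERIV_sum)
    show "((\<lambda>z. coeff p i * z ^ i) has_real_derivative coeff p i * (real i * z ^ (i - 1))) (at z)" for i
      using DERIV_cmult[OF DERIV_pow[of i z], of "coeff p i"] by simp
  qed
  then have "(poly p has_real_derivative (\<Sum>i\<le>D. coeff p i * (real i * z ^ (i - 1)))) (at z)"
    by (simp add: poly_sum_atMost[OF assms, abs_def])
  then show ?thesis using DERIV_unique poly_DERIV by blast
qed

text \<open>The lift \<open>p\<close> need not be continuous.\<close>
definition lifts_lipschitz :: "nat \<Rightarrow> ('a::euclidean_space \<Rightarrow> 'a) set \<Rightarrow> ('a \<Rightarrow> real) set \<Rightarrow> bool" where
  "lifts_lipschitz k G S \<longleftrightarrow> (\<forall>M. \<exists>C. \<forall>p. (\<forall>\<sigma>\<in>S. ck1 k M (\<lambda>t. \<sigma> (p t))) \<longrightarrow>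
    (\<exists>\<epsilon>>0. \<forall>t. \<bar>t\<bar> < \<epsilon> \<longrightarrow> (\<exists>g\<in>G. norm (p 0 - g (p t)) \<le> C * \<bar>t\<bar>)))"

lemma real_polynomial_function_continuous:
  fixes f :: "'a::euclidean_space \<Rightarrow> real"
  shows "real_polynomial_function f \<Longrightarrow> continuous_on A f"
  by (intro continuous_on_polymonial_function) (simp flip: real_polynomial_function_eq)

context finite_linear_group
begin

text \<open>
  \<open>\<theta>\<close> is a root of \<open>\<Prod> (T - \<phi>)\<close>, where \<open>\<phi>\<close> runs through the set of translates of \<open>\<theta>\<close>. The
  coefficients of this polynomial are invariants and near \<open>v\<close> the root is simple.
\<close>
lemma ck1_separating_invariant:
  assumes S: "generating_system G d S"
    and \<theta>: "real_polynomial_function \<theta>"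
    and inv: "\<And>h x. h \<in> stabilizer v \<Longrightarrow> \<theta> (h x) = \<theta> x"
    and sep: "\<And>g. g \<in> G \<Longrightarrow> g v \<noteq> v \<Longrightarrow> \<theta> (g v) \<noteq> \<theta> v"
  shows "\<exists>\<rho>>0. \<forall>M. \<exists>N. \<forall>p. (\<forall>\<sigma>\<in>S. ck1 k M (\<lambda>t. \<sigma> (p t))) \<longrightarrow>
    (\<forall>t\<in>unit_interval. norm (p t - v) < \<rho>) \<longrightarrow> ck1 k N (\<lambda>t. \<theta> (p t))"
proof -
  \<comment> \<open>Taken as a set, not as a family over \<open>G\<close>: every element of the
    stabilizer gives the translate \<open>\<theta>\<close> itself, which would otherwise be a
    multiple root.\<close>
  define F where "F = (\<lambda>g. \<theta> \<circ> g) ` G"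
  have finF: "finite F" by (simp add: F_def)
  have \<theta>F: "\<theta> \<in> F" using id_in by (auto simp: F_def intro!: image_eqI[of _ _ id])
  have Fp: "real_polynomial_function \<phi>" if "\<phi> \<in> F" for \<phi>
    using that real_polynomial_function_linear_compose[OF \<theta> linear_G] by (auto simp: F_def o_def)
  have sepF: "\<phi> v \<noteq> \<theta> v" if \<phi>: "\<phi> \<in> F - {\<theta>}" for \<phi>
  proof -
    obtain g where g: "g \<in> G" "\<phi> = \<theta> \<circ> g" using \<phi> by (auto simp: F_def)
    have "g v \<noteq> v"
    proof
      assume "g v = v"
      then have "\<theta> \<circ> g = \<theta>" using inv g(1) by (auto simp: stabilizer_def fun_eq_iff)
      then show False using g(2) \<phi> by simp
    qed
    then show ?thesis using sep g by simp
  qed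
  define B where "B x = (\<Prod>\<phi>\<in>F. [:- \<phi> x, 1:])" for x
  define D where "D = card F"
  have degB: "degree (B x) \<le> D" for x
    unfolding B_def D_def by (rule degree_prod_linear_le[OF finF])
  have Binv: "B (g x) = B x" if g: "g \<in> G" for g x
  proof -
    obtain k where k: "k \<in> G" "k \<circ> g = id" "g \<circ> k = id" using inverse_exists[OF g] .
    have "bij_betw (\<lambda>\<phi>. \<phi> \<circ> g) F F"
      by (rule bij_betw_byWitness[of _ "\<lambda>\<phi>. \<phi> \<circ> k"])
        (use k g comp_in in \<open>auto simp: F_def comp_assoc intro!: imageI\<close>)
    from prod.reindex_bij_betw[OF this, of "\<lambda>\<phi>. [:- \<phi> x, 1:]"] show ?thesis by (simp add: B_def)
  qed
  have coeffs: "(\<lambda>x. coeff (B x) i) \<in> invariants G" for i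
    using real_polynomial_function_coeff_prod[OF finF Fp] Binv by (simp add: invariants_def B_def)
  \<comment> \<open>The gap at \<open>v\<close> between \<open>\<theta>\<close> and the other
    translates. The inserted 1 keeps \<open>Min\<close> meaningful when there are no others.\<close>
  define s where "s = Min (insert 1 ((\<lambda>\<phi>. \<bar>\<phi> v - \<theta> v\<bar>) ` (F - {\<theta>})))"
  have s0: "0 < s" unfolding s_def using finF sepF by (subst Min_gr_iff) auto
  have s: "s \<le> \<bar>\<phi> v - \<theta> v\<bar>" if "\<phi> \<in> F - {\<theta>}" for \<phi>
    unfolding s_def using finF that by (intro Min_le) auto
  have "eventually (\<lambda>x. \<forall>\<phi>\<in>F. \<bar>\<phi> x - \<phi> v\<bar> < s / 4) (nhds v)"
  proof (intro eventually_ball_finite[OF finF] ballI)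
    fix \<phi> assume "\<phi> \<in> F"
    then have "isCont \<phi> v"
      using real_polynomial_function_continuous[OF Fp, of \<phi> UNIV] by (simp add: continuous_on_eq_continuous_at)
    then have "(\<phi> \<longlongrightarrow> \<phi> v) (nhds v)" by (simp add: isCont_def tendsto_at_iff_tendsto_nhds)
    then show "eventually (\<lambda>x. \<bar>\<phi> x - \<phi> v\<bar> < s / 4) (nhds v)"
      using s0 unfolding tendsto_iff dist_real_def by (meson divide_pos_pos zero_less_numeral)
  qed
  then obtain \<rho> where \<rho>: "0 < \<rho>" "\<And>x \<phi>. norm (x - v) < \<rho> \<Longrightarrow> \<phi> \<in> F \<Longrightarrow> \<bar>\<phi> x - \<phi> v\<bar> < s / 4"
    unfolding eventually_nhds_metric dist_norm by blast
  \<comment> \<open>Near \<open>v\<close> each translate moves by less than a quarter of the gap, so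
    at least half of it remains between values at two nearby points.\<close>
  define c where "c = (s / 2) ^ card (F - {\<theta>})"
  have c0: "0 < c" using s0 by (simp add: c_def)
  \<comment> \<open>Two points occur because \<open>ck1_root\<close> evaluates the polynomial of
    time \<open>t\<close> at the root of time \<open>s\<close>; for equal points the product is the
    derivative at the root.\<close>
  have low: "c \<le> \<bar>\<Prod>\<phi>\<in>F - {\<theta>}. (\<theta> x - \<phi> x')\<bar>"
    if "norm (x - v) < \<rho>" "norm (x' - v) < \<rho>" for x x'
  proof -
    have "c = (\<Prod>\<phi>\<in>F - {\<theta>}. s / 2)" by (simp add: c_def)
    also have "\<dots> \<le> (\<Prod>\<phi>\<in>F - {\<theta>}. \<bar>\<theta> x - \<phi> x'\<bar>)"
    proof (rule prod_mono)
      fix \<phi> assume \<phi>: "\<phi> \<in> F - {\<theta>}"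
      then show "0 \<le> s / 2 \<and> s / 2 \<le> \<bar>\<theta> x - \<phi> x'\<bar>"
        using \<rho>(2)[OF that(1) \<theta>F] \<rho>(2)[OF that(2) DiffD1[OF \<phi>]] s[OF \<phi>] s0 by linarith
    qed
    finally show ?thesis by (simp add: abs_prod)
  qed
  show ?thesis
  proof (rule exI[of _ \<rho>], intro conjI allI)
    fix M
    obtain N0 where N0: "\<And>i p. \<forall>\<sigma>\<in>S. ck1 k M (\<lambda>t. \<sigma> (p t)) \<Longrightarrow> ck1 k (N0 i) (\<lambda>t. coeff (B (p t)) i)"
      using ck1_invariant[OF S coeffs, of k M] by metis
    \<comment> \<open>\<open>ck1_root\<close> takes one constant for the coefficients and the root;
      \<open>\<bar>\<theta> v\<bar> + s\<close> bounds the root.\<close>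
    define L where "L = Max (insert (\<bar>\<theta> v\<bar> + s) (N0 ` {..D}))"
    have L1: "N0 i \<le> L" if "i \<le> D" for i unfolding L_def using that by (intro Max_ge) auto
    have L2: "\<bar>\<theta> v\<bar> + s \<le> L" unfolding L_def by (intro Max_ge) auto
    obtain N where N: "\<And>a y. \<lbrakk>\<forall>i\<le>D. ck1 k L (a i); \<forall>t\<in>unit_interval. \<bar>y t\<bar> \<le> L;
      \<forall>t\<in>unit_interval. (\<Sum>i\<le>D. a i t * y t ^ i) = 0;
      \<forall>s\<in>unit_interval. \<forall>t\<in>unit_interval. c * \<bar>y s - y t\<bar> \<le> \<bar>\<Sum>i\<le>D. a i t * y s ^ i\<bar>;
      \<forall>t\<in>unit_interval. c \<le> \<bar>\<Sum>i\<le>D. a i t * (real i * y t ^ (i - 1))\<bar>\<rbrakk> \<Longrightarrow> ck1 k N y"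
      using ck1_root[OF c0, of D k L] by blast
    show "\<exists>N. \<forall>p. (\<forall>\<sigma>\<in>S. ck1 k M (\<lambda>t. \<sigma> (p t))) \<longrightarrow>
      (\<forall>t\<in>unit_interval. norm (p t - v) < \<rho>) \<longrightarrow> ck1 k N (\<lambda>t. \<theta> (p t))"
    proof (intro exI allI impI)
      fix p assume p: "\<forall>\<sigma>\<in>S. ck1 k M (\<lambda>t. \<sigma> (p t))" and near: "\<forall>t\<in>unit_interval. norm (p t - v) < \<rho>"
      have Bp: "poly (B (p t)) z = (z - \<theta> (p t)) * (\<Prod>\<phi>\<in>F - {\<theta>}. (z - \<phi> (p t)))" for z t
        unfolding B_def prod.remove[OF finF \<theta>F] by (simp add: poly_prod left_diff_distrib)
      show "ck1 k N (\<lambda>t. \<theta> (p t))"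
      proof (rule N[of "\<lambda>i t. coeff (B (p t)) i"])
        show "\<forall>i\<le>D. ck1 k L (\<lambda>t. coeff (B (p t)) i)" using ck1_mono[OF N0[OF p] L1] by blast
        show "\<forall>t\<in>unit_interval. \<bar>\<theta> (p t)\<bar> \<le> L"
        proof
          fix t assume "t \<in> unit_interval"
          then show "\<bar>\<theta> (p t)\<bar> \<le> L" using \<rho>(2)[OF near[rule_format] \<theta>F, of t] L2 s0 by linarith
        qed
        show "\<forall>t\<in>unit_interval. (\<Sum>i\<le>D. coeff (B (p t)) i * \<theta> (p t) ^ i) = 0"
          by (simp add: Bp flip: poly_sum_atMost[OF degB])
        show "\<forall>s\<in>unit_interval. \<forall>t\<in>unit_interval. c * \<bar>\<theta> (p s) - \<theta> (p t)\<bar> \<le> \<bar>\<Sum>i\<le>D. coeff (B (p t)) i * \<theta> (p s) ^ i\<bar>"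
        proof (intro ballI)
          fix s t assume "s \<in> unit_interval" "t \<in> unit_interval"
          then have "c * \<bar>\<theta> (p s) - \<theta> (p t)\<bar> \<le> \<bar>\<Prod>\<phi>\<in>F - {\<theta>}. (\<theta> (p s) - \<phi> (p t))\<bar> * \<bar>\<theta> (p s) - \<theta> (p t)\<bar>"
            using near by (intro mult_right_mono low) auto
          then show "c * \<bar>\<theta> (p s) - \<theta> (p t)\<bar> \<le> \<bar>\<Sum>i\<le>D. coeff (B (p t)) i * \<theta> (p s) ^ i\<bar>"
            by (simp add: Bp abs_mult mult.commute flip: poly_sum_atMost[OF degB])
        qed
        show "\<forall>t\<in>unit_interval. c \<le> \<bar>\<Sum>i\<le>D. coeff (B (p t)) i * (real i * \<theta> (p t) ^ (i - 1))\<bar>"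
        proof
          fix t assume t: "t \<in> unit_interval"
          define R where "R = (\<Prod>\<phi>\<in>F - {\<theta>}. [:- \<phi> (p t), 1:])"
          have BR: "B (p t) = [:- \<theta> (p t), 1:] * R" unfolding B_def R_def by (rule prod.remove[OF finF \<theta>F])
          have "poly (pderiv (B (p t))) (\<theta> (p t)) = poly R (\<theta> (p t))"
            unfolding BR pderiv_mult by (simp add: pderiv_pCons)
          also have "\<dots> = (\<Prod>\<phi>\<in>F - {\<theta>}. (\<theta> (p t) - \<phi> (p t)))" by (simp add: R_def poly_prod)
          finally show "c \<le> \<bar>\<Sum>i\<le>D. coeff (B (p t)) i * (real i * \<theta> (p t) ^ (i - 1))\<bar>"
            using low[of "p t" "p t"] near t unfolding poly_pderiv_sum_atMost[OF degB, symmetric] by simp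
        qed
      qed
    qed
  qed (rule \<rho>(1))
qed

definition normsq :: "'a \<Rightarrow> real" where
  "normsq x = (\<Sum>g\<in>G. (norm (g x))\<^sup>2)"

lemma normsq_invariant: "normsq \<in> invariants G"
  using sum_orbit_invariant[OF real_polynomial_function_norm_squared[of 0]]
  by (simp add: normsq_def[abs_def])

lemma normsq_ge: "(norm x)\<^sup>2 \<le> normsq x"
  using member_le_sum[OF id_in, of "\<lambda>g. (norm (g x))\<^sup>2"] by (simp add: normsq_def)

lemma normsq_nonneg: "0 \<le> normsq x"
  by (simp add: normsq_def sum_nonneg)

lemma normsq_zero [simp]: "normsq 0 = 0"
  by (simp add: normsq_def linear_0[OF linear_G])

lemma normsq_pos: "x \<noteq> 0 \<Longrightarrow> 0 < normsq x"
  using normsq_ge[of x] by (smt (verit) zero_less_norm_iff zero_less_power)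

lemma normsq_scaleR: "normsq (c *\<^sub>R x) = c\<^sup>2 * normsq x"
  by (simp add: normsq_def linear_scale[OF linear_G] power_mult_distrib sum_distrib_left)

lemma normsq_apply: "g \<in> G \<Longrightarrow> normsq (g x) = normsq x"
  using normsq_invariant by (simp add: invariants_def)

text \<open>By itself \<tau>(x - v) may take its value at \<open>v\<close> also at other points of
  the orbit. The function \<open>normsq\<close> (x - v) does not, nor does the sum of \<tau>(x - v)
  and a large multiple of it; so both are regular along the lift, and \<tau> is recovered by
  subtraction.\<close>

lemma ck1_stabilizer_invariant:
  assumes S: "generating_system G d S" and \<tau>: "\<tau> \<in> invariants (stabilizer v)"
  shows "\<exists>\<rho>>0. \<forall>M. \<exists>N. \<forall>p. (\<forall>\<sigma>\<in>S. ck1 k M (\<lambda>t. \<sigma> (p t))) \<longrightarrow>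
    (\<forall>t\<in>unit_interval. norm (p t - v) < \<rho>) \<longrightarrow> ck1 k N (\<lambda>t. \<tau> (p t - v))"
proof -
  \<comment> \<open>Large enough for the quadratic term to outweigh the change of
    \<open>\<tau>\<close> at every other point of the orbit; the 1 makes this strict. For
    \<open>g v = v\<close> the summand is 0 / 0 = 0.\<close>
  define \<mu> where "\<mu> = 1 + (\<Sum>g\<in>G. \<bar>\<tau> (g v - v) - \<tau> 0\<bar> / normsq (g v - v))"
  have \<tau>p: "real_polynomial_function \<tau>" using \<tau> by (simp add: invariants_def)
  have np: "real_polynomial_function normsq" using normsq_invariant by (simp add: invariants_def)
  have shift: "h x - v = h (x - v)" if "h \<in> stabilizer v" for h x
    using that linear_diff[OF linear_G, of h x v] by (auto simp: stabilizer_def)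
  have np': "real_polynomial_function (\<lambda>x. normsq (x - v))"
    using real_polynomial_function_translate[OF np, of "- v"] by simp
  have \<tau>p': "real_polynomial_function (\<lambda>x. \<tau> (x - v))"
    using real_polynomial_function_translate[OF \<tau>p, of "- v"] by simp
  have ninv: "normsq (h x - v) = normsq (x - v)" if "h \<in> stabilizer v" for h x
    using shift[OF that] normsq_apply that by (simp add: stabilizer_def)
  have \<tau>inv: "\<tau> (h x - v) = \<tau> (x - v)" if "h \<in> stabilizer v" for h x
    using shift[OF that] \<tau> that by (simp add: invariants_def)
  have "\<exists>\<rho>>0. \<forall>M. \<exists>N. \<forall>p. (\<forall>\<sigma>\<in>S. ck1 k M (\<lambda>t. \<sigma> (p t))) \<longrightarrow>
    (\<forall>t\<in>unit_interval. norm (p t - v) < \<rho>) \<longrightarrow> ck1 k N (\<lambda>t. normsq (p t - v))"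
  proof (rule ck1_separating_invariant[OF S np'])
    show "normsq (g v - v) \<noteq> normsq (v - v)" if "g v \<noteq> v" for g
      using normsq_pos[of "g v - v"] that by simp
  qed (rule ninv)
  then obtain \<rho>1 where \<rho>1: "0 < \<rho>1" "\<And>M. \<exists>N. \<forall>p. (\<forall>\<sigma>\<in>S. ck1 k M (\<lambda>t. \<sigma> (p t))) \<longrightarrow>
    (\<forall>t\<in>unit_interval. norm (p t - v) < \<rho>1) \<longrightarrow> ck1 k N (\<lambda>t. normsq (p t - v))" by blast
  have "\<exists>\<rho>>0. \<forall>M. \<exists>N. \<forall>p. (\<forall>\<sigma>\<in>S. ck1 k M (\<lambda>t. \<sigma> (p t))) \<longrightarrow>
    (\<forall>t\<in>unit_interval. norm (p t - v) < \<rho>) \<longrightarrow> ck1 k N (\<lambda>t. \<tau> (p t - v) + \<mu> * normsq (p t - v))"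
  proof (rule ck1_separating_invariant[OF S])
    show "real_polynomial_function (\<lambda>x. \<tau> (x - v) + \<mu> * normsq (x - v))"
      by (intro rpf_add rpf_mult[OF rpf_const] np' \<tau>p')
    show "\<tau> (h x - v) + \<mu> * normsq (h x - v) = \<tau> (x - v) + \<mu> * normsq (x - v)"
      if "h \<in> stabilizer v" for h x
      using ninv[OF that] \<tau>inv[OF that] by simp
    show "\<tau> (g v - v) + \<mu> * normsq (g v - v) \<noteq> \<tau> (v - v) + \<mu> * normsq (v - v)"
      if g: "g \<in> G" "g v \<noteq> v" for g
    proof -
      have n: "0 < normsq (g v - v)" using normsq_pos[of "g v - v"] g by simp
      have "\<bar>\<tau> (g v - v) - \<tau> 0\<bar> / normsq (g v - v) < \<mu>"
        unfolding \<mu>_def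
        using member_le_sum[OF g(1), of "\<lambda>g. \<bar>\<tau> (g v - v) - \<tau> 0\<bar> / normsq (g v - v)"]
        by (simp add: normsq_nonneg)
      then have "\<bar>\<tau> (g v - v) - \<tau> 0\<bar> < \<mu> * normsq (g v - v)" using n by (simp add: pos_divide_less_eq)
      then show ?thesis by auto
    qed
  qed
  then obtain \<rho>2 where \<rho>2: "0 < \<rho>2" "\<And>M. \<exists>N. \<forall>p. (\<forall>\<sigma>\<in>S. ck1 k M (\<lambda>t. \<sigma> (p t))) \<longrightarrow>
    (\<forall>t\<in>unit_interval. norm (p t - v) < \<rho>2) \<longrightarrow> ck1 k N (\<lambda>t. \<tau> (p t - v) + \<mu> * normsq (p t - v))" by blast
  show ?thesis
  proof (rule exI[of _ "min \<rho>1 \<rho>2"], intro conjI allI)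
    fix M
    obtain N1 where N1: "\<And>p. (\<forall>\<sigma>\<in>S. ck1 k M (\<lambda>t. \<sigma> (p t))) \<Longrightarrow>
      (\<forall>t\<in>unit_interval. norm (p t - v) < \<rho>1) \<Longrightarrow> ck1 k N1 (\<lambda>t. normsq (p t - v))" using \<rho>1(2)[of M] by blast
    obtain N2 where N2: "\<And>p. (\<forall>\<sigma>\<in>S. ck1 k M (\<lambda>t. \<sigma> (p t))) \<Longrightarrow>
      (\<forall>t\<in>unit_interval. norm (p t - v) < \<rho>2) \<Longrightarrow> ck1 k N2 (\<lambda>t. \<tau> (p t - v) + \<mu> * normsq (p t - v))"
      using \<rho>2(2)[of M] by blast
    show "\<exists>N. \<forall>p. (\<forall>\<sigma>\<in>S. ck1 k M (\<lambda>t. \<sigma> (p t))) \<longrightarrow>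
      (\<forall>t\<in>unit_interval. norm (p t - v) < min \<rho>1 \<rho>2) \<longrightarrow> ck1 k N (\<lambda>t. \<tau> (p t - v))"
    proof (intro exI allI impI)
      fix p assume p: "\<forall>\<sigma>\<in>S. ck1 k M (\<lambda>t. \<sigma> (p t))"
        and near: "\<forall>t\<in>unit_interval. norm (p t - v) < min \<rho>1 \<rho>2"
      have "ck1 k (N2 + \<bar>- \<mu>\<bar> * N1) (\<lambda>t. (\<tau> (p t - v) + \<mu> * normsq (p t - v)) + (- \<mu>) * normsq (p t - v))"
        by (intro ck1_add ck1_cmult N1 N2 p) (use near in auto)
      then show "ck1 k (N2 + \<bar>- \<mu>\<bar> * N1) (\<lambda>t. \<tau> (p t - v))" by simp
    qed
  qed (use \<rho>1(1) \<rho>2(1) in simp)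
qed

lemma ck1_stabilizer_invariants:
  assumes S: "generating_system G d S" and "finite T" "T \<subseteq> invariants (stabilizer v)"
  shows "\<exists>\<rho>>0. \<forall>M. \<exists>N. \<forall>p. (\<forall>\<sigma>\<in>S. ck1 k M (\<lambda>t. \<sigma> (p t))) \<longrightarrow>
    (\<forall>t\<in>unit_interval. norm (p t - v) < \<rho>) \<longrightarrow> (\<forall>\<tau>\<in>T. ck1 k N (\<lambda>t. \<tau> (p t - v)))"
  using assms(2,3)
proof (induction T)
  case empty
  then show ?case by (intro exI[of _ 1]) simp
next
  case (insert \<tau> T)
  obtain \<rho>1 where \<rho>1: "0 < \<rho>1" "\<And>M. \<exists>N. \<forall>p. (\<forall>\<sigma>\<in>S. ck1 k M (\<lambda>t. \<sigma> (p t))) \<longrightarrow>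
    (\<forall>t\<in>unit_interval. norm (p t - v) < \<rho>1) \<longrightarrow> (\<forall>\<tau>\<in>T. ck1 k N (\<lambda>t. \<tau> (p t - v)))"
    using insert.IH insert.prems by blast
  obtain \<rho>2 where \<rho>2: "0 < \<rho>2" "\<And>M. \<exists>N. \<forall>p. (\<forall>\<sigma>\<in>S. ck1 k M (\<lambda>t. \<sigma> (p t))) \<longrightarrow>
    (\<forall>t\<in>unit_interval. norm (p t - v) < \<rho>2) \<longrightarrow> ck1 k N (\<lambda>t. \<tau> (p t - v))"
    using ck1_stabilizer_invariant[OF S, of \<tau> v] insert.prems by blast
  show ?case
  proof (rule exI[of _ "min \<rho>1 \<rho>2"], intro conjI allI)
    fix M
    obtain N1 where N1: "\<And>p. (\<forall>\<sigma>\<in>S. ck1 k M (\<lambda>t. \<sigma> (p t))) \<Longrightarrow>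
      (\<forall>t\<in>unit_interval. norm (p t - v) < \<rho>1) \<Longrightarrow> (\<forall>\<tau>\<in>T. ck1 k N1 (\<lambda>t. \<tau> (p t - v)))" using \<rho>1(2)[of M] by blast
    obtain N2 where N2: "\<And>p. (\<forall>\<sigma>\<in>S. ck1 k M (\<lambda>t. \<sigma> (p t))) \<Longrightarrow>
      (\<forall>t\<in>unit_interval. norm (p t - v) < \<rho>2) \<Longrightarrow> ck1 k N2 (\<lambda>t. \<tau> (p t - v))"
      using \<rho>2(2)[of M] by blast
    show "\<exists>N. \<forall>p. (\<forall>\<sigma>\<in>S. ck1 k M (\<lambda>t. \<sigma> (p t))) \<longrightarrow>
      (\<forall>t\<in>unit_interval. norm (p t - v) < min \<rho>1 \<rho>2) \<longrightarrow> (\<forall>\<tau>'\<in>insert \<tau> T. ck1 k N (\<lambda>t. \<tau>' (p t - v)))"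
    proof (intro exI allI impI ballI)
      fix p \<tau>' assume p: "\<forall>\<sigma>\<in>S. ck1 k M (\<lambda>t. \<sigma> (p t))"
        and near: "\<forall>t\<in>unit_interval. norm (p t - v) < min \<rho>1 \<rho>2" and \<tau>': "\<tau>' \<in> insert \<tau> T"
      have n1: "\<forall>t\<in>unit_interval. norm (p t - v) < \<rho>1" and n2: "\<forall>t\<in>unit_interval. norm (p t - v) < \<rho>2"
        using near by simp_all
      show "ck1 k (max N1 N2) (\<lambda>t. \<tau>' (p t - v))"
      proof (cases "\<tau>' = \<tau>")
        case True
        show ?thesis unfolding True by (rule ck1_mono[OF N2[OF p n2]]) simp
      next
        case False
        then have "ck1 k N1 (\<lambda>t. \<tau>' (p t - v))" using N1[OF p n1] \<tau>' by simp
        then show ?thesis by (rule ck1_mono) simp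
      qed
    qed
  qed (use \<rho>1(1) \<rho>2(1) in simp)
qed

end

section \<open>Reduction to stabilizers and splitting off the fixed part\<close>

context finite_linear_group
begin

text \<open>The lift is replaced by translates that stay close to \<open>v\<close>, where the
  invariants of the stabilizer are regular along it; the hypothesis is then applied to the
  difference with \<open>v\<close>. Elements of the stabilizer fix \<open>v\<close>, so
  \<open>v\<close> cancels in the final estimate.\<close>

lemma lifts_lipschitz_near:
  assumes S: "generating_system G d S"
    and IH: "lifts_lipschitz k (stabilizer v) (slice_generators v d S)"
  shows "\<exists>\<eta>>0. \<exists>C. \<forall>q. (\<forall>\<sigma>\<in>S. ck1 k M (\<lambda>t. \<sigma> (q t))) \<longrightarrow> norm (q 0 - v) < \<eta> \<longrightarrow>
    (\<exists>\<epsilon>>0. \<forall>t. \<bar>t\<bar> < \<epsilon> \<longrightarrow> (\<exists>g\<in>G. norm (q 0 - g (q t)) \<le> C * \<bar>t\<bar>))"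
proof -
  have slice: "generating_system (stabilizer v) d (slice_generators v d S)"
    by (rule generating_system_stabilizer[OF S])
  then have "finite (slice_generators v d S)" "slice_generators v d S \<subseteq> invariants (stabilizer v)"
    using algebra_generated.base unfolding generating_system_def by blast+
  from ck1_stabilizer_invariants[OF S this, of k] obtain \<rho> where \<rho>: "0 < \<rho>"
    "\<And>M. \<exists>N. \<forall>p. (\<forall>\<sigma>\<in>S. ck1 k M (\<lambda>t. \<sigma> (p t))) \<longrightarrow>
    (\<forall>t\<in>unit_interval. norm (p t - v) < \<rho>) \<longrightarrow> (\<forall>\<tau>\<in>slice_generators v d S. ck1 k N (\<lambda>t. \<tau> (p t - v)))"
    by blast
  obtain N where N: "\<And>p. (\<forall>\<sigma>\<in>S. ck1 k M (\<lambda>t. \<sigma> (p t))) \<Longrightarrow>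
    (\<forall>t\<in>unit_interval. norm (p t - v) < \<rho>) \<Longrightarrow> (\<forall>\<tau>\<in>slice_generators v d S. ck1 k N (\<lambda>t. \<tau> (p t - v)))"
    using \<rho>(2)[of M] by blast
  obtain C where C: "\<And>p. (\<forall>\<tau>\<in>slice_generators v d S. ck1 k N (\<lambda>t. \<tau> (p t))) \<Longrightarrow>
    (\<exists>\<epsilon>>0. \<forall>t. \<bar>t\<bar> < \<epsilon> \<longrightarrow> (\<exists>g\<in>stabilizer v. norm (p 0 - g (p t)) \<le> C * \<bar>t\<bar>))"
    using IH unfolding lifts_lipschitz_def by blast
  \<comment> \<open>An invariant that vanishes exactly on the orbit of \<open>v\<close>, so
    invariant data alone show that some translate of a point is near \<open>v\<close>: if the
    product is below \<open>\<zeta>\<close>, some factor is below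
    \<open>\<rho>\<^sup>2\<close>.\<close>
  define D where "D x = (\<Prod>g\<in>G. (norm (g x - v))\<^sup>2)" for x
  have D: "D \<in> invariants G"
    unfolding D_def by (rule prod_orbit_invariant[OF real_polynomial_function_norm_squared])
  obtain L where L: "\<And>q. (\<forall>\<sigma>\<in>S. ck1 k M (\<lambda>t. \<sigma> (q t))) \<Longrightarrow> ck1 k L (\<lambda>t. D (q t))"
    using ck1_invariant[OF S D, of k M] by blast
  define \<zeta> where "\<zeta> = (\<rho>\<^sup>2) ^ card G"
  have \<zeta>0: "0 < \<zeta>" using \<rho>(1) by (simp add: \<zeta>_def)
  have near: "\<exists>g\<in>G. norm (g x - v) < \<rho>" if "D x < \<zeta>" for x
  proof (rule ccontr)
    assume "\<not> ?thesis"
    then have *: "\<rho> \<le> norm (g x - v)" if "g \<in> G" for g using that by force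
    have "\<zeta> = (\<Prod>g\<in>G. \<rho>\<^sup>2)" by (simp add: \<zeta>_def)
    also have "\<dots> \<le> D x"
      unfolding D_def using * \<rho>(1) by (intro prod_mono) (auto intro: power_mono)
    finally show False using that by simp
  qed
  have "D v = 0" unfolding D_def by (rule prod_zero[OF finite_G], rule bexI[OF _ id_in]) simp
  moreover have "isCont D v"
    using real_polynomial_function_continuous[of D UNIV] D
    by (simp add: invariants_def continuous_on_eq_continuous_at)
  ultimately obtain \<eta>' where \<eta>': "0 < \<eta>'" "\<And>x. norm (x - v) < \<eta>' \<Longrightarrow> \<bar>D x\<bar> < \<zeta> / 2"
    using \<zeta>0 unfolding continuous_at_eps_delta by (metis dist_norm diff_zero half_gt_zero real_norm_def)
  define \<eta> where "\<eta> = min \<eta>' \<rho>"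
  \<comment> \<open>On the shortened parameter interval \<open>D\<close> changes by at most half of
    \<open>\<zeta>\<close>; the other half is reserved for \<open>D (q 0)\<close>. The 1 in the
    denominator covers \<open>L = 0\<close>.\<close>
  define \<kappa> where "\<kappa> = min 1 (\<zeta> / (2 * \<bar>L\<bar> + 1))"
  have \<kappa>: "0 < \<kappa>" "\<kappa> \<le> 1" "\<bar>L\<bar> * \<kappa> \<le> \<zeta> / 2"
  proof -
    show "0 < \<kappa>" "\<kappa> \<le> 1" using \<zeta>0 by (auto simp: \<kappa>_def)
    have "\<bar>L\<bar> * \<kappa> \<le> \<bar>L\<bar> * (\<zeta> / (2 * \<bar>L\<bar> + 1))" by (intro mult_left_mono) (auto simp: \<kappa>_def)
    also have "\<dots> \<le> \<zeta> / 2" using \<zeta>0 by (simp add: field_simps)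
    finally show "\<bar>L\<bar> * \<kappa> \<le> \<zeta> / 2" .
  qed
  show ?thesis
  proof (rule exI[of _ \<eta>], rule conjI[rotated], rule exI[of _ "C / \<kappa>"], intro allI impI)
    show "0 < \<eta>" using \<eta>'(1) \<rho>(1) by (simp add: \<eta>_def)
    fix q assume q: "\<forall>\<sigma>\<in>S. ck1 k M (\<lambda>t. \<sigma> (q t))" and q0: "norm (q 0 - v) < \<eta>"
    have "\<exists>g\<in>G. norm (g (q (\<kappa> * t)) - v) < \<rho>" if t: "t \<in> unit_interval" for t
    proof (rule near)
      have \<kappa>t: "\<kappa> * t \<in> unit_interval" using scaled_unit_interval[OF _ \<kappa>(2) t] \<kappa>(1) by simp
      have "\<bar>D (q (\<kappa> * t)) - D (q 0)\<bar> \<le> L * \<bar>\<kappa> * t - 0\<bar>"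
        by (rule ck1_lip[OF L[OF q] \<kappa>t]) simp
      also have "\<dots> \<le> \<bar>L\<bar> * (\<kappa> * 1)"
        unfolding diff_0_right abs_mult using \<kappa>(1) t by (intro mult_mono) auto
      also have "\<dots> = \<bar>L\<bar> * \<kappa>" by simp
      also have "\<dots> \<le> \<zeta> / 2" by (rule \<kappa>(3))
      finally have "\<bar>D (q (\<kappa> * t)) - D (q 0)\<bar> \<le> \<zeta> / 2" .
      moreover have "\<bar>D (q 0)\<bar> < \<zeta> / 2" using \<eta>'(2)[of "q 0"] q0 by (simp add: \<eta>_def)
      ultimately show "D (q (\<kappa> * t)) < \<zeta>" by linarith
    qed
    then obtain \<gamma>0 where \<gamma>0: "\<And>t. t \<in> unit_interval \<Longrightarrow> \<gamma>0 t \<in> G \<and> norm (\<gamma>0 t (q (\<kappa> * t)) - v) < \<rho>"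
      by metis
    \<comment> \<open>At time 0 no translate may intervene, since the claim concerns
      \<open>q 0\<close> itself; \<open>\<eta> \<le> \<rho>\<close> makes the identity admissible
      there.\<close>
    define \<gamma> where "\<gamma> = \<gamma>0(0 := id)"
    define p where "p t = \<gamma> t (q (\<kappa> * t))" for t
    have \<gamma>: "\<gamma> t \<in> G \<and> norm (p t - v) < \<rho>" if "t \<in> unit_interval" for t
      using \<gamma>0[OF that] id_in q0 by (simp add: \<gamma>_def p_def \<eta>_def)
    have p: "\<forall>\<sigma>\<in>S. ck1 k M (\<lambda>t. \<sigma> (p t))"
    proof
      fix \<sigma> assume \<sigma>: "\<sigma> \<in> S"
      then have "\<sigma> \<in> invariants G"
        using S algebra_generated.base unfolding generating_system_def by blast
      then have "\<sigma> (p t) = \<sigma> (q (\<kappa> * t))" if "t \<in> unit_interval" for t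
        using \<gamma>[OF that] by (simp add: p_def invariants_def)
      moreover have "ck1 k M (\<lambda>t. \<sigma> (q (\<kappa> * t)))"
        using ck1_rescale[of \<kappa> k M "\<lambda>t. \<sigma> (q t)"] \<kappa> q \<sigma> by simp
      ultimately show "ck1 k M (\<lambda>t. \<sigma> (p t))" using ck1_cong by (metis (no_types, lifting))
    qed
    have "\<forall>\<tau>\<in>slice_generators v d S. ck1 k N (\<lambda>t. \<tau> (p t - v))"
      by (rule N[OF p]) (use \<gamma> in blast)
    from C[OF this] obtain \<epsilon> where \<epsilon>: "0 < \<epsilon>"
      "\<And>t. \<bar>t\<bar> < \<epsilon> \<Longrightarrow> \<exists>g\<in>stabilizer v. norm (p 0 - v - g (p t - v)) \<le> C * \<bar>t\<bar>" by blast
    show "\<exists>\<epsilon>>0. \<forall>t. \<bar>t\<bar> < \<epsilon> \<longrightarrow> (\<exists>g\<in>G. norm (q 0 - g (q t)) \<le> C / \<kappa> * \<bar>t\<bar>)"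
    proof (rule exI[of _ "\<kappa> * min 1 \<epsilon>"], intro conjI allI impI)
      show "0 < \<kappa> * min 1 \<epsilon>" using \<kappa>(1) \<epsilon>(1) by simp
      fix t assume t: "\<bar>t\<bar> < \<kappa> * min 1 \<epsilon>"
      define s where "s = t / \<kappa>"
      have "\<bar>s\<bar> < min 1 \<epsilon>" using t \<kappa>(1) unfolding s_def abs_divide by (simp only: pos_divide_less_eq abs_of_pos mult.commute)
      then have s: "s \<in> unit_interval" "\<bar>s\<bar> < \<epsilon>" by (auto simp: abs_less_iff)
      obtain h where h: "h \<in> stabilizer v" "norm (p 0 - v - h (p s - v)) \<le> C * \<bar>s\<bar>" using \<epsilon>(2)[OF s(2)] by blast
      have hG: "h \<in> G" and hv: "h v = v" using h(1) by (auto simp: stabilizer_def)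
      have "p 0 - v - h (p s - v) = q 0 - (h \<circ> \<gamma> s) (q t)"
        using linear_diff[OF linear_G[OF hG]] hv \<kappa>(1) by (simp add: p_def s_def \<gamma>_def)
      moreover have "C * \<bar>s\<bar> = C / \<kappa> * \<bar>t\<bar>" using \<kappa>(1) by (simp add: s_def abs_divide)
      moreover have "h \<circ> \<gamma> s \<in> G" using comp_in[OF hG] \<gamma>[OF s(1)] by blast
      ultimately show "\<exists>g\<in>G. norm (q 0 - g (q t)) \<le> C / \<kappa> * \<bar>t\<bar>" using h(2) by metis
    qed
  qed
qed

text \<open>The Reynolds operator, that is, the projection onto the subspace of vectors fixed by
  \<open>G\<close>.\<close>

definition average :: "'a \<Rightarrow> 'a" where
  "average x = (1 / card G) *\<^sub>R (\<Sum>g\<in>G. g x)"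

lemma linear_average: "linear average"
proof (rule linearI)
  show "average (x + y) = average x + average y" for x y
    by (simp add: average_def linear_add[OF linear_G] sum.distrib scaleR_add_right)
  show "average (c *\<^sub>R x) = c *\<^sub>R average x" for c x
    by (simp add: average_def linear_scale[OF linear_G] flip: scaleR_sum_right)
qed

lemma average_apply: "g \<in> G \<Longrightarrow> average (g x) = average x"
  using sum_translate[of g "\<lambda>h. h x"] by (simp add: average_def)

lemma apply_average:
  assumes "g \<in> G"
  shows "g (average x) = average x"
proof -
  have "g (average x) = (1 / card G) *\<^sub>R (\<Sum>h\<in>G. (g \<circ> h) x)"
    by (simp add: average_def linear_scale[OF linear_G[OF assms]] linear_sum[OF linear_G[OF assms]])
  also have "(\<Sum>h\<in>G. (g \<circ> h) x) = (\<Sum>h\<in>G. h x)"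
    using sum.reindex_bij_betw[OF bij_betw_comp_left[OF assms], of "\<lambda>h. h x"] .
  finally show ?thesis by (simp add: average_def)
qed

lemma average_fixed:
  assumes "\<And>g. g \<in> G \<Longrightarrow> g x = x"
  shows "average x = x"
proof -
  have "(\<Sum>g\<in>G. g x) = (\<Sum>g\<in>G. x)" using assms by (intro sum.cong) auto
  then show ?thesis using id_in by (auto simp: average_def sum_constant_scaleR)
qed

lemma average_diff_average: "average (x - average x) = 0"
  using average_fixed[of "average x"] by (simp add: apply_average linear_diff[OF linear_average])

lemma average_inner_invariant: "(\<lambda>x. average x \<bullet> b) \<in> invariants G"
proof -
  have "bounded_linear (\<lambda>x. average x \<bullet> b)"
    using bounded_linear_compose[OF bounded_linear_inner_left] linear_average
    by (simp add: linear_conv_bounded_linear)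
  then show ?thesis using rpf_linear by (simp add: invariants_def average_apply)
qed

text \<open>The coordinates of the average are linear invariants, hence Lipschitz along the lift; on
  the fixed part orbits are single points.\<close>

lemma average_lipschitz:
  assumes S: "generating_system G d S"
  shows "\<exists>C. \<forall>p. (\<forall>\<sigma>\<in>S. ck1 k M (\<lambda>t. \<sigma> (p t))) \<longrightarrow>
    (\<forall>t\<in>unit_interval. norm (average (p 0) - average (p t)) \<le> C * \<bar>t\<bar>)"
proof -
  obtain N where N: "\<And>b p. (\<forall>\<sigma>\<in>S. ck1 k M (\<lambda>t. \<sigma> (p t))) \<Longrightarrow> ck1 k (N b) (\<lambda>t. average (p t) \<bullet> b)"
    using ck1_invariant[OF S average_inner_invariant, of k M] by metis
  show ?thesis
  proof (intro exI allI impI ballI)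
    fix p t assume p: "\<forall>\<sigma>\<in>S. ck1 k M (\<lambda>t. \<sigma> (p t))" and t: "t \<in> unit_interval"
    have "norm (average (p 0) - average (p t)) \<le> (\<Sum>b\<in>Basis. \<bar>(average (p 0) - average (p t)) \<bullet> b\<bar>)"
      by (rule norm_le_l1)
    also have "\<dots> \<le> (\<Sum>b\<in>Basis. N b * \<bar>t\<bar>)"
    proof (rule sum_mono)
      fix b :: 'a
      show "\<bar>(average (p 0) - average (p t)) \<bullet> b\<bar> \<le> N b * \<bar>t\<bar>"
        using ck1_lip[OF N[OF p], of 0 t b] t by (simp add: inner_diff_left)
    qed
    finally show "norm (average (p 0) - average (p t)) \<le> (\<Sum>b\<in>Basis. N b) * \<bar>t\<bar>"
      by (simp add: sum_distrib_right)
  qed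
qed


text \<open>Each generator is constant or linear, and a linear invariant takes the same value at
  \<open>x\<close> and at its average. So all invariants agree at \<open>x\<close> and 0, and
  \<open>normsq\<close> would tell these points apart.\<close>

lemma average_eq_0_degree_1:
  assumes S: "generating_system G 1 S" and x: "average x = 0"
  shows "x = 0"
proof -
  have \<sigma>0: "\<sigma> x = \<sigma> 0" if \<sigma>: "\<sigma> \<in> S" for \<sigma>
  proof -
    have \<sigma>I: "\<sigma> \<in> invariants G"
      using S \<sigma> algebra_generated.base unfolding generating_system_def by blast
    obtain e where e: "e \<le> 1" "\<And>c x. \<sigma> (c *\<^sub>R x) = c ^ e * \<sigma> x"
      using S \<sigma> by (auto simp: generating_system_def)
    show ?thesis
    proof (cases "e = 0")
      case True
      then show ?thesis using e(2)[of 0 x] by simp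
    next
      case False
      then have e1: "\<sigma> (c *\<^sub>R x) = c * \<sigma> x" for c x using e by (metis One_nat_def le_SucE le_zero_eq power_one_right)
      have "ray_poly \<sigma> y = [:0, \<sigma> y:]" for y by (rule ray_poly_eqI) (simp add: e1)
      then have "hom_part 1 \<sigma> = \<sigma>" by (simp add: hom_part_def fun_eq_iff)
      then have lin: "linear \<sigma>" using linear_hom_part_1[of \<sigma>] \<sigma>I by (simp add: invariants_def)
      have "\<sigma> (average x) = (1 / card G) * (\<Sum>g\<in>G. \<sigma> (g x))"
        by (simp add: average_def linear_scale[OF lin] linear_sum[OF lin])
      also have "\<dots> = \<sigma> x" using \<sigma>I card_pos by (auto simp: invariants_def)
      finally show ?thesis using x by simp
    qed
  qed
  have "q x = q 0" if "q \<in> algebra_generated S" for q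
    using that by induction (use \<sigma>0 in auto)
  then have "normsq x = normsq 0"
    using normsq_invariant S unfolding generating_system_def by blast
  then show ?thesis using normsq_pos[of x] normsq_zero by force
qed

text \<open>Away from the fixed points the stabilizers are proper subgroups; compactness of the unit
  sphere makes the constant uniform.\<close>
lemma lifts_lipschitz_sphere:
  assumes S: "generating_system G d S"
    and IH: "\<And>v. v \<noteq> 0 \<Longrightarrow> average v = 0 \<Longrightarrow> lifts_lipschitz k (stabilizer v) (slice_generators v d S)"
  shows "\<exists>C. \<forall>q. (\<forall>\<sigma>\<in>S. ck1 k M (\<lambda>t. \<sigma> (q t))) \<longrightarrow> average (q 0) = 0 \<longrightarrow> normsq (q 0) = 1 \<longrightarrow>
    (\<exists>\<epsilon>>0. \<forall>t. \<bar>t\<bar> < \<epsilon> \<longrightarrow> (\<exists>g\<in>G. norm (q 0 - g (q t)) \<le> C * \<bar>t\<bar>))"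
proof -
  define K where "K = {x. average x = 0 \<and> normsq x = 1}"
  have cont: "continuous_on UNIV average" "continuous_on UNIV normsq"
    using linear_average real_polynomial_function_continuous normsq_invariant
    by (auto simp: linear_continuous_on linear_conv_bounded_linear invariants_def)
  have "norm x \<le> 1" if "x \<in> K" for x
    using normsq_ge[of x] that by (simp add: K_def power_le_one_iff abs_square_le_1)
  then have "bounded K" by (auto simp: bounded_iff)
  moreover have "closed K"
    unfolding K_def by (intro closed_Collect_conj closed_Collect_eq cont continuous_on_const)
  ultimately have K: "compact K" using compact_eq_bounded_closed by blast
  have "\<forall>v. \<exists>\<eta> C. v \<in> K \<longrightarrow> \<eta> > 0 \<and> (\<forall>q. (\<forall>\<sigma>\<in>S. ck1 k M (\<lambda>t. \<sigma> (q t))) \<longrightarrow> norm (q 0 - v) < \<eta> \<longrightarrow>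
    (\<exists>\<epsilon>>0. \<forall>t. \<bar>t\<bar> < \<epsilon> \<longrightarrow> (\<exists>g\<in>G. norm (q 0 - g (q t)) \<le> C * \<bar>t\<bar>)))"
  proof
    fix v
    show "\<exists>\<eta> C. v \<in> K \<longrightarrow> \<eta> > 0 \<and> (\<forall>q. (\<forall>\<sigma>\<in>S. ck1 k M (\<lambda>t. \<sigma> (q t))) \<longrightarrow> norm (q 0 - v) < \<eta> \<longrightarrow>
    (\<exists>\<epsilon>>0. \<forall>t. \<bar>t\<bar> < \<epsilon> \<longrightarrow> (\<exists>g\<in>G. norm (q 0 - g (q t)) \<le> C * \<bar>t\<bar>)))"
    proof (cases "v \<in> K")
      case True
      then have "v \<noteq> 0" "average v = 0" by (auto simp: K_def)
      then obtain \<eta> C where "\<eta> > 0" "\<forall>q. (\<forall>\<sigma>\<in>S. ck1 k M (\<lambda>t. \<sigma> (q t))) \<longrightarrow> norm (q 0 - v) < \<eta> \<longrightarrow>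
        (\<exists>\<epsilon>>0. \<forall>t. \<bar>t\<bar> < \<epsilon> \<longrightarrow> (\<exists>g\<in>G. norm (q 0 - g (q t)) \<le> C * \<bar>t\<bar>))"
        using lifts_lipschitz_near[OF S IH, of v M] by auto
      then show ?thesis by (intro exI[of _ \<eta>] exI[of _ C] impI conjI)
    qed simp
  qed
  then obtain \<eta> C where \<eta>: "\<And>v. v \<in> K \<Longrightarrow> \<eta> v > 0" and C: "\<And>v q. v \<in> K \<Longrightarrow>
    (\<forall>\<sigma>\<in>S. ck1 k M (\<lambda>t. \<sigma> (q t))) \<Longrightarrow> norm (q 0 - v) < \<eta> v \<Longrightarrow>
    (\<exists>\<epsilon>>0. \<forall>t. \<bar>t\<bar> < \<epsilon> \<longrightarrow> (\<exists>g\<in>G. norm (q 0 - g (q t)) \<le> C v * \<bar>t\<bar>))"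
    by metis
  obtain F where F: "F \<subseteq> K" "finite F" "K \<subseteq> (\<Union>v\<in>F. ball v (\<eta> v))"
  proof (rule compactE_image[OF K, of K "\<lambda>v. ball v (\<eta> v)"])
    show "K \<subseteq> (\<Union>v\<in>K. ball v (\<eta> v))" using \<eta> by force
  qed auto
  show ?thesis
  proof (rule exI[of _ "Max (C ` F)"], intro allI impI)
    \<comment> \<open>If \<open>F\<close> is empty then so is \<open>K\<close>, and no curve meets
      these hypotheses; this covers the degenerate maximum.\<close>
    fix q assume q: "\<forall>\<sigma>\<in>S. ck1 k M (\<lambda>t. \<sigma> (q t))" and q0: "average (q 0) = 0" "normsq (q 0) = 1"
    then have "q 0 \<in> K" by (simp add: K_def)
    then obtain v where v: "v \<in> F" "norm (q 0 - v) < \<eta> v"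
      using F(3) by (auto simp: dist_norm norm_minus_commute)
    obtain \<epsilon> where \<epsilon>: "0 < \<epsilon>" "\<And>t. \<bar>t\<bar> < \<epsilon> \<Longrightarrow> \<exists>g\<in>G. norm (q 0 - g (q t)) \<le> C v * \<bar>t\<bar>"
      using C[OF subsetD[OF F(1) v(1)] q v(2)] by blast
    have "C v * \<bar>t\<bar> \<le> Max (C ` F) * \<bar>t\<bar>" for t
      using v(1) F(2) by (intro mult_right_mono Max_ge) auto
    then have "\<exists>g\<in>G. norm (q 0 - g (q t)) \<le> Max (C ` F) * \<bar>t\<bar>" if "\<bar>t\<bar> < \<epsilon>" for t
      using \<epsilon>(2)[OF that] order_trans by blast
    then show "\<exists>\<epsilon>>0. \<forall>t. \<bar>t\<bar> < \<epsilon> \<longrightarrow> (\<exists>g\<in>G. norm (q 0 - g (q t)) \<le> Max (C ` F) * \<bar>t\<bar>)"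
      using \<epsilon>(1) by blast
  qed
qed

end

section \<open>Rescaling to the unit sphere and induction on the group order\<close>

context finite_linear_group
begin

text \<open>\<open>Suc (Suc l)\<close> is the degree bound d; being at least 2, it provides the
  Lipschitz derivative for Glaeser's inequality. At the scale \<open>\<kappa> = c * r\<close> the
  top Lipschitz constant of a generator of degree e is multiplied by c^d r^(d - e), which is bounded
  because e \<le> d and \<open>r \<le> N\<close>.\<close>

lemma lifts_lipschitz_no_fixed_part:
  assumes S: "generating_system G (Suc (Suc l)) S"
    and IH: "\<And>v. v \<noteq> 0 \<Longrightarrow> average v = 0 \<Longrightarrow>
      lifts_lipschitz (Suc l) (stabilizer v) (slice_generators v (Suc (Suc l)) S)"
  shows "\<exists>C. \<forall>p. (\<forall>\<sigma>\<in>S. ck1 (Suc l) M (\<lambda>t. \<sigma> (p t))) \<longrightarrow> average (p 0) = 0 \<longrightarrow>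
    (\<exists>\<epsilon>>0. \<forall>t. \<bar>t\<bar> < \<epsilon> \<longrightarrow> (\<exists>g\<in>G. norm (p 0 - g (p t)) \<le> C * \<bar>t\<bar>))"
proof -
  obtain N0 where N0: "\<And>p. (\<forall>\<sigma>\<in>S. ck1 (Suc l) M (\<lambda>t. \<sigma> (p t))) \<Longrightarrow> ck1 (Suc l) N0 (\<lambda>t. normsq (p t))"
    using ck1_invariant[OF S normsq_invariant, of "Suc l" M] by blast
  define N where "N = max 1 N0"
  have N: "ck1 (Suc l) N (\<lambda>t. normsq (p t))" if "\<forall>\<sigma>\<in>S. ck1 (Suc l) M (\<lambda>t. \<sigma> (p t))" for p
    by (rule ck1_mono[OF N0[OF that]]) (simp add: N_def)
  have N1: "1 \<le> N" by (simp add: N_def)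
  have sqrtN: "sqrt N \<le> N" using N1 by (intro real_le_lsqrt) (auto simp: power2_eq_square)
  have finS: "finite S" and SI: "\<And>\<sigma>. \<sigma> \<in> S \<Longrightarrow> \<sigma> \<in> invariants G"
    using S algebra_generated.base unfolding generating_system_def by blast+
  \<comment> \<open>Bounds of the generators on the ball in which the rescaled lift will stay;
    interpolation trades them for the bounds on lower derivatives lost in rescaling.\<close>
  have "\<exists>B. \<forall>x\<in>cball 0 2. \<bar>\<sigma> x\<bar> \<le> B" if "\<sigma> \<in> S" for \<sigma>
  proof -
    have "compact (\<sigma> ` cball 0 2)"
      using SI[OF that] by (intro compact_continuous_image real_polynomial_function_continuous compact_cball)
        (simp add: invariants_def)
    then show ?thesis using compact_imp_bounded bounded_iff by (metis (no_types, lifting) imageI real_norm_def)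
  qed
  then obtain B0 where B0: "\<And>\<sigma> x. \<sigma> \<in> S \<Longrightarrow> x \<in> cball 0 2 \<Longrightarrow> \<bar>\<sigma> x\<bar> \<le> B0 \<sigma>" by metis
  define B where "B = Max (B0 ` S)"
  have B: "\<bar>\<sigma> x\<bar> \<le> B" if "\<sigma> \<in> S" "x \<in> cball 0 2" for \<sigma> x
  proof -
    have "B0 \<sigma> \<le> B" unfolding B_def using finS that(1) by (intro Max_ge) auto
    then show ?thesis using B0[OF that] by linarith
  qed
  obtain M' where M': "\<And>u. top_lip (Suc l) (N ^ Suc (Suc l) * M) u \<Longrightarrow> (\<forall>t\<in>unit_interval. \<bar>u t\<bar> \<le> B) \<Longrightarrow> ck1 (Suc l) M' u"
    using top_lip_bounded_imp_ck1[of "Suc l" "N ^ Suc (Suc l) * M" B] by blast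
  obtain C where C: "\<And>q. (\<forall>\<sigma>\<in>S. ck1 (Suc l) M' (\<lambda>t. \<sigma> (q t))) \<Longrightarrow> average (q 0) = 0 \<Longrightarrow> normsq (q 0) = 1 \<Longrightarrow>
    (\<exists>\<epsilon>>0. \<forall>t. \<bar>t\<bar> < \<epsilon> \<longrightarrow> (\<exists>g\<in>G. norm (q 0 - g (q t)) \<le> C * \<bar>t\<bar>))"
    using lifts_lipschitz_sphere[OF S IH, of M'] by blast
  \<comment> \<open>Makes both terms of Glaeser's inequality at most r^2 / 4 on the rescaled
    interval, and \<open>\<kappa> \<le> 1\<close> for \<open>r \<le> N\<close>.\<close>
  define c where "c = 1 / (8 * N)"
  have c: "0 < c" "c \<le> 1" using N1 by (auto simp: c_def)
  \<comment> \<open>\<open>sqrt N\<close> serves lifts starting at 0. Otherwise scaling back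
    multiplies lengths by \<open>r\<close> and times by \<open>c * r\<close>, which turns
    \<open>C\<close> into \<open>C / c\<close>.\<close>
  define C' where "C' = max (sqrt N) (C / c)"
  show ?thesis
  proof (rule exI[of _ C'], intro allI impI)
    fix p assume p: "\<forall>\<sigma>\<in>S. ck1 (Suc l) M (\<lambda>t. \<sigma> (p t))" and p0: "average (p 0) = 0"
    have gl: "\<bar>normsq (p t) - normsq (p 0)\<bar> \<le> 2 * sqrt (N * normsq (p 0)) * \<bar>t\<bar> + N * t\<^sup>2"
      if "t \<in> unit_interval" for t
      using glaeser[OF N[OF p] normsq_nonneg _ that] N1 by simp
    show "\<exists>\<epsilon>>0. \<forall>t. \<bar>t\<bar> < \<epsilon> \<longrightarrow> (\<exists>g\<in>G. norm (p 0 - g (p t)) \<le> C' * \<bar>t\<bar>)"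
    proof (cases "p 0 = 0")
      case True
      \<comment> \<open>The linear term of Glaeser's inequality vanishes here, so \<open>p t\<close>
        itself is of order \<bar>t\<bar> and the identity serves as group element.\<close>
      have "norm (p t) \<le> C' * \<bar>t\<bar>" if "\<bar>t\<bar> < 1" for t
      proof -
        have "normsq (p t) \<le> N * t\<^sup>2" using gl[of t] that True by (simp add: abs_less_iff)
        then have "(norm (p t))\<^sup>2 \<le> N * t\<^sup>2" using normsq_ge order_trans by blast
        then have "norm (p t) \<le> sqrt (N * t\<^sup>2)" by (simp add: real_le_rsqrt)
        also have "\<dots> = sqrt N * \<bar>t\<bar>" by (simp add: real_sqrt_mult)
        also have "\<dots> \<le> C' * \<bar>t\<bar>" by (intro mult_right_mono) (auto simp: C'_def)
        finally show ?thesis .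
      qed
      then show ?thesis using True id_in by (intro exI[of _ 1]) (auto intro!: bexI[of _ id])
    next
      case False
      define r where "r = sqrt (normsq (p 0))"
      have r0: "0 < r" using normsq_pos[OF False] by (simp add: r_def)
      have r2: "r\<^sup>2 = normsq (p 0)" using normsq_nonneg by (simp add: r_def)
      have "r \<le> sqrt N" using ck1_bounded[OF N[OF p], of 0] by (simp add: r_def abs_le_iff)
      also note sqrtN
      finally have rN: "r \<le> N" .
      define \<kappa> where "\<kappa> = c * r"
      have \<kappa>0: "0 < \<kappa>" using c r0 by (simp add: \<kappa>_def)
      have \<kappa>8: "\<kappa> * (8 * N) = r" using N1 by (simp add: \<kappa>_def c_def)
      have "\<kappa> \<le> c * N" unfolding \<kappa>_def using rN c by (intro mult_left_mono) auto
      also have "\<dots> \<le> 1" using N1 by (simp add: c_def)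
      finally have \<kappa>1: "\<kappa> \<le> 1" .
      define q where "q s = (1 / r) *\<^sub>R p (\<kappa> * s)" for s
      have comparable: "normsq (p (\<kappa> * s)) \<le> 2 * r\<^sup>2" if s: "s \<in> unit_interval" for s
      proof -
        have s1: "\<bar>s\<bar> \<le> 1" using s by auto
        have "\<bar>normsq (p (\<kappa> * s)) - r\<^sup>2\<bar> \<le> 2 * sqrt (N * r\<^sup>2) * \<bar>\<kappa> * s\<bar> + N * (\<kappa> * s)\<^sup>2"
          using gl[OF scaled_unit_interval[OF _ \<kappa>1 s]] \<kappa>0 unfolding r2 by simp
        also have "sqrt (N * r\<^sup>2) = sqrt N * r" using r0 by (simp add: real_sqrt_mult)
        also have "\<bar>\<kappa> * s\<bar> = \<kappa> * \<bar>s\<bar>" using \<kappa>0 by (simp add: abs_mult)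
        also have "2 * (sqrt N * r) * (\<kappa> * \<bar>s\<bar>) \<le> 2 * (N * r) * (\<kappa> * 1)"
          using N1 r0 \<kappa>0 s1 sqrtN by (intro mult_mono) auto
        also have "\<dots> = r * (\<kappa> * (8 * N)) / 4" by simp
        also have "\<dots> = r\<^sup>2 / 4" unfolding \<kappa>8 by (simp add: power2_eq_square)
        also have "N * (\<kappa> * s)\<^sup>2 \<le> N * \<kappa>\<^sup>2"
          using N1 s1 by (intro mult_left_mono) (auto simp: power_mult_distrib abs_square_le_1 mult_left_le)
        also have "\<dots> \<le> r\<^sup>2 / 4"
        proof -
          have "r\<^sup>2 = N * \<kappa>\<^sup>2 * (64 * N)" unfolding \<kappa>8[symmetric] by (simp add: power2_eq_square)
          moreover have "N * \<kappa>\<^sup>2 * 4 \<le> N * \<kappa>\<^sup>2 * (64 * N)" using N1 by (intro mult_left_mono) auto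
          ultimately show ?thesis by simp
        qed
        finally have "\<bar>normsq (p (\<kappa> * s)) - r\<^sup>2\<bar> \<le> r\<^sup>2 / 4 + r\<^sup>2 / 4" by simp
        moreover have "0 \<le> r\<^sup>2" by simp
        ultimately show ?thesis by linarith
      qed
      have q2: "q s \<in> cball 0 2" if s: "s \<in> unit_interval" for s
      proof -
        have "normsq (q s) = (1 / r)\<^sup>2 * normsq (p (\<kappa> * s))" by (simp add: q_def normsq_scaleR)
        also have "\<dots> \<le> (1 / r)\<^sup>2 * (2 * r\<^sup>2)" by (intro mult_left_mono comparable s) simp
        also have "\<dots> = 2" using r0 by (simp add: power_divide)
        finally have "(norm (q s))\<^sup>2 \<le> 2\<^sup>2" using normsq_ge[of "q s"] by simp
        then have "norm (q s) \<le> 2" by (rule power2_le_imp_le) simp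
        then show ?thesis by simp
      qed
      have "\<forall>\<sigma>\<in>S. ck1 (Suc l) M' (\<lambda>s. \<sigma> (q s))"
      proof (intro ballI M')
        fix \<sigma> assume \<sigma>: "\<sigma> \<in> S"
        show "\<bar>\<sigma> (q t)\<bar> \<le> B" if "t \<in> unit_interval" for t using B[OF \<sigma> q2[OF that]] .
        obtain e where e: "e \<le> Suc (Suc l)" "\<And>c x. \<sigma> (c *\<^sub>R x) = c ^ e * \<sigma> x"
          using S \<sigma> by (auto simp: generating_system_def)
        have M0: "0 \<le> M" using p \<sigma> ck1_nonneg by blast
        have "top_lip (Suc l) M (\<lambda>t. \<sigma> (p t))" using p \<sigma> ck1_imp_top_lip by blast
        then have "top_lip (Suc l) (\<bar>(1 / r) ^ e\<bar> * \<kappa> ^ Suc (Suc l) * M) (\<lambda>s. (1 / r) ^ e * \<sigma> (p (\<kappa> * s)))"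
          using top_lip_rescale[of \<kappa> "Suc l" M "\<lambda>t. \<sigma> (p t)"] \<kappa>0 \<kappa>1 by simp
        moreover have "\<bar>(1 / r) ^ e\<bar> * \<kappa> ^ Suc (Suc l) * M \<le> N ^ Suc (Suc l) * M"
        proof (rule mult_right_mono[OF _ M0])
          have "\<bar>(1 / r) ^ e\<bar> * \<kappa> ^ Suc (Suc l) = c ^ Suc (Suc l) * (r ^ Suc (Suc l) / r ^ e)"
            using r0 by (simp only: \<kappa>_def power_mult_distrib) (simp add: power_divide)
          also have "r ^ Suc (Suc l) / r ^ e = r ^ (Suc (Suc l) - e)"
            using r0 e(1) by (simp only: power_diff)
          also have "c ^ Suc (Suc l) * r ^ (Suc (Suc l) - e) \<le> 1 * N ^ (Suc (Suc l) - e)"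
            using c r0 rN by (intro mult_mono power_mono power_le_one) auto
          also have "\<dots> \<le> N ^ Suc (Suc l)" unfolding mult_1 using N1 by (intro power_increasing) auto
          finally show "\<bar>(1 / r) ^ e\<bar> * \<kappa> ^ Suc (Suc l) \<le> N ^ Suc (Suc l)" .
        qed
        ultimately show "top_lip (Suc l) (N ^ Suc (Suc l) * M) (\<lambda>s. \<sigma> (q s))"
          unfolding q_def e(2) by (rule top_lip_mono)
      qed
      moreover have "average (q 0) = 0" using p0 by (simp add: q_def linear_scale[OF linear_average])
      moreover have "normsq (q 0) = 1" using r0 by (simp add: q_def normsq_scaleR power_divide flip: r2)
      ultimately obtain \<epsilon> where \<epsilon>: "0 < \<epsilon>" "\<And>s. \<bar>s\<bar> < \<epsilon> \<Longrightarrow> \<exists>g\<in>G. norm (q 0 - g (q s)) \<le> C * \<bar>s\<bar>"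
        using C by blast
      show ?thesis
      proof (rule exI[of _ "\<kappa> * \<epsilon>"], intro conjI allI impI)
        show "0 < \<kappa> * \<epsilon>" using \<kappa>0 \<epsilon>(1) by simp
        fix t assume t: "\<bar>t\<bar> < \<kappa> * \<epsilon>"
        have "\<bar>t / \<kappa>\<bar> < \<epsilon>"
          using t \<kappa>0 unfolding abs_divide by (simp only: pos_divide_less_eq abs_of_pos mult.commute)
        then obtain g where g: "g \<in> G" "norm (q 0 - g (q (t / \<kappa>))) \<le> C * \<bar>t / \<kappa>\<bar>" using \<epsilon>(2) by blast
        have "q 0 - g (q (t / \<kappa>)) = (1 / r) *\<^sub>R (p 0 - g (p t))"
          using \<kappa>0 by (simp add: q_def linear_scale[OF linear_G[OF g(1)]] scaleR_diff_right)
        then have "norm (p 0 - g (p t)) = r * norm (q 0 - g (q (t / \<kappa>)))" using r0 by simp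
        also have "\<dots> \<le> r * (C * \<bar>t / \<kappa>\<bar>)" using g(2) r0 by (intro mult_left_mono) auto
        also have "\<dots> = C / c * \<bar>t\<bar>" using r0 c \<kappa>0 by (simp add: abs_divide) (simp add: \<kappa>_def)
        also have "\<dots> \<le> C' * \<bar>t\<bar>" by (intro mult_right_mono) (auto simp: C'_def)
        finally show "\<exists>g\<in>G. norm (p 0 - g (p t)) \<le> C' * \<bar>t\<bar>" using g(1) by blast
      qed
    qed
  qed
qed

text \<open>Averaging splits the lift into its fixed part, whose coordinates are invariants, and a
  rest with average 0. Group elements act trivially on the first summand, so the one found for the
  second serves both.\<close>

lemma lifts_lipschitz_step:
  assumes S: "generating_system G (Suc k) S"
    and IH: "\<And>v. v \<noteq> 0 \<Longrightarrow> average v = 0 \<Longrightarrow>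
      lifts_lipschitz k (stabilizer v) (slice_generators v (Suc k) S)"
  shows "lifts_lipschitz k G S"
  unfolding lifts_lipschitz_def
proof
  fix M
  obtain C1 where C1: "\<And>p t. (\<forall>\<sigma>\<in>S. ck1 k M (\<lambda>t. \<sigma> (p t))) \<Longrightarrow> t \<in> unit_interval \<Longrightarrow>
      norm (average (p 0) - average (p t)) \<le> C1 * \<bar>t\<bar>"
    using average_lipschitz[OF S, of k M] by blast
  have inv: "(\<lambda>x. \<sigma> (x - average x)) \<in> invariants G" if "\<sigma> \<in> S" for \<sigma>
  proof -
    have \<sigma>: "\<sigma> \<in> invariants G" using that S algebra_generated.base unfolding generating_system_def by blast
    have "linear (\<lambda>x. x - average x)" by (intro linear_compose_sub linear_ident linear_average)
    then have "real_polynomial_function (\<lambda>x. \<sigma> (x - average x))"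
      using real_polynomial_function_linear_compose \<sigma> by (auto simp: invariants_def)
    moreover have "\<sigma> (g x - average (g x)) = \<sigma> (x - average x)" if "g \<in> G" for g x
    proof -
      have "g x - average (g x) = g (x - average x)"
        using that by (simp add: average_apply linear_diff[OF linear_G] apply_average)
      then show ?thesis using \<sigma> that by (simp add: invariants_def)
    qed
    ultimately show ?thesis by (simp add: invariants_def)
  qed
  obtain M0 where M0: "\<And>\<sigma> p. \<sigma> \<in> S \<Longrightarrow> (\<forall>\<sigma>\<in>S. ck1 k M (\<lambda>t. \<sigma> (p t))) \<Longrightarrow>
      ck1 k (M0 \<sigma>) (\<lambda>t. \<sigma> (p t - average (p t)))"
    using ck1_invariant[OF S inv, of _ k M] by metis
  define M' where "M' = Max (M0 ` S)"
  have finS: "finite S" using S by (simp add: generating_system_def)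
  have M': "ck1 k M' (\<lambda>t. \<sigma> (p t - average (p t)))" if "\<sigma> \<in> S" "\<forall>\<sigma>\<in>S. ck1 k M (\<lambda>t. \<sigma> (p t))" for \<sigma> p
    by (rule ck1_mono[OF M0[OF that]]) (use finS that(1) in \<open>auto simp: M'_def\<close>)
  \<comment> \<open>The case \<open>k = 0\<close> is separate because Glaeser's inequality requires
    a derivative; there average 0 forces the lift to vanish.\<close>
  have "\<exists>C. \<forall>p. (\<forall>\<sigma>\<in>S. ck1 k M' (\<lambda>t. \<sigma> (p t))) \<longrightarrow> average (p 0) = 0 \<longrightarrow> (\<forall>t. average (p t) = 0) \<longrightarrow>
    (\<exists>\<epsilon>>0. \<forall>t. \<bar>t\<bar> < \<epsilon> \<longrightarrow> (\<exists>g\<in>G. norm (p 0 - g (p t)) \<le> C * \<bar>t\<bar>))"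
  proof (cases k)
    case 0
    then have "x = 0" if "average x = 0" for x using average_eq_0_degree_1[OF _ that, of S] S by simp
    then have "\<exists>\<epsilon>>0. \<forall>t. \<bar>t\<bar> < \<epsilon> \<longrightarrow> (\<exists>g\<in>G. norm (p 0 - g (p t)) \<le> 0 * \<bar>t\<bar>)"
      if "\<forall>t. average (p t) = 0" for p :: "real \<Rightarrow> 'a"
    proof -
      have "p t = 0" for t using that \<open>\<And>x. average x = 0 \<Longrightarrow> x = 0\<close> by blast
      then show ?thesis using id_in by (intro exI[of _ 1]) (auto intro!: bexI[of _ id])
    qed
    then show ?thesis by blast
  next
    case (Suc l)
    then show ?thesis using lifts_lipschitz_no_fixed_part[of l S M'] S IH by blast
  qed
  then obtain C2 where C2: "\<And>p. (\<forall>\<sigma>\<in>S. ck1 k M' (\<lambda>t. \<sigma> (p t))) \<Longrightarrow> (\<forall>t. average (p t) = 0) \<Longrightarrow>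
    (\<exists>\<epsilon>>0. \<forall>t. \<bar>t\<bar> < \<epsilon> \<longrightarrow> (\<exists>g\<in>G. norm (p 0 - g (p t)) \<le> C2 * \<bar>t\<bar>))"
    by blast
  show "\<exists>C. \<forall>p. (\<forall>\<sigma>\<in>S. ck1 k M (\<lambda>t. \<sigma> (p t))) \<longrightarrow>
    (\<exists>\<epsilon>>0. \<forall>t. \<bar>t\<bar> < \<epsilon> \<longrightarrow> (\<exists>g\<in>G. norm (p 0 - g (p t)) \<le> C * \<bar>t\<bar>))"
  proof (rule exI[of _ "C1 + C2"], intro allI impI)
    fix p assume p: "\<forall>\<sigma>\<in>S. ck1 k M (\<lambda>t. \<sigma> (p t))"
    define q where "q t = p t - average (p t)" for t
    have "\<forall>\<sigma>\<in>S. ck1 k M' (\<lambda>t. \<sigma> (q t))" using M'[OF _ p] by (simp add: q_def)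
    moreover have "\<forall>t. average (q t) = 0" using average_diff_average by (simp add: q_def)
    ultimately obtain \<epsilon> where \<epsilon>: "0 < \<epsilon>" "\<And>t. \<bar>t\<bar> < \<epsilon> \<Longrightarrow> \<exists>g\<in>G. norm (q 0 - g (q t)) \<le> C2 * \<bar>t\<bar>"
      using C2 by blast
    have "\<exists>g\<in>G. norm (p 0 - g (p t)) \<le> (C1 + C2) * \<bar>t\<bar>" if t: "\<bar>t\<bar> < min 1 \<epsilon>" for t
    proof -
      have tI: "t \<in> unit_interval" and "\<bar>t\<bar> < \<epsilon>" using t by (auto simp: abs_less_iff)
      then obtain g where g: "g \<in> G" "norm (q 0 - g (q t)) \<le> C2 * \<bar>t\<bar>" using \<epsilon>(2) by blast
      have "p 0 - g (p t) = (average (p 0) - average (p t)) + (q 0 - g (q t))"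
        using g(1) by (simp add: q_def linear_diff[OF linear_G] apply_average)
      then have "norm (p 0 - g (p t)) \<le> norm (average (p 0) - average (p t)) + norm (q 0 - g (q t))"
        by (metis norm_triangle_ineq)
      then have "norm (p 0 - g (p t)) \<le> (C1 + C2) * \<bar>t\<bar>"
        using C1[OF p tI] g(2) by (simp add: distrib_right)
      then show ?thesis using g(1) by blast
    qed
    then show "\<exists>\<epsilon>>0. \<forall>t. \<bar>t\<bar> < \<epsilon> \<longrightarrow> (\<exists>g\<in>G. norm (p 0 - g (p t)) \<le> (C1 + C2) * \<bar>t\<bar>)"
      using \<epsilon>(1) by (intro exI[of _ "min 1 \<epsilon>"]) simp
  qed
qed

end

text \<open>No base case is required: for the trivial group the average is the identity, and the
  hypothesis on \<open>v\<close> in \<open>lifts_lipschitz_step\<close> is void. In general a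
  nonzero \<open>v\<close> with average 0 is not fixed by all of \<open>G\<close>. The order
  \<open>k\<close> is kept, as expansions do not raise degrees above \<open>Suc k\<close>.\<close>

theorem lifts_lipschitz_of_generating_system:
  assumes "finite_linear_group G" "generating_system G (Suc k) S"
  shows "lifts_lipschitz k G S"
  using assms
proof (induction "card G" arbitrary: G S rule: less_induct)
  case less
  interpret finite_linear_group G by (rule less.prems(1))
  show ?case
  proof (rule lifts_lipschitz_step[OF less.prems(2)])
    fix v :: 'a assume v: "v \<noteq> 0" "average v = 0"
    have "\<exists>g\<in>G. g v \<noteq> v" using average_fixed[of v] v by force
    then have "stabilizer v \<subset> G" by (auto simp: stabilizer_def)
    then have "card (stabilizer v) < card G" by (rule psubset_card_mono[OF finite_G])
    then show "lifts_lipschitz k (stabilizer v) (slice_generators v (Suc k) S)"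
      by (rule less.hyps[OF _ finite_linear_group_stabilizer generating_system_stabilizer[OF less.prems(2)]])
  qed
qed


section \<open>Test functions\<close>

text \<open>\<open>pdiffs\<close> applies the last direction of a list first, so the recursion
  splits lists at their end.\<close>

lemma Ck_on_SucI:
  assumes "continuous_on UNIV f"
    and "\<And>i x. (\<lambda>t. f (x + t *\<^sub>R axis i 1)) differentiable (at 0)"
    and "\<And>i. Ck_on k UNIV (pdiff i f)"
  shows "Ck_on (Suc k) UNIV f"
  unfolding Ck_on_def
proof (intro conjI allI impI ballI)
  fix "is" :: "'a list" assume len: "length is \<le> Suc k"
  show "continuous_on UNIV (pdiffs is f)"
  proof (cases "is" rule: rev_cases)
    case (snoc js i)
    then show ?thesis using assms(3)[of i] len unfolding Ck_on_def by simp
  qed (use assms(1) in simp)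
next
  fix "is" :: "'a list" and i x assume len: "length is < Suc k"
  show "(\<lambda>t. pdiffs is f (x + t *\<^sub>R axis i 1)) differentiable (at 0)"
  proof (cases "is" rule: rev_cases)
    case (snoc js l)
    then show ?thesis using assms(3)[of l] len unfolding Ck_on_def by simp
  qed (use assms(2) in simp)
qed

lemma Ck_on_SucD:
  assumes "Ck_on (Suc k) UNIV f"
  shows "continuous_on UNIV f" "(\<lambda>t. f (x + t *\<^sub>R axis i 1)) differentiable (at 0)"
    "Ck_on k UNIV (pdiff i f)"
proof -
  have c: "length is \<le> Suc k \<Longrightarrow> continuous_on UNIV (pdiffs is f)"
    and d: "length is < Suc k \<Longrightarrow> (\<lambda>t. pdiffs is f (x + t *\<^sub>R axis l 1)) differentiable (at 0)" for "is" l x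
    using assms by (auto simp: Ck_on_def)
  show "continuous_on UNIV f" using c[of "[]"] by simp
  show "(\<lambda>t. f (x + t *\<^sub>R axis i 1)) differentiable (at 0)" using d[of "[]"] by simp
  show "Ck_on k UNIV (pdiff i f)" unfolding Ck_on_def
  proof (intro conjI allI impI ballI)
    show "continuous_on UNIV (pdiffs is (pdiff i f))" if "length is \<le> k" for "is"
      using c[of "is @ [i]"] that by simp
    show "(\<lambda>t. pdiffs is (pdiff i f) (x + t *\<^sub>R axis l 1)) differentiable (at 0)" if "length is < k" for "is" l x
      using d[of "is @ [i]"] that by simp
  qed
qed

lemma Ck_on_0: "Ck_on 0 UNIV f \<longleftrightarrow> continuous_on UNIV f"
  by (simp add: Ck_on_def)

lemma pdiff_eqI:
  "((\<lambda>t. f (x + t *\<^sub>R axis i 1)) has_real_derivative D) (at 0) \<Longrightarrow> pdiff i f x = D"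
  unfolding pdiff_def by (rule DERIV_imp_deriv)

lemma has_derivative_pdiff:
  "(\<lambda>t. f (x + t *\<^sub>R axis i 1)) differentiable (at 0) \<Longrightarrow>
    ((\<lambda>t. f (x + t *\<^sub>R axis i 1)) has_real_derivative pdiff i f x) (at 0)"
  unfolding pdiff_def by (simp add: DERIV_deriv_iff_real_differentiable)

lemma Ck_on_add:
  "Ck_on k UNIV f \<Longrightarrow> Ck_on k UNIV g \<Longrightarrow> Ck_on k UNIV (\<lambda>x. f x + g x)"
proof (induction k arbitrary: f g)
  case 0
  then show ?case by (simp add: Ck_on_0 continuous_on_add)
next
  case (Suc k)
  note f = Ck_on_SucD[OF Suc.prems(1)] and g = Ck_on_SucD[OF Suc.prems(2)]
  have d: "((\<lambda>t. f (x + t *\<^sub>R axis i 1) + g (x + t *\<^sub>R axis i 1)) has_real_derivative pdiff i f x + pdiff i g x) (at 0)" for i x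
    by (intro DERIV_add has_derivative_pdiff f g)
  have "pdiff i (\<lambda>x. f x + g x) = (\<lambda>x. pdiff i f x + pdiff i g x)" for i
    by (rule ext, rule pdiff_eqI[OF d])
  then show ?case
    using d by (intro Ck_on_SucI continuous_on_add f g)
      (auto simp: real_differentiable_def intro!: Suc.IH f g)
qed

lemma Ck_on_mult:
  "Ck_on k UNIV f \<Longrightarrow> Ck_on k UNIV g \<Longrightarrow> Ck_on k UNIV (\<lambda>x. f x * g x)"
proof (induction k arbitrary: f g)
  case 0
  then show ?case by (simp add: Ck_on_0 continuous_on_mult)
next
  case (Suc k)
  have drop: "Ck_on (Suc k) UNIV h \<Longrightarrow> Ck_on k UNIV h" for h :: "real ^ 'a \<Rightarrow> real"
    by (auto simp: Ck_on_def)
  note f = Ck_on_SucD[OF Suc.prems(1)] and g = Ck_on_SucD[OF Suc.prems(2)]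
  have d: "((\<lambda>t. f (x + t *\<^sub>R axis i 1) * g (x + t *\<^sub>R axis i 1)) has_real_derivative
      pdiff i f x * g x + pdiff i g x * f x) (at 0)" for i x
    using DERIV_mult[OF has_derivative_pdiff[of f x i, OF f(2)] has_derivative_pdiff[of g x i, OF g(2)]] by simp
  have "pdiff i (\<lambda>x. f x * g x) = (\<lambda>x. pdiff i f x * g x + pdiff i g x * f x)" for i
    by (rule ext, rule pdiff_eqI[OF d])
  then show ?case
    using d by (intro Ck_on_SucI continuous_on_mult f g)
      (auto simp: real_differentiable_def
        intro!: Ck_on_add Suc.IH[OF f(3) drop[OF Suc.prems(2)]] Suc.IH[OF g(3) drop[OF Suc.prems(1)]])
qed

lemma Ck_on_const: "Ck_on k UNIV (\<lambda>_. c)"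
proof (induction k arbitrary: c)
  case 0
  show ?case by (simp add: Ck_on_0)
next
  case (Suc k)
  have "pdiff i (\<lambda>_. c) = (\<lambda>_. 0)" for i :: 'a by (rule ext, rule pdiff_eqI) simp
  then show ?case using Suc by (intro Ck_on_SucI) auto
qed

lemma Ck_on_prod:
  "finite J \<Longrightarrow> (\<And>j. j \<in> J \<Longrightarrow> Ck_on k UNIV (f j)) \<Longrightarrow> Ck_on k UNIV (\<lambda>x. \<Prod>j\<in>J. f j x)"
  by (induction J rule: finite_induct) (simp_all add: Ck_on_const Ck_on_mult)

text \<open>A family containing exp(-1/x) and closed under differentiation, which only changes the
  polynomial in 1/x; smoothness can thus be proved for all \<open>P\<close> at once.\<close>

definition flat :: "real poly \<Rightarrow> real \<Rightarrow> real" where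
  "flat P x = (if 0 < x then poly P (inverse x) * exp (- inverse x) else 0)"

lemma flat_smult: "flat (smult c P) x = c * flat P x"
  by (simp add: flat_def)

lemma poly_times_exp_tendsto_0: "((\<lambda>y. poly P y * exp (- y)) \<longlongrightarrow> 0) at_top" for P :: "real poly"
proof -
  have "((\<lambda>y. \<Sum>i\<le>degree P. coeff P i * (y ^ i / exp y)) \<longlongrightarrow> (\<Sum>i\<le>degree P. coeff P i * 0)) at_top"
    by (intro tendsto_sum tendsto_mult tendsto_const tendsto_power_div_exp_0)
  then show ?thesis by (simp add: poly_altdef sum_distrib_right exp_minus divide_inverse mult.assoc)
qed

lemma flat_tendsto_0: "(flat P \<longlongrightarrow> 0) (at 0)"
proof -
  have "((\<lambda>x. poly P (inverse x) * exp (- inverse x)) \<longlongrightarrow> 0) (at_right 0)"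
    by (rule filterlim_compose[OF poly_times_exp_tendsto_0 filterlim_inverse_at_top_right])
  then have "(flat P \<longlongrightarrow> 0) (at_right 0)"
    by (rule Lim_transform_eventually) (auto simp: flat_def eventually_at_filter)
  moreover have "(flat P \<longlongrightarrow> 0) (at_left 0)"
    by (rule Lim_transform_eventually[OF tendsto_const]) (auto simp: flat_def eventually_at_filter)
  ultimately show ?thesis by (simp add: filterlim_split_at_real)
qed

lemma flat_has_derivative:
  "(flat P has_real_derivative flat ([:0, 0, 1:] * (P - pderiv P)) x) (at x)"
proof -
  consider "x > 0" | "x = 0" | "x < 0" by linarith
  then show ?thesis
  proof cases
    case 1
    have "((\<lambda>x. poly P (inverse x) * exp (- inverse x)) has_real_derivative
        flat ([:0, 0, 1:] * (P - pderiv P)) x) (at x)"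
      using 1 by (auto intro!: derivative_eq_intros DERIV_chain2[OF poly_DERIV] simp: flat_def algebra_simps power2_eq_square)
    then show ?thesis
      by (rule has_field_derivative_transform_within_open[of _ _ _ "{0<..}"]) (use 1 in \<open>auto simp: flat_def\<close>)
  next
    case 2
    \<comment> \<open>At 0 the difference quotient of \<open>flat P\<close> is again
      \<open>flat\<close>, of \<open>P\<close> times the variable, and tends to 0.\<close>
    have "(\<lambda>h. (flat P (0 + h) - flat P 0) / h) \<midarrow>0\<rightarrow> 0"
      by (rule Lim_transform_eventually[OF flat_tendsto_0[of "[:0, 1:] * P"]])
        (auto simp: flat_def eventually_at_filter field_simps)
    then show ?thesis using 2 by (simp add: DERIV_def flat_def)
  next
    case 3
    have "((\<lambda>x. 0) has_real_derivative flat ([:0, 0, 1:] * (P - pderiv P)) x) (at x)"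
      using 3 by (simp add: flat_def)
    then show ?thesis
      by (rule has_field_derivative_transform_within_open[of _ _ _ "{..<0}"]) (use 3 in \<open>auto simp: flat_def\<close>)
  qed
qed

text \<open>\<open>P\<close> is generalised since every differentiation changes it; a direction
  other than \<open>j\<close> is covered by the zero polynomial, so derivatives keep one
  form.\<close>

lemma Ck_on_flat: "Ck_on k UNIV (\<lambda>x::real^'m. flat P (c * (x $ j - a)))"
proof (induction k arbitrary: P)
  case 0
  have "continuous_on UNIV (flat P)"
    by (rule DERIV_continuous_on) (rule has_field_derivative_at_within[OF flat_has_derivative])
  then show ?case unfolding Ck_on_0 by (rule continuous_on_compose2) (auto intro!: continuous_intros)
next
  case (Suc k)
  define P' where "P' = [:0, 0, 1:] * (P - pderiv P)"
  have d: "((\<lambda>t. flat P (c * ((x + t *\<^sub>R axis i 1) $ j - a))) has_real_derivative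
      flat (smult (if i = j then c else 0) P') (c * (x $ j - a))) (at 0)" for i and x :: "real^'m"
  proof -
    have "((\<lambda>t. c * ((x + t *\<^sub>R axis i 1) $ j - a)) has_real_derivative (if i = j then c else 0)) (at 0)"
      by (auto simp: axis_def intro!: derivative_eq_intros)
    from DERIV_chain2[OF flat_has_derivative this, of P] show ?thesis
      unfolding flat_smult P'_def by (simp only: mult.commute) simp
  qed
  have "continuous_on UNIV (flat P)"
    by (rule DERIV_continuous_on) (rule has_field_derivative_at_within[OF flat_has_derivative])
  then have "continuous_on UNIV (\<lambda>x::real^'m. flat P (c * (x $ j - a)))"
    by (rule continuous_on_compose2) (auto intro!: continuous_intros)
  moreover have "pdiff i (\<lambda>x::real^'m. flat P (c * (x $ j - a))) =
      (\<lambda>x. flat (smult (if i = j then c else 0) P') (c * (x $ j - a)))" for i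
    by (rule ext, rule pdiff_eqI[OF d])
  ultimately show ?case
    using d Suc.IH by (intro Ck_on_SucI) (auto simp: real_differentiable_def)
qed

text \<open>A product of one-variable cutoffs, positive exactly in the open box. Scaling by
  \<open>Suc n\<close> drives the arguments to infinity there, where \<open>flat 1\<close> tends to
  1: the bumps approximate the indicator of the box.\<close>

definition bump :: "real^'m \<Rightarrow> real^'m \<Rightarrow> nat \<Rightarrow> real^'m \<Rightarrow> real" where
  "bump a b n x = (\<Prod>j\<in>UNIV. flat 1 (Suc n * (x $ j - a $ j)) * flat 1 (- real (Suc n) * (x $ j - b $ j)))"

lemma bump_eq: "bump a b n x = (if x \<in> box a b then
    (\<Prod>j\<in>UNIV. exp (- inverse (Suc n * (x $ j - a $ j))) * exp (- inverse (Suc n * (b $ j - x $ j)))) else 0)"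
proof -
  have neg: "- real (Suc n) * (x $ j - b $ j) = Suc n * (b $ j - x $ j)" for j
    by (simp add: algebra_simps)
  show ?thesis
  proof (cases "x \<in> box a b")
    case True
    then have "a $ j < x $ j \<and> x $ j < b $ j" for j by (simp add: mem_box_cart)
    then have "0 < Suc n * (x $ j - a $ j)" "0 < Suc n * (b $ j - x $ j)" for j
      by (simp_all del: of_nat_Suc)
    then show ?thesis using True unfolding bump_def neg flat_def by (simp del: of_nat_Suc)
  next
    case False
    then obtain j where "\<not> (a $ j < x $ j \<and> x $ j < b $ j)" by (auto simp: mem_box_cart)
    then have "flat 1 (Suc n * (x $ j - a $ j)) * flat 1 (- real (Suc n) * (x $ j - b $ j)) = 0"
      unfolding neg flat_def by (auto simp: zero_less_mult_iff simp del: of_nat_Suc)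
    then have "bump a b n x = 0" unfolding bump_def by (intro prod_zero) auto
    then show ?thesis using False by simp
  qed
qed

lemma bump_bounds: "0 \<le> bump a b n x" "bump a b n x \<le> 1"
proof -
  show "0 \<le> bump a b n x" unfolding bump_eq by (auto intro!: prod_nonneg)
  show "bump a b n x \<le> 1"
  proof (cases "x \<in> box a b")
    case True
    then have "a $ j < x $ j \<and> x $ j < b $ j" for j by (simp add: mem_box_cart)
    then have "(\<Prod>j\<in>UNIV. exp (- inverse (Suc n * (x $ j - a $ j))) * exp (- inverse (Suc n * (b $ j - x $ j)))) \<le> 1"
      by (intro prod_le_1 conjI mult_nonneg_nonneg mult_le_one) (auto simp del: of_nat_Suc simp: less_imp_le)
    then show ?thesis using True by (simp add: bump_eq)
  qed (simp add: bump_eq)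
qed

lemma bump_tendsto_indicator: "(\<lambda>n. bump a b n x) \<longlonglongrightarrow> indicator (box a b) x"
proof (cases "x \<in> box a b")
  case True
  then have pos: "0 < x $ j - a $ j" "0 < b $ j - x $ j" for j by (auto simp: mem_box_cart)
  have lim: "(\<lambda>n. exp (- inverse (real (Suc n) * c))) \<longlonglongrightarrow> 1" if "0 < c" for c :: real
  proof -
    have "(\<lambda>n. inverse (real (Suc n)) * inverse c) \<longlonglongrightarrow> 0 * inverse c"
      by (intro tendsto_intros LIMSEQ_inverse_real_of_nat)
    then have "(\<lambda>n. exp (- (inverse (real (Suc n)) * inverse c))) \<longlonglongrightarrow> exp (- 0)"
      by (intro tendsto_intros) simp
    then show ?thesis by (simp add: mult.commute)
  qed
  have "(\<lambda>n. \<Prod>j\<in>UNIV. exp (- inverse (Suc n * (x $ j - a $ j))) * exp (- inverse (Suc n * (b $ j - x $ j))))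
      \<longlonglongrightarrow> (\<Prod>j\<in>(UNIV :: 'a set). 1 * 1)"
    by (intro tendsto_prod tendsto_mult lim pos)
  then show ?thesis using True by (simp add: bump_eq)
qed (simp add: bump_eq)

lemma bump_test_function:
  assumes "cbox a b \<subseteq> \<Omega>"
  shows "bump a b n \<in> test_functions \<Omega>"
proof -
  have supp: "closure {x. bump a b n x \<noteq> 0} \<subseteq> cbox a b"
    by (rule closure_minimal) (use box_subset_cbox in \<open>auto simp: bump_eq\<close>)
  moreover have "compact (closure {x. bump a b n x \<noteq> 0})"
    using supp bounded_cbox bounded_subset by (metis closed_closure compact_eq_bounded_closed)
  moreover have "Ck_on k UNIV (bump a b n)" for k
    unfolding bump_def[abs_def] by (intro Ck_on_prod Ck_on_mult Ck_on_flat) simp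
  ultimately show ?thesis using assms by (auto simp: test_functions_def)
qed


section \<open>Weak derivatives\<close>

text \<open>Boxes form an intersection-stable generator of the Borel sets, so the vanishing of the
  integral spreads to all of them. The whole space is not a box; \<open>total\<close> takes care of
  complements.\<close>

lemma AE_zero_of_box_integrals:
  fixes g :: "'a::euclidean_space \<Rightarrow> real"
  assumes g: "integrable lborel g"
    and box: "\<And>c d. set_lebesgue_integral lborel (box c d) g = 0"
    and total: "integral\<^sup>L lborel g = 0"
  shows "AE x in lborel. g x = 0"
proof (rule sigma_finite_measure.density_zero[OF sigma_finite_lborel g])
  fix A :: "'a set" assume "A \<in> sets lborel"
  then have A: "A \<in> sigma_sets UNIV (range (\<lambda>(a, b). box a b))"
    by (simp add: borel_eq_box)
  have meas: "B \<in> sigma_sets UNIV (range (\<lambda>(a, b). box a b)) \<Longrightarrow> B \<in> sets lborel" for B :: "'a set"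
    by (simp add: borel_eq_box)
  have int: "set_integrable lborel B g" if "B \<in> sets lborel" for B
    unfolding set_integrable_def using integrable_mult_indicator[OF that g] .
  show "set_lebesgue_integral lborel A g = 0"
  proof (rule sigma_sets_induct_disjoint[OF _ _ A, where P = "\<lambda>A. set_lebesgue_integral lborel A g = 0"])
    show "Int_stable (range (\<lambda>(a, b). box a b :: 'a set))"
      unfolding Int_stable_def by (auto simp: box_Int_box)
    show "set_lebesgue_integral lborel B g = 0" if "B \<in> range (\<lambda>(a, b). box a b)" for B
      using that box by auto
    show "set_lebesgue_integral lborel (UNIV - B) g = 0"
      if B: "B \<in> sigma_sets UNIV (range (\<lambda>(a, b). box a b))" "set_lebesgue_integral lborel B g = 0" for B
    proof -
      have "set_lebesgue_integral lborel (B \<union> (UNIV - B)) g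
          = set_lebesgue_integral lborel B g + set_lebesgue_integral lborel (UNIV - B) g"
        using meas[OF B(1)] by (intro set_integral_Un int) auto
      moreover have "set_lebesgue_integral lborel (B \<union> (UNIV - B)) g = integral\<^sup>L lborel g"
        by (simp add: set_lebesgue_integral_def)
      ultimately show ?thesis using B(2) total by simp
    qed
    show "set_lebesgue_integral lborel (\<Union>i. B i) g = 0"
      if B: "disjoint_family B" "range B \<subseteq> sigma_sets UNIV (range (\<lambda>(a, b). box a b))"
        "\<And>i. set_lebesgue_integral lborel (B i) g = 0" for B :: "nat \<Rightarrow> 'a set"
    proof -
      have m: "B i \<in> sets lborel" for i using B(2) meas by blast
      have d: "B i \<inter> B j = {}" if "i \<noteq> j" for i j
        using B(1) that by (auto simp: disjoint_family_on_def)
      have "(\<Union>i. B i) \<in> sets lborel" using m by blast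
      then show ?thesis using lebesgue_integral_countable_add[OF m d int, of id] B(3)
        by (subst lebesgue_integral_countable_add[OF m d int]) auto
    qed
  qed (auto simp: set_lebesgue_integral_def)
qed

lemma test_function_Ck_on: "\<phi> \<in> test_functions \<Omega> \<Longrightarrow> Ck_on k UNIV \<phi>"
  by (simp add: test_functions_def)

lemma test_functionE:
  assumes "\<phi> \<in> test_functions \<Omega>"
  obtains K B where "compact K" "K \<subseteq> \<Omega>" "\<And>x. x \<notin> K \<Longrightarrow> \<phi> x = 0" "\<And>x. \<bar>\<phi> x\<bar> \<le> B"
    "continuous_on UNIV \<phi>"
proof -
  define K where "K = closure {x. \<phi> x \<noteq> 0}"
  have K: "compact K" "K \<subseteq> \<Omega>" using assms by (auto simp: K_def test_functions_def)
  have zero: "\<phi> x = 0" if "x \<notin> K" for x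
    using that closure_subset[of "{x. \<phi> x \<noteq> 0}"] by (auto simp: K_def)
  have cont: "continuous_on UNIV \<phi>" using test_function_Ck_on[OF assms, of 0] by (simp add: Ck_on_0)
  have "bounded (\<phi> ` K)"
    using compact_continuous_image[OF continuous_on_subset[OF cont] K(1)] compact_imp_bounded by blast
  then obtain B where "\<forall>x\<in>K. \<bar>\<phi> x\<bar> \<le> B" by (auto simp: bounded_iff)
  then have "\<bar>\<phi> x\<bar> \<le> \<bar>B\<bar>" for x using zero[of x] by (cases "x \<in> K") force+
  then show thesis using that K zero cont by blast
qed

lemma borel_measurable_lebesgue_continuous:
  fixes \<phi> :: "'a::euclidean_space \<Rightarrow> real"
  shows "continuous_on UNIV \<phi> \<Longrightarrow> \<phi> \<in> borel_measurable lebesgue"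
  by (intro measurable_completion) (simp add: borel_measurable_continuous_onI)

lemma integrable_mult_test:
  assumes v: "locally_integrable \<Omega> v" and \<phi>: "\<phi> \<in> test_functions \<Omega>"
  shows "set_integrable lebesgue \<Omega> (\<lambda>x. v x * \<phi> x)"
proof -
  obtain K B where K: "compact K" "K \<subseteq> \<Omega>" "\<And>x. x \<notin> K \<Longrightarrow> \<phi> x = 0" "\<And>x. \<bar>\<phi> x\<bar> \<le> B"
    "continuous_on UNIV \<phi>"
    using test_functionE[OF \<phi>] by metis
  have vK: "integrable lebesgue (\<lambda>x. indicator K x *\<^sub>R v x)"
    using v K(1,2) by (auto simp: locally_integrable_def set_integrable_def)
  have "integrable lebesgue (\<lambda>x. (indicator K x *\<^sub>R v x) * \<phi> x)"
  proof (rule Bochner_Integration.integrable_bound)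
    show "integrable lebesgue (\<lambda>x. B * (indicator K x *\<^sub>R v x))" using vK by (intro integrable_mult_right)
    show "(\<lambda>x. (indicator K x *\<^sub>R v x) * \<phi> x) \<in> borel_measurable lebesgue"
      using borel_measurable_integrable[OF vK] borel_measurable_lebesgue_continuous[OF K(5)]
      by (intro borel_measurable_times)
    show "AE x in lebesgue. norm ((indicator K x *\<^sub>R v x) * \<phi> x) \<le> norm (B * (indicator K x *\<^sub>R v x))"
    proof (rule AE_I2)
      fix x
      have "\<bar>\<phi> x\<bar> \<le> \<bar>B\<bar>" using K(4)[of x] by linarith
      then show "norm ((indicator K x *\<^sub>R v x) * \<phi> x) \<le> norm (B * (indicator K x *\<^sub>R v x))"
        unfolding real_norm_def abs_mult[of _ "\<phi> x"] abs_mult[of B]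
        by (simp add: mult.commute mult_right_mono)
    qed
  qed
  moreover have "(\<lambda>x. (indicator K x *\<^sub>R v x) * \<phi> x) = (\<lambda>x. indicator \<Omega> x *\<^sub>R (v x * \<phi> x))"
    using K(2,3) by (auto simp: indicator_def fun_eq_iff)
  ultimately show ?thesis unfolding set_integrable_def by simp
qed

text \<open>The bumps converge boundedly to the indicator of the box, and their supports lie in the
  closed box, a compact subset of \<open>\<Omega>\<close> on which \<open>w\<close> is integrable;
  dominated convergence applies.\<close>

lemma set_integral_box_eq_0:
  assumes w: "locally_integrable \<Omega> w"
    and zero: "\<And>\<phi>. \<phi> \<in> test_functions \<Omega> \<Longrightarrow> (LINT x:\<Omega>|lebesgue. w x * \<phi> x) = 0"
    and ab: "cbox a b \<subseteq> \<Omega>"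
  shows "(LINT x:box a b|lebesgue. w x) = 0"
proof -
  have wc: "integrable lebesgue (\<lambda>x. indicator (cbox a b) x *\<^sub>R w x)"
    using w ab compact_cbox by (auto simp: locally_integrable_def set_integrable_def)
  have bm: "bump a b n \<in> borel_measurable lebesgue" for n
    using test_functionE[OF bump_test_function[OF ab]] borel_measurable_lebesgue_continuous by metis
  have eq: "(indicator (cbox a b) x *\<^sub>R w x) * bump a b n x = indicator \<Omega> x *\<^sub>R (w x * bump a b n x)" for x n
    using ab box_subset_cbox[of a b] by (auto simp: indicator_def bump_eq)
  have "(\<lambda>n. integral\<^sup>L lebesgue (\<lambda>x. (indicator (cbox a b) x *\<^sub>R w x) * bump a b n x)) \<longlonglongrightarrow>
      integral\<^sup>L lebesgue (\<lambda>x. (indicator (cbox a b) x *\<^sub>R w x) * indicator (box a b) x)"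
  proof (rule integral_dominated_convergence)
    show "(\<lambda>x. indicat_real (cbox a b) x *\<^sub>R w x * indicat_real (box a b) x) \<in> borel_measurable lebesgue"
      using borel_measurable_integrable[OF wc] by (intro borel_measurable_times borel_measurable_indicator) auto
    show "(\<lambda>x. (indicator (cbox a b) x *\<^sub>R w x) * bump a b n x) \<in> borel_measurable lebesgue" for n
      using borel_measurable_integrable[OF wc] bm by (intro borel_measurable_times)
    show "integrable lebesgue (\<lambda>x. norm (indicator (cbox a b) x *\<^sub>R w x))"
      using wc by (rule integrable_norm)
    show "AE x in lebesgue. (\<lambda>n. (indicator (cbox a b) x *\<^sub>R w x) * bump a b n x)
        \<longlonglongrightarrow> (indicator (cbox a b) x *\<^sub>R w x) * indicator (box a b) x"
      by (intro AE_I2 tendsto_mult tendsto_const bump_tendsto_indicator)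
    show "AE x in lebesgue. norm ((indicator (cbox a b) x *\<^sub>R w x) * bump a b n x) \<le> norm (indicator (cbox a b) x *\<^sub>R w x)" for n
    proof (rule AE_I2)
      fix x
      have "\<bar>bump a b n x\<bar> \<le> 1" using bump_bounds[of a b n x] by simp
      then show "norm ((indicator (cbox a b) x *\<^sub>R w x) * bump a b n x) \<le> norm (indicator (cbox a b) x *\<^sub>R w x)"
        unfolding real_norm_def abs_mult[of _ "bump a b n x"] by (rule mult_left_le) simp
    qed
  qed
  moreover have "integral\<^sup>L lebesgue (\<lambda>x. (indicator (cbox a b) x *\<^sub>R w x) * bump a b n x) = 0" for n
    unfolding eq using zero[OF bump_test_function[OF ab]] by (simp add: set_lebesgue_integral_def)
  ultimately have "integral\<^sup>L lebesgue (\<lambda>x. (indicator (cbox a b) x *\<^sub>R w x) * indicator (box a b) x) = 0"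
    by (simp add: LIMSEQ_const_iff)
  moreover have "(\<lambda>x. (indicator (cbox a b) x *\<^sub>R w x) * indicator (box a b) x) = (\<lambda>x. indicator (box a b) x *\<^sub>R w x)"
    using box_subset_cbox[of a b] by (auto simp: indicator_def fun_eq_iff)
  ultimately show ?thesis unfolding set_lebesgue_integral_def by simp
qed

text \<open>The fundamental lemma of the calculus of variations. On one closed cell inside
  \<open>\<Omega>\<close> the restriction of \<open>w\<close> has integral 0 over every box, and
  \<open>\<Omega>\<close> is a countable union of such cells.\<close>

lemma AE_zero_of_test_functions:
  assumes "open \<Omega>" and w: "locally_integrable \<Omega> w"
    and zero: "\<And>\<phi>. \<phi> \<in> test_functions \<Omega> \<Longrightarrow> (LINT x:\<Omega>|lebesgue. w x * \<phi> x) = 0"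
  shows "AE x in lebesgue_on \<Omega>. w x = 0"
proof -
  have cell: "AE x in lebesgue. x \<in> cbox a b \<longrightarrow> w x = 0" if ab: "cbox a b \<subseteq> \<Omega>" for a b
  proof -
    define wb where "wb x = indicator (box a b) x *\<^sub>R w x" for x
    have "set_integrable lebesgue (cbox a b) w"
      using w ab compact_cbox by (auto simp: locally_integrable_def)
    then have "set_integrable lebesgue (box a b) w"
      by (rule set_integrable_subset) (auto simp: box_subset_cbox)
    then have wb: "integrable lebesgue wb" by (simp add: set_integrable_def wb_def[abs_def])
    \<comment> \<open>A Borel representative, since the sets generated by boxes are the Borel sets
      only.\<close>
    obtain g where g: "g \<in> borel_measurable lborel" "AE x in lborel. wb x = g x"
      using completion_ex_borel_measurable_real[OF borel_measurable_integrable[OF wb]] by blast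
    have g': "g \<in> borel_measurable lebesgue" using g(1) by (rule measurable_completion)
    have "integrable lebesgue g"
      using integrable_cong_AE[OF borel_measurable_integrable[OF wb] g' AE_completion[OF g(2)]] wb by simp
    then have gi: "integrable lborel g" using integrable_completion[OF g(1)] by simp
    have sub: "(LINT x:A|lborel. g x) = (LINT x:A|lebesgue. wb x)" if A: "A \<in> sets borel" for A
    proof -
      have m: "(\<lambda>x. indicator A x *\<^sub>R g x) \<in> borel_measurable lborel" using g(1) A by simp
      have "(LINT x:A|lborel. g x) = integral\<^sup>L lebesgue (\<lambda>x. indicator A x *\<^sub>R g x)"
        unfolding set_lebesgue_integral_def using integral_completion[OF m] by simp
      also have "\<dots> = integral\<^sup>L lebesgue (\<lambda>x. indicator A x *\<^sub>R wb x)"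
      proof (rule integral_cong_AE)
        show "(\<lambda>x. indicator A x *\<^sub>R wb x) \<in> borel_measurable lebesgue"
          using borel_measurable_integrable[OF wb] A
          by (intro borel_measurable_scaleR borel_measurable_indicator) (auto intro: sets_completionI_sets)
        show "AE x in lebesgue. indicator A x *\<^sub>R g x = indicator A x *\<^sub>R wb x"
          using AE_completion[OF g(2)] by eventually_elim simp
      qed (use measurable_completion[OF m] in simp)
      finally show ?thesis by (simp add: set_lebesgue_integral_def)
    qed
    have sub0: "(LINT x:box c d|lebesgue. wb x) = 0" for c d
    proof -
      obtain c' d' where cd: "box c d \<inter> box a b = box c' d'" using box_Int_box by blast
      have "(LINT x:box c d|lebesgue. wb x) = (LINT x:box c' d'|lebesgue. w x)"
        unfolding set_lebesgue_integral_def wb_def cd[symmetric]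
        by (intro Bochner_Integration.integral_cong) (auto simp: indicator_def)
      also have "\<dots> = 0"
      proof (cases "box c' d' = {}")
        case True
        then show ?thesis by (simp add: set_lebesgue_integral_def)
      next
        case False
        have "cbox c' d' = closure (box c' d')" using closure_box[OF False] by simp
        also have "\<dots> \<subseteq> cbox a b"
          by (rule closure_minimal) (use cd box_subset_cbox in auto)
        finally show ?thesis using set_integral_box_eq_0[OF w zero] ab by blast
      qed
      finally show ?thesis .
    qed
    have "AE x in lborel. g x = 0"
    proof (rule AE_zero_of_box_integrals[OF gi])
      show "(LINT x:box c d|lborel. g x) = 0" for c d using sub[of "box c d"] sub0 by simp
      have "integral\<^sup>L lborel g = (LINT x:UNIV|lborel. g x)" by (simp add: set_lebesgue_integral_def)
      also have "\<dots> = integral\<^sup>L lebesgue wb" using sub[of UNIV] by (simp add: set_lebesgue_integral_def)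
      also have "\<dots> = (LINT x:box a b|lebesgue. wb x)"
        unfolding set_lebesgue_integral_def by (intro Bochner_Integration.integral_cong) (auto simp: wb_def indicator_def)
      finally show "integral\<^sup>L lborel g = 0" using sub0 by simp
    qed
    then have "AE x in lebesgue. g x = 0" by (rule AE_completion)
    \<comment> \<open>\<open>wb\<close> sees \<open>w\<close> on the open box only; the faces of the
      cell are a null set.\<close>
    moreover have "AE x in lebesgue. x \<notin> cbox a b - box a b"
      using negligible_frontier_interval[of a b] AE_not_in[of "cbox a b - box a b" lebesgue]
      unfolding negligible_iff_null_sets by blast
    ultimately show ?thesis
      using AE_completion[OF g(2)] by eventually_elim (auto simp: wb_def)
  qed
  obtain \<D> where \<D>: "countable \<D>" "\<And>X. X \<in> \<D> \<Longrightarrow> X \<subseteq> \<Omega>" "\<And>X. X \<in> \<D> \<Longrightarrow> \<exists>a b. X = cbox a b" "\<Union>\<D> = \<Omega>"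
    using open_countable_Union_open_cbox[OF \<open>open \<Omega>\<close>] by (metis PowD subsetD)
  have "AE x in lebesgue. \<forall>X\<in>\<D>. x \<in> X \<longrightarrow> w x = 0"
    unfolding AE_ball_countable[OF \<D>(1)] using cell \<D>(2,3) by blast
  then have "AE x in lebesgue. x \<in> \<Omega> \<longrightarrow> w x = 0"
    by eventually_elim (use \<D>(4) in auto)
  then show ?thesis
    using \<open>open \<Omega>\<close> by (subst AE_restrict_space_iff) (auto intro: lmeasurable_open borel_open sets_completionI_sets)
qed

text \<open>Midpoints replace general convex combinations of the tail from \<open>N\<close> on: the
  parallelogram identity involves nothing else, and bounds pass from two functions to their midpoint
  at once.\<close>

inductive_set midpoint_hull :: "(nat \<Rightarrow> 'a \<Rightarrow> real) \<Rightarrow> nat \<Rightarrow> ('a \<Rightarrow> real) set"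
  for D :: "nat \<Rightarrow> 'a \<Rightarrow> real" and N :: nat
where
  base: "N \<le> n \<Longrightarrow> D n \<in> midpoint_hull D N"
| mid: "f \<in> midpoint_hull D N \<Longrightarrow> g \<in> midpoint_hull D N \<Longrightarrow> (\<lambda>x. (f x + g x) / 2) \<in> midpoint_hull D N"

lemma midpoint_hull_antimono:
  assumes "N \<le> M" shows "midpoint_hull D M \<subseteq> midpoint_hull D N"
proof
  fix f assume "f \<in> midpoint_hull D M"
  then show "f \<in> midpoint_hull D N"
    by induction (use assms in \<open>auto intro: midpoint_hull.intros\<close>)
qed

section \<open>Weak limits of bounded sequences on a finite measure space\<close>

context finite_measure
begin

lemma integrable_bounded:
  fixes f :: "'a \<Rightarrow> real"
  assumes "f \<in> borel_measurable M" "\<And>x. x \<in> space M \<Longrightarrow> \<bar>f x\<bar> \<le> B"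
  shows "integrable M f"
  by (rule integrable_const_bound[of f B]) (use assms in auto)

lemma midpoint_hull_bounded:
  fixes D :: "nat \<Rightarrow> 'a \<Rightarrow> real"
  assumes "\<And>n. D n \<in> borel_measurable M" "\<And>n x. x \<in> space M \<Longrightarrow> \<bar>D n x\<bar> \<le> L"
    and "f \<in> midpoint_hull D N"
  shows "f \<in> borel_measurable M \<and> (\<forall>x\<in>space M. \<bar>f x\<bar> \<le> L)"
  using assms(3)
proof induction
  case (mid f g)
  have "\<bar>(f x + g x) / 2\<bar> \<le> L" if "x \<in> space M" for x
  proof -
    have "\<bar>f x\<bar> \<le> L" "\<bar>g x\<bar> \<le> L" using mid that by blast+
    then show ?thesis by simp
  qed
  moreover have "(\<lambda>x. (f x + g x) / 2) \<in> borel_measurable M"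
    using mid.IH by (intro borel_measurable_divide borel_measurable_add borel_measurable_const) auto
  ultimately show ?case by blast
qed (use assms in auto)

text \<open>The integral is linear in \<open>f\<close>, so lying within \<open>e\<close> of
  \<open>J\<close> is a convex condition. Hulls of late tails thus have almost the limiting
  integrals.\<close>

lemma midpoint_hull_integral_close:
  fixes D :: "nat \<Rightarrow> 'a \<Rightarrow> real"
  assumes D: "\<And>n. D n \<in> borel_measurable M" "\<And>n x. x \<in> space M \<Longrightarrow> \<bar>D n x\<bar> \<le> L"
    and \<phi>: "\<phi> \<in> borel_measurable M" "\<And>x. x \<in> space M \<Longrightarrow> \<bar>\<phi> x\<bar> \<le> B"
    and close: "\<And>n. N \<le> n \<Longrightarrow> \<bar>(\<integral>x. D n x * \<phi> x \<partial>M) - J\<bar> \<le> e"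
    and f: "f \<in> midpoint_hull D N"
  shows "\<bar>(\<integral>x. f x * \<phi> x \<partial>M) - J\<bar> \<le> e"
  using f
proof induction
  case (mid f g)
  have int: "integrable M (\<lambda>x. h x * \<phi> x)" if "h \<in> midpoint_hull D N" for h
  proof (rule integrable_bounded)
    have h: "h \<in> borel_measurable M \<and> (\<forall>x\<in>space M. \<bar>h x\<bar> \<le> L)"
      using midpoint_hull_bounded[of D L h N] D that by blast
    show "(\<lambda>x. h x * \<phi> x) \<in> borel_measurable M"
      using h \<phi>(1) by (intro borel_measurable_times) auto
    show "\<bar>h x * \<phi> x\<bar> \<le> \<bar>L\<bar> * \<bar>B\<bar>" if "x \<in> space M" for x
      using h \<phi>(2)[OF that] that unfolding abs_mult by (intro mult_mono) fastforce+
  qed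
  have "(\<integral>x. (f x + g x) / 2 * \<phi> x \<partial>M) = ((\<integral>x. f x * \<phi> x \<partial>M) + (\<integral>x. g x * \<phi> x \<partial>M)) / 2"
    using Bochner_Integration.integral_add[OF int[OF mid(1)] int[OF mid(2)]]
    by (simp add: distrib_right)
  moreover have "\<bar>(a + b) / 2 - J\<bar> \<le> e" if "\<bar>a - J\<bar> \<le> e" "\<bar>b - J\<bar> \<le> e" for a b :: real
    using that by (simp add: abs_le_iff field_simps)
  ultimately show ?case using mid.IH by presburger
qed (rule close)

text \<open>
  Elements of almost minimal \<open>L\<^sup>2\<close>-norm of the midpoint-convex hulls of the tails form a Cauchy
  sequence, by the parallelogram identity.
\<close>
lemma weak_cluster_function:
  fixes D :: "nat \<Rightarrow> 'a \<Rightarrow> real"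
  assumes D: "\<And>n. D n \<in> borel_measurable M" "\<And>n x. x \<in> space M \<Longrightarrow> \<bar>D n x\<bar> \<le> L" and "0 \<le> L"
  shows "\<exists>v. v \<in> borel_measurable M \<and> (\<forall>x. \<bar>v x\<bar> \<le> L) \<and>
    (\<forall>\<phi> B J. \<phi> \<in> borel_measurable M \<longrightarrow> (\<forall>x\<in>space M. \<bar>\<phi> x\<bar> \<le> B) \<longrightarrow>
      (\<lambda>n. \<integral>x. D n x * \<phi> x \<partial>M) \<longlonglongrightarrow> J \<longrightarrow> (\<integral>x. v x * \<phi> x \<partial>M) = J)"
proof -
  have hull: "f \<in> borel_measurable M \<and> (\<forall>x\<in>space M. \<bar>f x\<bar> \<le> L)" if "f \<in> midpoint_hull D N" for f N
    using midpoint_hull_bounded[of D L f N] D that by blast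
  have sq_le: "y\<^sup>2 \<le> L\<^sup>2" if "\<bar>y\<bar> \<le> L" for y
    using power_mono[OF that, of 2] by simp
  have sq: "integrable M (\<lambda>x. (f x)\<^sup>2)" if "f \<in> midpoint_hull D N" for f N
    by (rule integrable_bounded[of _ "L\<^sup>2"]) (use hull[OF that] in \<open>auto intro!: sq_le\<close>)
  have prod: "integrable M (\<lambda>x. f x * g x)" if "f \<in> midpoint_hull D N" "g \<in> midpoint_hull D N'" for f g N N'
    by (rule integrable_bounded[of _ "L * L"])
      (use hull[OF that(1)] hull[OF that(2)] \<open>0 \<le> L\<close> in \<open>auto simp: abs_mult intro!: mult_mono\<close>)
  define q where "q f = (\<integral>x. (f x)\<^sup>2 \<partial>M)" for f :: "'a \<Rightarrow> real"
  define d where "d N = Inf (q ` midpoint_hull D N)" for N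
  have ne: "midpoint_hull D N \<noteq> {}" for N using midpoint_hull.base[of N N D] by blast
  have q0: "0 \<le> q f" for f by (simp add: q_def)
  then have bdd: "bdd_below (q ` midpoint_hull D N)" for N by (auto simp: bdd_below_def)
  have d_le: "d N \<le> q f" if "f \<in> midpoint_hull D N" for f N
    unfolding d_def using bdd that by (intro cInf_lower) auto
  \<comment> \<open>The hulls shrink with \<open>N\<close>, so the infima increase; being bounded
    they converge, which makes the defect in the parallelogram identity small.\<close>
  have "mono d"
    unfolding mono_def d_def using ne bdd
    by (intro allI impI cInf_superset_mono image_mono midpoint_hull_antimono) auto
  moreover have "d N \<le> L\<^sup>2 * measure M (space M)" for N
  proof -
    have DN: "D N \<in> midpoint_hull D N" by (rule midpoint_hull.base) simp
    have "q (D N) \<le> (\<integral>x. L\<^sup>2 \<partial>M)"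
      unfolding q_def using hull[OF DN]
      by (intro integral_mono sq[OF DN]) (auto intro!: sq_le)
    then show ?thesis using d_le[OF DN] by (simp add: mult.commute)
  qed
  ultimately have dC: "Cauchy d"
    using incseq_convergent[of d "L\<^sup>2 * measure M (space M)"] LIMSEQ_imp_Cauchy by blast
  have "\<exists>f\<in>midpoint_hull D N. q f < d N + 1 / Suc N" for N
  proof -
    have "Inf (q ` midpoint_hull D N) < d N + 1 / Suc N" by (simp add: d_def)
    then show ?thesis using cInf_lessD[of "q ` midpoint_hull D N"] ne by blast
  qed
  then obtain w where w: "\<And>N. w N \<in> midpoint_hull D N" "\<And>N. q (w N) < d N + 1 / Suc N" by metis
  have par: "q (\<lambda>x. w i x - w j x) \<le> 2 * (d j - d i) + 4 / Suc i" if "i \<le> j" for i j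
  proof -
    have wj: "w j \<in> midpoint_hull D i" using midpoint_hull_antimono[OF that] w(1) by blast
    note m = midpoint_hull.mid[OF w(1)[of i] wj]
    have "q (\<lambda>x. w i x - w j x) = (\<integral>x. 2 * (w i x)\<^sup>2 + 2 * (w j x)\<^sup>2 - 4 * ((w i x + w j x) / 2)\<^sup>2 \<partial>M)"
      unfolding q_def by (intro Bochner_Integration.integral_cong) (auto simp: power2_eq_square field_simps)
    also have "\<dots> = 2 * q (w i) + 2 * q (w j) - 4 * q (\<lambda>x. (w i x + w j x) / 2)"
      unfolding q_def using sq[OF w(1)[of i]] sq[OF wj] sq[OF m]
      by (simp only: Bochner_Integration.integral_diff Bochner_Integration.integral_add integral_mult_right_zero
          integrable_mult_right Bochner_Integration.integrable_add)
    also have "\<dots> \<le> 2 * (d i + 1 / Suc i) + 2 * (d j + 1 / Suc j) - 4 * d i"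
      using w(2)[of i] w(2)[of j] d_le[OF m] by simp
    also have "1 / real (Suc j) \<le> 1 / real (Suc i)" using that by (intro divide_left_mono) auto
    finally show ?thesis by (simp add: algebra_simps)
  qed
  have int_w: "integrable M (w i)" for i
    using hull[OF w(1)[of i]] by (intro integrable_bounded) auto
  have L1: "\<exists>N. \<forall>i\<ge>N. \<forall>j\<ge>N. (\<integral>x. norm (w i x - w j x) \<partial>M) < e" if e: "0 < e" for e
  proof -
    define \<mu> where "\<mu> = measure M (space M)"
    have \<mu>: "0 \<le> \<mu>" by (simp add: \<mu>_def)
    \<comment> \<open>Integrating \<bar>a\<bar> \<le> \<delta> + a^2 / \<delta> leads from L^2 to
      L^1: \<open>\<delta>\<close> makes the first term at most e/4, and \<open>\<eta>\<close> below
      makes the second, at most 6 \<eta> / \<delta>, less than e/2.\<close>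
    define \<delta> where "\<delta> = e / 4 / (\<mu> + 1)"
    have \<delta>: "0 < \<delta>" "\<delta> * \<mu> \<le> e / 4"
    proof -
      show "0 < \<delta>" using e \<mu> by (simp add: \<delta>_def)
      have "\<delta> * \<mu> \<le> \<delta> * (\<mu> + 1)" using \<open>0 < \<delta>\<close> by simp
      also have "\<dots> = e / 4" unfolding \<delta>_def by (rule nonzero_eq_divide_eq[THEN iffD1, OF _ refl]) (use \<mu> in simp)
      finally show "\<delta> * \<mu> \<le> e / 4" .
    qed
    define \<eta> where "\<eta> = \<delta> * e / 16"
    have \<delta>e: "0 < \<eta>" using \<delta> e by (simp add: \<eta>_def)
    obtain N1 where N1: "\<And>i j. i \<ge> N1 \<Longrightarrow> j \<ge> N1 \<Longrightarrow> \<bar>d j - d i\<bar> < \<eta>"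
      using dC \<delta>e unfolding Cauchy_iff by (metis real_norm_def)
    obtain N2 :: nat where N2: "inverse (Suc N2) < \<eta>" using reals_Archimedean[OF \<delta>e] by auto
    have main: "(\<integral>x. norm (w i x - w j x) \<partial>M) < e" if ij: "i \<ge> max N1 N2" "i \<le> j" for i j
    proof -
      have c1: "1 / real (Suc i) \<le> inverse (Suc N2)"
        using ij by (simp add: inverse_eq_divide frac_le)
      have c2: "4 / real (Suc i) = 4 * (1 / real (Suc i))" by simp
      have c3: "\<bar>d j - d i\<bar> < \<eta>" using N1[of i j] ij by simp
      have qb: "q (\<lambda>x. w i x - w j x) \<le> 6 * \<eta>"
      proof -
        have "y \<le> 6 * \<eta>" if "t \<le> n" "n < \<eta>" "\<bar>u\<bar> < \<eta>" "y \<le> 2 * u + 4 * t" for t n u y :: real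
          using that by linarith
        then show ?thesis
          using c1 c3 par[OF ij(2)] N2 unfolding c2 by blast
      qed
      have pt: "norm (w i x - w j x) \<le> \<delta> + (w i x - w j x)\<^sup>2 / \<delta>" for x
      proof (cases "\<bar>w i x - w j x\<bar> \<le> \<delta>")
        case True
        then show ?thesis using \<delta>(1) by (simp add: add_increasing2)
      next
        case False
        then have "\<delta> * \<bar>w i x - w j x\<bar> \<le> \<bar>w i x - w j x\<bar> * \<bar>w i x - w j x\<bar>"
          by (intro mult_right_mono) auto
        then have "\<bar>w i x - w j x\<bar> \<le> (w i x - w j x)\<^sup>2 / \<delta>"
          using \<delta>(1) by (simp add: pos_le_divide_eq power2_eq_square mult.commute)
        then show ?thesis using \<delta>(1) by simp
      qed
      have sqi: "integrable M (\<lambda>x. (w i x - w j x)\<^sup>2)"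
        by (rule Bochner_Integration.integrable_cong[THEN iffD1, OF refl _
            Bochner_Integration.integrable_diff[OF Bochner_Integration.integrable_add[OF sq[OF w(1)[of i]] sq[OF w(1)[of j]]]
              integrable_mult_right[OF prod[OF w(1)[of i] w(1)[of j]], of 2]]])
          (simp add: power2_eq_square algebra_simps)
      have "(\<integral>x. norm (w i x - w j x) \<partial>M) \<le> (\<integral>x. \<delta> + (w i x - w j x)\<^sup>2 / \<delta> \<partial>M)"
        by (intro integral_mono pt integrable_norm Bochner_Integration.integrable_diff int_w
            Bochner_Integration.integrable_add integrable_divide sqi) simp
      also have "\<dots> = \<delta> * \<mu> + q (\<lambda>x. w i x - w j x) / \<delta>"
        using sqi by (subst Bochner_Integration.integral_add) (simp_all add: q_def \<mu>_def mult.commute)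
      also have "\<dots> \<le> e / 4 + 6 * \<eta> / \<delta>"
        using \<delta> qb by (intro add_mono divide_right_mono) auto
      also have "\<dots> < e" using \<delta>(1) e by (simp add: \<eta>_def)
      finally show ?thesis .
    qed
    have "(\<integral>x. norm (w i x - w j x) \<partial>M) < e" if "i \<ge> max N1 N2" "j \<ge> max N1 N2" for i j
      using main[of i j] main[of j i] that by (cases "i \<le> j") (auto simp: abs_minus_commute)
    then show ?thesis by blast
  qed
  obtain r where r: "strict_mono r" "AE x in M. Cauchy (\<lambda>i. w (r i) x)"
    using cauchy_L1_AE_cauchy_subseq[of M w] int_w L1 by metis
  have wm: "w i \<in> borel_measurable M" and wL: "x \<in> space M \<Longrightarrow> \<bar>w i x\<bar> \<le> L" for i x
    using hull[OF w(1)[of i]] by auto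
  \<comment> \<open>The limit in the extended reals gives a measurable function defined everywhere;
    truncation then makes the bound \<open>L\<close> hold at every point.\<close>
  define l where "l x = real_of_ereal (lim (\<lambda>i. ereal (w (r i) x)))" for x
  define v where "v x = max (- L) (min L (l x))" for x
  have lm: "l \<in> borel_measurable M" unfolding l_def using wm by measurable
  have lim: "AE x in M. (\<lambda>i. w (r i) x) \<longlonglongrightarrow> v x"
    using r(2) AE_space
  proof eventually_elim
    case (elim x)
    then obtain y where y: "(\<lambda>i. w (r i) x) \<longlonglongrightarrow> y" using Cauchy_convergent convergent_def by blast
    then have "lim (\<lambda>i. ereal (w (r i) x)) = ereal y" by (intro limI) simp
    then have "l x = y" by (simp add: l_def)
    moreover have "\<bar>y\<bar> \<le> L"
      by (rule LIMSEQ_le_const2[OF tendsto_rabs[OF y]]) (use wL elim in auto)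
    ultimately have "v x = y" by (auto simp: v_def abs_le_iff)
    then show ?case using y by simp
  qed
  show ?thesis
  proof (intro exI[of _ v] conjI allI impI)
    show vm: "v \<in> borel_measurable M" unfolding v_def using lm by measurable
    show "\<bar>v x\<bar> \<le> L" for x using \<open>0 \<le> L\<close> by (auto simp: v_def abs_le_iff)
    fix \<phi> B J
    assume \<phi>: "\<phi> \<in> borel_measurable M" "\<forall>x\<in>space M. \<bar>\<phi> x\<bar> \<le> B"
      and J: "(\<lambda>n. \<integral>x. D n x * \<phi> x \<partial>M) \<longlonglongrightarrow> J"
    have "(\<lambda>i. \<integral>x. w (r i) x * \<phi> x \<partial>M) \<longlonglongrightarrow> (\<integral>x. v x * \<phi> x \<partial>M)"
    proof (rule integral_dominated_convergence)
      show "integrable M (\<lambda>x. L * \<bar>\<phi> x\<bar>)"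
        using \<phi> by (intro integrable_mult_right integrable_bounded[of _ B]) auto
      show "AE x in M. (\<lambda>i. w (r i) x * \<phi> x) \<longlonglongrightarrow> v x * \<phi> x"
        using lim by eventually_elim (intro tendsto_mult tendsto_const)
      show "AE x in M. norm (w (r i) x * \<phi> x) \<le> L * \<bar>\<phi> x\<bar>" for i
        by (rule AE_I2) (simp add: abs_mult mult_right_mono wL)
    qed (use wm vm \<phi>(1) in auto)
    \<comment> \<open>As \<open>r i \<ge> i\<close>, the function \<open>w (r i)\<close> lies in the
      hull of the tail from \<open>i\<close> on, and its integral is as close to \<open>J\<close> as
      those of that tail.\<close>
    moreover have "(\<lambda>i. \<integral>x. w (r i) x * \<phi> x \<partial>M) \<longlonglongrightarrow> J"
    proof (rule LIMSEQ_I)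
      fix e :: real assume "0 < e"
      then obtain N where N: "\<And>n. N \<le> n \<Longrightarrow> \<bar>(\<integral>x. D n x * \<phi> x \<partial>M) - J\<bar> \<le> e / 2"
        using J unfolding LIMSEQ_iff real_norm_def by (metis half_gt_zero less_imp_le)
      have "norm ((\<integral>x. w (r i) x * \<phi> x \<partial>M) - J) < e" if "N \<le> i" for i
      proof -
        have "N \<le> r i" using that r(1) seq_suble order_trans by blast
        then have "w (r i) \<in> midpoint_hull D N" using midpoint_hull_antimono w(1) by blast
        from midpoint_hull_integral_close[of D L \<phi> B N J "e / 2", OF D \<phi>(1) _ N this]
        have "\<bar>(\<integral>x. w (r i) x * \<phi> x \<partial>M) - J\<bar> \<le> e / 2" using \<phi>(2) by blast
        then show ?thesis using \<open>0 < e\<close> by simp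
      qed
      then show "\<exists>N. \<forall>i\<ge>N. norm ((\<integral>x. w (r i) x * \<phi> x \<partial>M) - J) < e" by blast
    qed
    ultimately show "(\<integral>x. v x * \<phi> x \<partial>M) = J" using LIMSEQ_unique by blast
  qed
qed

end

section \<open>Weak derivatives from difference quotients\<close>

lemma has_derivative_along_axis:
  assumes "Ck_on (Suc k) UNIV \<phi>"
  shows "((\<lambda>t. \<phi> (x + t *\<^sub>R axis j 1)) has_real_derivative pdiff j \<phi> (x + t *\<^sub>R axis j 1)) (at t)"
proof -
  have "((\<lambda>s. \<phi> ((x + t *\<^sub>R axis j 1) + s *\<^sub>R axis j 1)) has_real_derivative pdiff j \<phi> (x + t *\<^sub>R axis j 1)) (at 0)"
    by (intro has_derivative_pdiff Ck_on_SucD(2)[OF assms])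
  then have "((\<lambda>s. \<phi> (x + (s + t) *\<^sub>R axis j 1)) has_real_derivative pdiff j \<phi> (x + t *\<^sub>R axis j 1)) (at 0)"
    by (simp add: algebra_simps)
  then show ?thesis using DERIV_shift[of "\<lambda>t. \<phi> (x + t *\<^sub>R axis j 1)" _ 0 t] by simp
qed

lemma pdiff_eq_0_outside_support:
  assumes "x \<notin> closure {x. \<phi> x \<noteq> 0}"
  shows "pdiff j \<phi> x = 0"
proof -
  define K where "K = closure {x. \<phi> x \<noteq> 0}"
  have "open ((\<lambda>t. x + t *\<^sub>R axis j 1) -` (- K))"
    by (intro continuous_open_vimage) (auto intro!: continuous_intros simp: K_def)
  moreover have "\<phi> y = 0" if "y \<in> - K" for y
    using that closure_subset[of "{x. \<phi> x \<noteq> 0}"] by (auto simp: K_def)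
  moreover have "0 \<in> (\<lambda>t. x + t *\<^sub>R axis j 1) -` (- K)" using assms by (simp add: K_def)
  ultimately have "((\<lambda>t. \<phi> (x + t *\<^sub>R axis j 1)) has_real_derivative 0) (at 0)"
    by (intro has_field_derivative_transform_within_open[of "\<lambda>_. 0" 0 0 "(\<lambda>t. x + t *\<^sub>R axis j 1) -` (- K)" "\<lambda>t. \<phi> (x + t *\<^sub>R axis j 1)"])
      simp_all
  then show ?thesis by (rule pdiff_eqI)
qed

lemma pdiff_test_function_bounded:
  assumes "\<phi> \<in> test_functions \<Omega>"
  obtains B where "\<And>x. \<bar>pdiff j \<phi> x\<bar> \<le> B"
proof -
  define K where "K = closure {x. \<phi> x \<noteq> 0}"
  have K: "compact K" using assms by (auto simp: K_def test_functions_def)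
  have C: "Ck_on (Suc 0) UNIV \<phi>" by (rule test_function_Ck_on[OF assms])
  have zero: "pdiff j \<phi> x = 0" if "x \<notin> K" for x
    using pdiff_eq_0_outside_support that by (simp add: K_def)
  have "continuous_on UNIV (pdiff j \<phi>)" using Ck_on_SucD(3)[OF C] by (simp add: Ck_on_0)
  then have "bounded (pdiff j \<phi> ` K)"
    using compact_continuous_image[OF continuous_on_subset K] compact_imp_bounded by blast
  then obtain B where "\<forall>x\<in>K. \<bar>pdiff j \<phi> x\<bar> \<le> B" by (auto simp: bounded_iff)
  then have "\<bar>pdiff j \<phi> x\<bar> \<le> \<bar>B\<bar>" for x using zero[of x] by (cases "x \<in> K") force+
  then show thesis using that by blast
qed

lemma integrable_bounded_support:
  fixes f :: "'a::euclidean_space \<Rightarrow> real"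
  assumes "f \<in> borel_measurable borel" "\<And>x. \<bar>f x\<bar> \<le> B" "compact K" "\<And>x. x \<notin> K \<Longrightarrow> f x = 0"
  shows "integrable lborel f"
proof (rule Bochner_Integration.integrable_bound)
  show "integrable lborel (\<lambda>x. B * indicator K x)"
    using emeasure_compact_finite[OF assms(3)] compact_imp_closed[OF assms(3)]
    by (intro integrable_mult_right integrable_real_indicator) auto
  show "AE x in lborel. norm (f x) \<le> norm (B * indicator K x)"
  proof (rule AE_I2)
    fix x
    have "\<bar>f x\<bar> \<le> \<bar>B\<bar>" using assms(2)[of x] by linarith
    then show "norm (f x) \<le> norm (B * indicator K x)" using assms(4)[of x] by (cases "x \<in> K") auto
  qed
qed (use assms in simp)

lemma lborel_integral_shift:
  fixes f :: "'a::euclidean_space \<Rightarrow> real"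
  assumes "f \<in> borel_measurable borel"
  shows "integral\<^sup>L lborel (\<lambda>x. f (c + x)) = integral\<^sup>L lborel f"
  using integral_distr[of "(+) c" lborel borel f] assms by (simp add: lborel_distr_plus)

text \<open>A translation moves the difference quotient from \<open>u\<close> to
  \<open>\<phi>\<close>, where it converges boundedly to the classical derivative. The integrals
  extend over the whole space, so no boundary terms arise.\<close>

lemma difference_quotients_converge_weakly:
  fixes u :: "real^'m \<Rightarrow> real"
  assumes u: "u \<in> borel_measurable borel" "\<And>x. \<bar>u x\<bar> \<le> B"
    and \<phi>: "\<phi> \<in> test_functions \<Omega>"
    and h: "h \<longlonglongrightarrow> 0" "\<And>n. 0 < h n" "\<And>n. h n \<le> 1"
  shows "(\<lambda>n. \<integral>x. (u (x + h n *\<^sub>R axis j 1) - u x) / h n * \<phi> x \<partial>lborel) \<longlonglongrightarrow>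
    - (\<integral>x. u x * pdiff j \<phi> x \<partial>lborel)"
proof -
  define e :: "real^'m" where "e = axis j 1"
  have ne: "norm e = 1" by (simp add: e_def)
  obtain K B1 where K: "compact K" "\<And>x. x \<notin> K \<Longrightarrow> \<phi> x = 0" "\<And>x. \<bar>\<phi> x\<bar> \<le> B1" "continuous_on UNIV \<phi>"
    using test_functionE[OF \<phi>] by metis
  obtain B2 where B2: "\<And>x. \<bar>pdiff j \<phi> x\<bar> \<le> B2" using pdiff_test_function_bounded[OF \<phi>] by metis
  have C: "Ck_on (Suc 0) UNIV \<phi>" by (rule test_function_Ck_on[OF \<phi>])
  note der = has_derivative_along_axis[OF C, where j = j, folded e_def]
  have \<phi>m [measurable]: "\<phi> \<in> borel_measurable borel" using K(4) by (rule borel_measurable_continuous_onI)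
  have pm [measurable]: "pdiff j \<phi> \<in> borel_measurable borel"
    using Ck_on_SucD(3)[OF C] by (intro borel_measurable_continuous_onI) (simp add: Ck_on_0)
  note um [measurable] = u(1)
  have B: "0 \<le> B" "0 \<le> B1" "0 \<le> B2" using u(2)[of 0] K(3)[of 0] B2[of 0] by linarith+
  have lip: "\<bar>\<phi> (x + t *\<^sub>R e) - \<phi> x\<bar> \<le> B2 * \<bar>t\<bar>" for x t
    using field_differentiable_bound[of UNIV "\<lambda>t. \<phi> (x + t *\<^sub>R e)" "\<lambda>t. pdiff j \<phi> (x + t *\<^sub>R e)" B2 t 0]
      der B2 by simp
  obtain R where R: "K \<subseteq> cball 0 R" using compact_imp_bounded[OF K(1)] by (auto simp: bounded_iff subset_iff)
  have move: "(\<integral>x. (u (x + h n *\<^sub>R e) - u x) / h n * \<phi> x \<partial>lborel) =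
      (\<integral>x. u x * ((\<phi> (x + (- h n) *\<^sub>R e) - \<phi> x) / h n) \<partial>lborel)" for n
  proof -
    have i1: "integrable lborel (\<lambda>x. u (x + h n *\<^sub>R e) * \<phi> x)"
      by (rule integrable_bounded_support[of _ "B * B1", OF _ _ K(1)])
        (use u(2) K(2,3) B in \<open>auto simp: abs_mult intro!: mult_mono\<close>)
    have i2: "integrable lborel (\<lambda>x. u x * \<phi> x)"
      by (rule integrable_bounded_support[of _ "B * B1", OF _ _ K(1)])
        (use u(2) K(2,3) B in \<open>auto simp: abs_mult intro!: mult_mono\<close>)
    have i3: "integrable lborel (\<lambda>x. u x * \<phi> (x + (- h n) *\<^sub>R e))"
    proof (rule integrable_bounded_support[of _ "B * B1"])
      \<comment> \<open>A shift by \<open>h n \<le> 1\<close> enlarges the support of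
        \<open>\<phi>\<close> by at most 1.\<close>
      show "compact (cball 0 (R + 1) :: (real^'m) set)" by simp
      show "u x * \<phi> (x + (- h n) *\<^sub>R e) = 0" if "x \<notin> cball 0 (R + 1)" for x
      proof -
        have "norm x \<le> norm (x + (- h n) *\<^sub>R e) + norm (h n *\<^sub>R e)"
          using norm_triangle_ineq[of "x + (- h n) *\<^sub>R e" "h n *\<^sub>R e"] by simp
        moreover have "norm (h n *\<^sub>R e) \<le> 1" using h(2,3)[of n] ne by simp
        ultimately have "x + (- h n) *\<^sub>R e \<notin> K" using that R by (auto simp: subset_iff)
        then show ?thesis using K(2) by simp
      qed
    qed (use u(2) K(3) B in \<open>auto simp: abs_mult intro!: mult_mono\<close>)
    have "(\<integral>x. (u (x + h n *\<^sub>R e) - u x) / h n * \<phi> x \<partial>lborel) =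
        ((\<integral>x. u (x + h n *\<^sub>R e) * \<phi> x \<partial>lborel) - (\<integral>x. u x * \<phi> x \<partial>lborel)) / h n"
      using Bochner_Integration.integral_diff[OF i1 i2] by (simp add: left_diff_distrib)
    also have "(\<integral>x. u (x + h n *\<^sub>R e) * \<phi> x \<partial>lborel) = (\<integral>x. u x * \<phi> (x + (- h n) *\<^sub>R e) \<partial>lborel)"
      using lborel_integral_shift[of "\<lambda>x. u (x + h n *\<^sub>R e) * \<phi> x" "- h n *\<^sub>R e"] by (simp add: algebra_simps)
    also have "((\<integral>x. u x * \<phi> (x + (- h n) *\<^sub>R e) \<partial>lborel) - (\<integral>x. u x * \<phi> x \<partial>lborel)) / h n =
        (\<integral>x. u x * ((\<phi> (x + (- h n) *\<^sub>R e) - \<phi> x) / h n) \<partial>lborel)"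
      using Bochner_Integration.integral_diff[OF i3 i2] by (simp add: right_diff_distrib)
    finally show ?thesis .
  qed
  have "(\<lambda>n. \<integral>x. u x * ((\<phi> (x + (- h n) *\<^sub>R e) - \<phi> x) / h n) \<partial>lborel) \<longlonglongrightarrow>
      (\<integral>x. u x * (- pdiff j \<phi> x) \<partial>lborel)"
  proof (rule integral_dominated_convergence)
    show "integrable lborel (\<lambda>x::real^'m. (B * B2) * indicator (cball 0 (R + 1)) x)"
      using emeasure_compact_finite[of "cball 0 (R + 1) :: (real^'m) set"]
      by (intro integrable_mult_right integrable_real_indicator) auto
    show "AE x in lborel. (\<lambda>n. u x * ((\<phi> (x + (- h n) *\<^sub>R e) - \<phi> x) / h n)) \<longlonglongrightarrow> u x * (- pdiff j \<phi> x)"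
    proof (intro AE_I2 tendsto_mult tendsto_const)
      fix x
      have "(\<lambda>t. (\<phi> (x + t *\<^sub>R e) - \<phi> x) / t) \<midarrow>0\<rightarrow> pdiff j \<phi> x"
        using der[of x 0] unfolding DERIV_def by simp
      moreover have "filterlim (\<lambda>n. - h n) (at 0) sequentially"
        unfolding filterlim_at using tendsto_minus[OF h(1)] h(2)
        by (auto intro!: always_eventually simp: less_imp_neq[symmetric])
      ultimately have "(\<lambda>n. (\<phi> (x + (- h n) *\<^sub>R e) - \<phi> x) / (- h n)) \<longlonglongrightarrow> pdiff j \<phi> x"
        by (rule filterlim_compose)
      from tendsto_minus[OF this] show "(\<lambda>n. (\<phi> (x + (- h n) *\<^sub>R e) - \<phi> x) / h n) \<longlonglongrightarrow> - pdiff j \<phi> x"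
        by simp
    qed
    show "AE x in lborel. norm (u x * ((\<phi> (x + (- h n) *\<^sub>R e) - \<phi> x) / h n)) \<le> (B * B2) * indicator (cball 0 (R + 1)) x" for n
    proof (rule AE_I2)
      fix x
      show "norm (u x * ((\<phi> (x + (- h n) *\<^sub>R e) - \<phi> x) / h n)) \<le> (B * B2) * indicator (cball 0 (R + 1)) x"
      proof (cases "x \<in> cball 0 (R + 1)")
        case True
        have "\<bar>(\<phi> (x + (- h n) *\<^sub>R e) - \<phi> x) / h n\<bar> \<le> B2"
          using lip[of x "- h n"] h(2)[of n] by (simp add: abs_divide pos_divide_le_eq)
        then have "norm (u x * ((\<phi> (x + (- h n) *\<^sub>R e) - \<phi> x) / h n)) \<le> B * B2"
          unfolding real_norm_def abs_mult[of "u x"] using u(2)[of x] B by (intro mult_mono) auto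
        then show ?thesis using True by (simp only: indicator_simps mult_1_right)
      next
        case False
        have "norm x \<le> norm (x + (- h n) *\<^sub>R e) + norm (h n *\<^sub>R e)"
          using norm_triangle_ineq[of "x + (- h n) *\<^sub>R e" "h n *\<^sub>R e"] by simp
        moreover have "norm (h n *\<^sub>R e) \<le> 1" using h(2,3)[of n] ne by simp
        ultimately have "x + (- h n) *\<^sub>R e \<notin> K" "x \<notin> K" using False R by (auto simp: subset_iff)
        then show ?thesis using K(2) B by simp
      qed
    qed
  qed measurable
  then show ?thesis unfolding e_def[symmetric] move by simp
qed

lemma set_integral_support:
  fixes f :: "'a::euclidean_space \<Rightarrow> real"
  assumes "f \<in> borel_measurable borel" "\<And>x. x \<notin> \<Omega> \<Longrightarrow> f x = 0"
  shows "(LINT x:\<Omega>|lebesgue. f x) = integral\<^sup>L lborel f"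
proof -
  have "(LINT x:\<Omega>|lebesgue. f x) = integral\<^sup>L lebesgue f"
    unfolding set_lebesgue_integral_def
    by (intro Bochner_Integration.integral_cong) (use assms(2) in \<open>auto simp: indicator_def\<close>)
  also have "\<dots> = integral\<^sup>L lborel f" using assms(1) by (intro integral_completion) simp
  finally show ?thesis .
qed

lemma bounded_locally_integrable:
  assumes "open \<Omega>" "v \<in> borel_measurable (lebesgue_on \<Omega>)" "\<And>x. x \<in> \<Omega> \<Longrightarrow> \<bar>v x\<bar> \<le> B"
  shows "locally_integrable \<Omega> v"
  unfolding locally_integrable_def set_integrable_def
proof (intro allI impI, elim conjE)
  fix K assume K: "compact K" "K \<subseteq> \<Omega>"
  have \<Omega>: "\<Omega> \<in> sets lebesgue" using assms(1) by (intro sets_completionI_sets) simp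
  have Km: "K \<in> sets lebesgue" using compact_imp_closed[OF K(1)] by (intro sets_completionI_sets) simp
  have vm: "(\<lambda>x. if x \<in> \<Omega> then v x else 0) \<in> borel_measurable lebesgue"
    using assms(2) \<Omega> borel_measurable_if by blast
  have eq: "(\<lambda>x. indicator K x *\<^sub>R v x) = (\<lambda>x. indicator K x * (if x \<in> \<Omega> then v x else 0))"
    using K(2) by (auto simp: indicator_def fun_eq_iff)
  show "integrable lebesgue (\<lambda>x. indicator K x *\<^sub>R v x)"
  proof (rule Bochner_Integration.integrable_bound)
    have "K \<in> lmeasurable" using K(1) by (rule lmeasurable_compact)
    then show "integrable lebesgue (\<lambda>x. B * indicator K x)"
      by (intro integrable_mult_right integrable_real_indicator) (auto simp: fmeasurable_def)
    show "(\<lambda>x. indicator K x *\<^sub>R v x) \<in> borel_measurable lebesgue"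
      unfolding eq using vm Km by (intro borel_measurable_times borel_measurable_indicator)
    show "AE x in lebesgue. norm (indicator K x *\<^sub>R v x) \<le> norm (B * indicator K x)"
    proof (rule AE_I2)
      fix x
      show "norm (indicator K x *\<^sub>R v x) \<le> norm (B * indicator K x)"
        using assms(3)[of x] K(2) by (cases "x \<in> K") auto
    qed
  qed
qed

lemma Linf_bounded:
  assumes "v \<in> borel_measurable (lebesgue_on \<Omega>)" "\<And>x. x \<in> \<Omega> \<Longrightarrow> \<bar>v x\<bar> \<le> B"
  shows "v \<in> Linf \<Omega>"
proof -
  have "Linf_norm \<Omega> v \<le> ennreal \<bar>B\<bar>"
    unfolding Linf_norm_def
  proof (rule esssup_I)
    show "(\<lambda>x. ennreal \<bar>v x\<bar>) \<in> borel_measurable (lebesgue_on \<Omega>)" using assms(1) by measurable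
    show "AE x in lebesgue_on \<Omega>. ennreal \<bar>v x\<bar> \<le> ennreal \<bar>B\<bar>"
      by (rule AE_I2) (use assms(2) in \<open>force intro!: ennreal_leI simp: space_restrict_space\<close>)
  qed
  then show ?thesis using assms(1) by (auto simp: Linf_def intro: le_less_trans)
qed

text \<open>\<open>u\<close> lives on the whole space so that translations make sense near the
  boundary of \<open>\<Omega>\<close>; the Lipschitz condition bounds the quotients on
  \<open>\<Omega>\<close>. Their weak cluster function keeps the bound, and tested against
  \<open>\<phi>\<close> it reproduces the limit of the quotients.\<close>

lemma weak_pdiff_exists:
  fixes u :: "real^'m \<Rightarrow> real"
  assumes \<Omega>: "open \<Omega>" "bounded \<Omega>"
    and u: "u \<in> borel_measurable borel" "\<And>x. \<bar>u x\<bar> \<le> B"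
    and \<epsilon>: "0 < \<epsilon>" and L: "0 \<le> L"
    and lip: "\<And>x h. x \<in> \<Omega> \<Longrightarrow> \<bar>h\<bar> < \<epsilon> \<Longrightarrow> \<bar>u (x + h *\<^sub>R axis j 1) - u x\<bar> \<le> L * \<bar>h\<bar>"
  shows "\<exists>v\<in>Linf \<Omega>. has_weak_pdiff \<Omega> j u v \<and> (\<forall>x. \<bar>v x\<bar> \<le> L)"
proof -
  have \<Omega>m: "\<Omega> \<in> sets lebesgue" using \<Omega>(1) by (intro sets_completionI_sets) simp
  have "\<Omega> \<in> lmeasurable" using \<Omega> by (rule lmeasurable_open[rotated])
  then interpret finite_measure "lebesgue_on \<Omega>"
    by (rule finite_measure_lebesgue_on)
  obtain n0 :: nat where n0: "inverse (Suc n0) < \<epsilon>" using reals_Archimedean[OF \<epsilon>] by auto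
  \<comment> \<open>The shift by \<open>n0\<close> keeps every step below \<open>\<epsilon>\<close>,
    where the Lipschitz hypothesis applies.\<close>
  define h where "h n = inverse (real (Suc (n + n0)))" for n
  have h: "h \<longlonglongrightarrow> 0" "\<And>n. 0 < h n" "\<And>n. h n \<le> 1" "\<And>n. h n < \<epsilon>"
  proof -
    show "h \<longlonglongrightarrow> 0" unfolding h_def using LIMSEQ_ignore_initial_segment[OF LIMSEQ_inverse_real_of_nat] by simp
    show "0 < h n" for n by (simp add: h_def)
    show "h n \<le> 1" for n unfolding h_def by (intro inverse_le_1_iff[THEN iffD2]) simp
    have "h n \<le> inverse (Suc n0)" for n unfolding h_def by (intro le_imp_inverse_le) simp_all
    then show "h n < \<epsilon>" for n using n0 le_less_trans by blast
  qed
  define D where "D n x = (u (x + h n *\<^sub>R axis j 1) - u x) / h n" for n x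
  note um [measurable] = u(1)
  have Db: "D n \<in> borel_measurable borel" for n unfolding D_def by measurable
  have toM: "f \<in> borel_measurable (lebesgue_on \<Omega>)" if "f \<in> borel_measurable borel" for f :: "real^'m \<Rightarrow> real"
    using that by (intro measurable_restrict_space1 measurable_completion) simp
  have DL: "\<bar>D n x\<bar> \<le> L" if "x \<in> space (lebesgue_on \<Omega>)" for n x
  proof -
    have "\<bar>u (x + h n *\<^sub>R axis j 1) - u x\<bar> \<le> L * h n"
      using lip[of x "h n"] h(2,4)[of n] that by (simp add: space_restrict_space)
    then show ?thesis using h(2)[of n] by (simp add: D_def abs_divide pos_divide_le_eq)
  qed
  obtain v where v: "v \<in> borel_measurable (lebesgue_on \<Omega>)" "\<And>x. \<bar>v x\<bar> \<le> L"
    "\<And>\<phi> B J. \<phi> \<in> borel_measurable (lebesgue_on \<Omega>) \<Longrightarrow> \<forall>x\<in>space (lebesgue_on \<Omega>). \<bar>\<phi> x\<bar> \<le> B \<Longrightarrow>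
      (\<lambda>n. \<integral>x. D n x * \<phi> x \<partial>lebesgue_on \<Omega>) \<longlonglongrightarrow> J \<Longrightarrow> (\<integral>x. v x * \<phi> x \<partial>lebesgue_on \<Omega>) = J"
  proof -
    have "\<exists>v. v \<in> borel_measurable (lebesgue_on \<Omega>) \<and> (\<forall>x. \<bar>v x\<bar> \<le> L) \<and>
      (\<forall>\<phi> B J. \<phi> \<in> borel_measurable (lebesgue_on \<Omega>) \<longrightarrow> (\<forall>x\<in>space (lebesgue_on \<Omega>). \<bar>\<phi> x\<bar> \<le> B) \<longrightarrow>
      (\<lambda>n. \<integral>x. D n x * \<phi> x \<partial>lebesgue_on \<Omega>) \<longlonglongrightarrow> J \<longrightarrow> (\<integral>x. v x * \<phi> x \<partial>lebesgue_on \<Omega>) = J)"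
    proof (rule weak_cluster_function)
      show "D n \<in> borel_measurable (lebesgue_on \<Omega>)" for n by (rule toM[OF Db])
    qed (rule DL L, assumption?)+
    then obtain v where v: "v \<in> borel_measurable (lebesgue_on \<Omega>)" "\<forall>x. \<bar>v x\<bar> \<le> L"
      "\<forall>\<phi> B J. \<phi> \<in> borel_measurable (lebesgue_on \<Omega>) \<longrightarrow> (\<forall>x\<in>space (lebesgue_on \<Omega>). \<bar>\<phi> x\<bar> \<le> B) \<longrightarrow>
      (\<lambda>n. \<integral>x. D n x * \<phi> x \<partial>lebesgue_on \<Omega>) \<longlonglongrightarrow> J \<longrightarrow> (\<integral>x. v x * \<phi> x \<partial>lebesgue_on \<Omega>) = J"
      by (elim exE conjE)
    show thesis
      by (rule that[OF v(1) v(2)[rule_format] v(3)[THEN spec, THEN spec, THEN spec, THEN mp, THEN mp, THEN mp]])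
  qed
  have restr: "(LINT x:\<Omega>|lebesgue. f x) = (\<integral>x. f x \<partial>lebesgue_on \<Omega>)" for f :: "real^'m \<Rightarrow> real"
    using \<Omega>m by (simp add: set_lebesgue_integral_def integral_restrict_space)
  have "has_weak_pdiff \<Omega> j u v"
    unfolding has_weak_pdiff_def
  proof (intro conjI ballI)
    show "locally_integrable \<Omega> u" by (rule bounded_locally_integrable[OF \<Omega>(1) toM[OF u(1)] u(2)])
    show "locally_integrable \<Omega> v" by (rule bounded_locally_integrable[OF \<Omega>(1) v(1) v(2)])
    fix \<phi> assume \<phi>: "\<phi> \<in> test_functions \<Omega>"
    obtain K B1 where K: "K \<subseteq> \<Omega>" "\<And>x. x \<notin> K \<Longrightarrow> \<phi> x = 0" "\<And>x. \<bar>\<phi> x\<bar> \<le> B1" "continuous_on UNIV \<phi>"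
      using test_functionE[OF \<phi>] by metis
    have \<phi>m [measurable]: "\<phi> \<in> borel_measurable borel" using K(4) by (rule borel_measurable_continuous_onI)
    have C: "Ck_on (Suc 0) UNIV \<phi>" by (rule test_function_Ck_on[OF \<phi>])
    have pm [measurable]: "pdiff j \<phi> \<in> borel_measurable borel"
      using Ck_on_SucD(3)[OF C] by (intro borel_measurable_continuous_onI) (simp add: Ck_on_0)
    have Dphi: "(\<integral>x. D n x * \<phi> x \<partial>lebesgue_on \<Omega>) = (\<integral>x. D n x * \<phi> x \<partial>lborel)" for n
      unfolding restr[symmetric]
      by (rule set_integral_support) (use K(1,2) Db[of n] in auto)
    have out: "pdiff j \<phi> x = 0" if "x \<notin> \<Omega>" for x
      by (rule pdiff_eq_0_outside_support) (use \<phi> that in \<open>auto simp: test_functions_def\<close>)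
    have uphi: "(LINT x:\<Omega>|lebesgue. u x * pdiff j \<phi> x) = (\<integral>x. u x * pdiff j \<phi> x \<partial>lborel)"
      by (rule set_integral_support) (use out in auto)
    have "(\<lambda>n. \<integral>x. D n x * \<phi> x \<partial>lebesgue_on \<Omega>) \<longlonglongrightarrow> - (\<integral>x. u x * pdiff j \<phi> x \<partial>lborel)"
      unfolding Dphi unfolding D_def
      by (rule difference_quotients_converge_weakly[OF u \<phi> h(1,2,3)])
    then have "(\<integral>x. v x * \<phi> x \<partial>lebesgue_on \<Omega>) = - (\<integral>x. u x * pdiff j \<phi> x \<partial>lborel)"
      using v(3)[OF toM[OF \<phi>m], of B1] K(3) by blast
    then show "(LINT x:\<Omega>|lebesgue. u x * pdiff j \<phi> x) = - (LINT x:\<Omega>|lebesgue. v x * \<phi> x)"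
      unfolding uphi restr by simp
  qed
  then show ?thesis using Linf_bounded[OF v(1) v(2)] v(2) by blast
qed

lemma weak_pdiff_unique:
  assumes "open \<Omega>" and v: "has_weak_pdiff \<Omega> j u v" and w: "has_weak_pdiff \<Omega> j u w"
  shows "AE x in lebesgue_on \<Omega>. v x = w x"
proof -
  have loc: "locally_integrable \<Omega> v" "locally_integrable \<Omega> w"
    using v w by (auto simp: has_weak_pdiff_def)
  have "AE x in lebesgue_on \<Omega>. v x - w x = 0"
  proof (rule AE_zero_of_test_functions[OF \<open>open \<Omega>\<close>])
    show "locally_integrable \<Omega> (\<lambda>x. v x - w x)"
      using loc by (auto simp: locally_integrable_def intro: set_integral_diff)
    fix \<phi> assume \<phi>: "\<phi> \<in> test_functions \<Omega>"
    have "(LINT x:\<Omega>|lebesgue. (v x - w x) * \<phi> x) =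
        (LINT x:\<Omega>|lebesgue. v x * \<phi> x) - (LINT x:\<Omega>|lebesgue. w x * \<phi> x)"
      using set_integral_diff(2)[OF integrable_mult_test[OF loc(1) \<phi>] integrable_mult_test[OF loc(2) \<phi>]]
      by (simp add: left_diff_distrib)
    also have "\<dots> = 0" using v w \<phi> by (simp add: has_weak_pdiff_def)
    finally show "(LINT x:\<Omega>|lebesgue. (v x - w x) * \<phi> x) = 0" .
  qed
  then show ?thesis by simp
qed


section \<open>Sobolev maps into unordered tuples\<close>

lemma has_weak_pdiff_cong:
  assumes eq: "\<And>x. x \<in> \<Omega> \<Longrightarrow> u x = u' x" and v: "has_weak_pdiff \<Omega> j u v"
  shows "has_weak_pdiff \<Omega> j u' v"
proof -
  have "locally_integrable \<Omega> u'"
    unfolding locally_integrable_def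
  proof (intro allI impI, elim conjE)
    fix K assume K: "compact K" "K \<subseteq> \<Omega>"
    have eq': "(\<lambda>x. indicator K x *\<^sub>R u x) = (\<lambda>x. indicator K x *\<^sub>R u' x)"
      using K(2) eq by (auto simp: indicator_def fun_eq_iff)
    have "set_integrable lebesgue K u" using v K unfolding has_weak_pdiff_def locally_integrable_def by blast
    then show "set_integrable lebesgue K u'" unfolding set_integrable_def eq' .
  qed
  moreover have "(LINT x:\<Omega>|lebesgue. u x * \<psi> x) = (LINT x:\<Omega>|lebesgue. u' x * \<psi> x)" for \<psi>
    unfolding set_lebesgue_integral_def
    by (intro Bochner_Integration.integral_cong refl) (simp add: indicator_def eq)
  ultimately show ?thesis using v by (simp add: has_weak_pdiff_def)
qed

lemma Linf_AE_bounded: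
  assumes "\<phi> \<in> Linf \<Omega>"
  obtains B where "AE x in lebesgue_on \<Omega>. \<bar>\<phi> x\<bar> \<le> B"
proof -
  have fin: "Linf_norm \<Omega> \<phi> < \<infinity>" using assms by (simp add: Linf_def)
  have "AE x in lebesgue_on \<Omega>. ennreal \<bar>\<phi> x\<bar> \<le> Linf_norm \<Omega> \<phi>"
    unfolding Linf_norm_def by (rule esssup_AE)
  then have "AE x in lebesgue_on \<Omega>. \<bar>\<phi> x\<bar> \<le> enn2real (Linf_norm \<Omega> \<phi>)"
  proof eventually_elim
    case (elim x)
    then show ?case using enn2real_mono[OF elim] fin by simp
  qed
  then show thesis by (rule that)
qed

lemma Linf_AE_boundedI:
  assumes "\<phi> \<in> borel_measurable (lebesgue_on \<Omega>)" "AE x in lebesgue_on \<Omega>. \<bar>\<phi> x\<bar> \<le> B"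
  shows "Linf_norm \<Omega> \<phi> \<le> ennreal B"
  unfolding Linf_norm_def
proof (rule esssup_I)
  show "(\<lambda>x. ennreal \<bar>\<phi> x\<bar>) \<in> borel_measurable (lebesgue_on \<Omega>)" using assms(1) by measurable
  show "AE x in lebesgue_on \<Omega>. ennreal \<bar>\<phi> x\<bar> \<le> ennreal B"
    using assms(2) by eventually_elim (rule ennreal_leI)
qed

lemma Linf_dominated:
  assumes "\<phi> \<in> Linf \<Omega>" "\<psi> \<in> borel_measurable (lebesgue_on \<Omega>)"
    "\<And>x. x \<in> \<Omega> \<Longrightarrow> \<bar>\<psi> x\<bar> \<le> \<bar>\<phi> x\<bar>"
  shows "\<psi> \<in> Linf \<Omega>"
proof -
  obtain B where "AE x in lebesgue_on \<Omega>. \<bar>\<phi> x\<bar> \<le> B" using Linf_AE_bounded[OF assms(1)] .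
  then have "AE x in lebesgue_on \<Omega>. \<bar>\<psi> x\<bar> \<le> B"
    using AE_space by eventually_elim (use assms(3) in \<open>force simp: space_restrict_space\<close>)
  from Linf_AE_boundedI[OF assms(2) this] show ?thesis
    using assms(2) by (auto simp: Linf_def intro: le_less_trans)
qed

text \<open>
  The infimum of a sequence of dominating functions whose integrals tend to the infimum of all
  integrals of dominating functions.
\<close>
lemma minimal_dominating_exists:
  assumes \<Omega>: "open \<Omega>" "bounded \<Omega>" and dom: "dominates_pdiff \<Omega> Q f j \<phi>0"
  shows "\<exists>\<phi>. dominates_pdiff \<Omega> Q f j \<phi> \<and>
    (\<forall>\<psi>. dominates_pdiff \<Omega> Q f j \<psi> \<longrightarrow> (AE x in lebesgue_on \<Omega>. \<phi> x \<le> \<psi> x))"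
proof -
  have "\<Omega> \<in> lmeasurable" using \<Omega> by (rule lmeasurable_open[rotated])
  then interpret finite_measure "lebesgue_on \<Omega>" by (rule finite_measure_lebesgue_on)
  define A where "A = {\<phi>. dominates_pdiff \<Omega> Q f j \<phi>}"
  have A_meas: "\<phi> \<in> borel_measurable (lebesgue_on \<Omega>)" and A_nn: "x \<in> \<Omega> \<Longrightarrow> 0 \<le> \<phi> x"
    and A_Linf: "\<phi> \<in> Linf \<Omega>"
    and A_dom: "P \<in> unordered_tuples Q \<Longrightarrow> has_weak_pdiff \<Omega> j (\<lambda>x. tuple_dist (f x) P) v \<Longrightarrow>
      AE x in lebesgue_on \<Omega>. \<bar>v x\<bar> \<le> \<phi> x"
    if "\<phi> \<in> A" for \<phi> x P v
    using that by (auto simp: A_def dominates_pdiff_def Linf_def)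
  have A_int: "integrable (lebesgue_on \<Omega>) \<phi>" if \<phi>: "\<phi> \<in> A" for \<phi>
  proof -
    obtain B where "AE x in lebesgue_on \<Omega>. \<bar>\<phi> x\<bar> \<le> B" using Linf_AE_bounded[OF A_Linf[OF \<phi>]] .
    then show ?thesis using A_meas[OF \<phi>] by (intro integrable_const_bound[of \<phi> B]) auto
  qed
  define I where "I \<phi> = (\<integral>x. \<phi> x \<partial>lebesgue_on \<Omega>)" for \<phi> :: "real^'a \<Rightarrow> real"
  have I0: "0 \<le> I \<phi>" if "\<phi> \<in> A" for \<phi>
    unfolding I_def by (rule integral_nonneg_AE) (rule AE_I2, use A_nn[OF that] in \<open>simp add: space_restrict_space\<close>)
  then have bdd: "bdd_below (I ` A)" by (auto simp: bdd_below_def)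
  have ne: "A \<noteq> {}" using dom by (auto simp: A_def)
  define a where "a = Inf (I ` A)"
  have a_le: "a \<le> I \<phi>" if "\<phi> \<in> A" for \<phi> unfolding a_def using bdd that by (intro cInf_lower) auto
  have "\<exists>\<phi>\<in>A. I \<phi> < a + inverse (Suc n)" for n
  proof -
    have "Inf (I ` A) < a + inverse (Suc n)" by (simp add: a_def)
    then show ?thesis using cInf_lessD[of "I ` A"] ne by blast
  qed
  then obtain \<psi> where \<psi>: "\<And>n. \<psi> n \<in> A" "\<And>n. I (\<psi> n) < a + inverse (Suc n)" by metis
  \<comment> \<open>Dominating functions are unrestricted outside \<open>\<Omega>\<close>; the value
    0 there keeps the infimum bounded below at every point.\<close>
  define \<phi> where "\<phi> x = (INF n. if x \<in> \<Omega> then \<psi> n x else 0)" for x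
  have bddx: "bdd_below (range (\<lambda>n. if x \<in> \<Omega> then \<psi> n x else 0))" for x
    by (rule bdd_belowI2[of _ 0]) (simp add: A_nn[OF \<psi>(1)])
  have \<phi>_le: "\<phi> x \<le> \<psi> n x" if "x \<in> \<Omega>" for x n
    unfolding \<phi>_def using cINF_lower[OF bddx, of n x] that by simp
  have \<phi>_nn: "0 \<le> \<phi> x" if "x \<in> \<Omega>" for x
    unfolding \<phi>_def by (rule cINF_greatest) (use A_nn[OF \<psi>(1)] in auto)
  have \<phi>_meas: "\<phi> \<in> borel_measurable (lebesgue_on \<Omega>)"
    unfolding \<phi>_def
  proof (rule borel_measurable_cINF)
    show "(\<lambda>x. if x \<in> \<Omega> then \<psi> n x else 0) \<in> borel_measurable (lebesgue_on \<Omega>)" for n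
      using A_meas[OF \<psi>(1)[of n]]
      by (rule measurable_cong[THEN iffD1, rotated]) (simp add: space_restrict_space)
    show "bdd_below (range (\<lambda>n. if x \<in> \<Omega> then \<psi> n x else 0))" for x by (rule bddx)
  qed simp
  have \<phi>A: "\<phi> \<in> A"
    unfolding A_def dominates_pdiff_def mem_Collect_eq
  proof (intro conjI ballI allI impI)
    show "\<phi> \<in> Linf \<Omega>"
      by (rule Linf_dominated[OF A_Linf[OF \<psi>(1)[of 0]] \<phi>_meas]) (use \<phi>_le \<phi>_nn A_nn[OF \<psi>(1)] in fastforce)
    show "0 \<le> \<phi> x" if "x \<in> \<Omega>" for x using \<phi>_nn[OF that] .
    fix P v assume P: "P \<in> unordered_tuples Q" "has_weak_pdiff \<Omega> j (\<lambda>x. tuple_dist (f x) P) v"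
    have "AE x in lebesgue_on \<Omega>. \<forall>n. \<bar>v x\<bar> \<le> \<psi> n x"
      unfolding AE_all_countable using A_dom[OF \<psi>(1) P] by blast
    then show "AE x in lebesgue_on \<Omega>. \<bar>v x\<bar> \<le> \<phi> x"
      using AE_space
    proof eventually_elim
      case (elim x)
      then show ?case unfolding \<phi>_def by (intro cINF_greatest) (auto simp: space_restrict_space)
    qed
  qed
  have I_mono: "I \<alpha> \<le> I \<beta>" if "\<alpha> \<in> A" "\<beta> \<in> A" "\<And>x. x \<in> \<Omega> \<Longrightarrow> \<alpha> x \<le> \<beta> x" for \<alpha> \<beta>
    unfolding I_def using that by (intro integral_mono A_int) (auto simp: space_restrict_space)
  have I\<phi>: "I \<phi> = a"
  proof (rule antisym)
    show "I \<phi> \<le> a"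
    proof (rule field_le_epsilon)
      fix e :: real assume "0 < e"
      then obtain n where n: "inverse (Suc n) < e" using reals_Archimedean by blast
      have "I \<phi> \<le> I (\<psi> n)" by (rule I_mono[OF \<phi>A \<psi>(1) \<phi>_le])
      then show "I \<phi> \<le> a + e" using \<psi>(2)[of n] n by linarith
    qed
  qed (rule a_le[OF \<phi>A])
  have "AE x in lebesgue_on \<Omega>. \<phi> x \<le> \<beta> x" if \<beta>: "\<beta> \<in> A" for \<beta>
  proof -
    \<comment> \<open>The minimum is again dominating, so its integral is at least \<open>a\<close>.
      It lies below \<open>\<phi>\<close>, whose integral is \<open>a\<close>, so both agree almost
      everywhere.\<close>
    define \<alpha> where "\<alpha> x = min (\<phi> x) (\<beta> x)" for x
    have \<alpha>_meas: "\<alpha> \<in> borel_measurable (lebesgue_on \<Omega>)"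
      unfolding \<alpha>_def using A_meas[OF \<phi>A] A_meas[OF \<beta>] by measurable
    have \<alpha>A: "\<alpha> \<in> A"
      unfolding A_def dominates_pdiff_def mem_Collect_eq
    proof (intro conjI ballI allI impI)
      show "\<alpha> \<in> Linf \<Omega>"
        by (rule Linf_dominated[OF A_Linf[OF \<phi>A] \<alpha>_meas]) (use A_nn[OF \<phi>A] A_nn[OF \<beta>] in \<open>auto simp: \<alpha>_def\<close>)
      show "0 \<le> \<alpha> x" if "x \<in> \<Omega>" for x using A_nn[OF \<phi>A that] A_nn[OF \<beta> that] by (simp add: \<alpha>_def)
      fix P v assume P: "P \<in> unordered_tuples Q" "has_weak_pdiff \<Omega> j (\<lambda>x. tuple_dist (f x) P) v"
      show "AE x in lebesgue_on \<Omega>. \<bar>v x\<bar> \<le> \<alpha> x"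
        using A_dom[OF \<phi>A P] A_dom[OF \<beta> P] by eventually_elim (simp add: \<alpha>_def)
    qed
    have int: "integrable (lebesgue_on \<Omega>) (\<lambda>x. \<phi> x - \<alpha> x)" by (intro Bochner_Integration.integrable_diff A_int \<phi>A \<alpha>A)
    have "(\<integral>x. \<phi> x - \<alpha> x \<partial>lebesgue_on \<Omega>) = I \<phi> - I \<alpha>"
      unfolding I_def by (rule Bochner_Integration.integral_diff[OF A_int[OF \<phi>A] A_int[OF \<alpha>A]])
    also have "\<dots> \<le> 0" using a_le[OF \<alpha>A] I\<phi> by simp
    finally have "(\<integral>x. \<phi> x - \<alpha> x \<partial>lebesgue_on \<Omega>) = 0"
      by (intro antisym integral_nonneg_AE) (auto simp: \<alpha>_def)
    then have "AE x in lebesgue_on \<Omega>. \<phi> x - \<alpha> x = 0"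
      by (subst (asm) integral_nonneg_eq_0_iff_AE[OF int]) (auto simp: \<alpha>_def)
    then show ?thesis by eventually_elim (auto simp: \<alpha>_def)
  qed
  then show ?thesis using \<phi>A by (auto simp: A_def)
qed

text \<open>Difference quotients leave \<open>\<Omega>\<close>, hence the extensions
  \<open>u\<close> of the distance functions; they, their bounds and radii may depend on
  \<open>P\<close>. The constant \<open>L\<close> may not: this makes the constant function
  \<open>L\<close> dominating for each \<open>j\<close>, and \<open>CARD('m)\<close> squares are
  then summed.\<close>

lemma W1inf_tuples_criterion:
  fixes f :: "real^'m \<Rightarrow> (real^'n) multiset"
  assumes \<Omega>: "open \<Omega>" "bounded \<Omega>" and L: "0 \<le> L"
    and f: "f \<in> lebesgue_on \<Omega> \<rightarrow>\<^sub>M sigma (unordered_tuples Q)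
      {U. openin (Metric_space.mtopology (unordered_tuples Q) tuple_dist) U}"
    and ext: "\<And>P. P \<in> unordered_tuples Q \<Longrightarrow> \<exists>u B \<epsilon>. u \<in> borel_measurable borel \<and> (\<forall>x. \<bar>u x\<bar> \<le> B) \<and> 0 < \<epsilon> \<and>
      (\<forall>x\<in>\<Omega>. u x = tuple_dist (f x) P) \<and>
      (\<forall>j. \<forall>x\<in>\<Omega>. \<forall>h. \<bar>h\<bar> < \<epsilon> \<longrightarrow> \<bar>u (x + h *\<^sub>R axis j 1) - u x\<bar> \<le> L * \<bar>h\<bar>)"
  shows "f \<in> W1inf_tuples \<Omega> Q \<and>
    Linf_norm \<Omega> (tuple_diff_norm \<Omega> Q f) \<le> ennreal (sqrt (real CARD('m)) * L)"
proof -
  have ex: "\<exists>v\<in>Linf \<Omega>. has_weak_pdiff \<Omega> j (\<lambda>x. tuple_dist (f x) P) v \<and> (\<forall>x. \<bar>v x\<bar> \<le> L)"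
    and Linf: "(\<lambda>x. tuple_dist (f x) P) \<in> Linf \<Omega>"
    if P: "P \<in> unordered_tuples Q" for j P
  proof -
    obtain u B \<epsilon> where u: "u \<in> borel_measurable borel" "\<And>x. \<bar>u x\<bar> \<le> B" "0 < \<epsilon>"
      "\<And>x. x \<in> \<Omega> \<Longrightarrow> u x = tuple_dist (f x) P"
      "\<And>j x h. x \<in> \<Omega> \<Longrightarrow> \<bar>h\<bar> < \<epsilon> \<Longrightarrow> \<bar>u (x + h *\<^sub>R axis j 1) - u x\<bar> \<le> L * \<bar>h\<bar>"
      using ext[OF P] by blast
    obtain v where v: "v \<in> Linf \<Omega>" "has_weak_pdiff \<Omega> j u v" "\<forall>x. \<bar>v x\<bar> \<le> L"
      using weak_pdiff_exists[OF \<Omega> u(1,2,3) L u(5), of j] by blast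
    then show "\<exists>v\<in>Linf \<Omega>. has_weak_pdiff \<Omega> j (\<lambda>x. tuple_dist (f x) P) v \<and> (\<forall>x. \<bar>v x\<bar> \<le> L)"
      using has_weak_pdiff_cong[OF u(4) v(2)] by blast
    have "u \<in> borel_measurable (lebesgue_on \<Omega>)"
      using u(1) by (intro measurable_restrict_space1 measurable_completion) simp
    then have "(\<lambda>x. tuple_dist (f x) P) \<in> borel_measurable (lebesgue_on \<Omega>)"
      by (rule measurable_cong[THEN iffD1, rotated]) (simp add: space_restrict_space u(4))
    then show "(\<lambda>x. tuple_dist (f x) P) \<in> Linf \<Omega>"
      by (rule Linf_bounded[of _ _ B]) (use u(2,4) in metis)
  qed
  have dom: "dominates_pdiff \<Omega> Q f j (\<lambda>_. L)" for j
    unfolding dominates_pdiff_def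
  proof (intro conjI ballI allI impI)
    show "(\<lambda>_. L) \<in> Linf \<Omega>" by (rule Linf_bounded[of _ _ L]) (use L in auto)
    fix P v assume P: "P \<in> unordered_tuples Q" and v: "has_weak_pdiff \<Omega> j (\<lambda>x. tuple_dist (f x) P) v"
    obtain w where w: "has_weak_pdiff \<Omega> j (\<lambda>x. tuple_dist (f x) P) w" "\<forall>x. \<bar>w x\<bar> \<le> L" using ex[OF P] by blast
    show "AE x in lebesgue_on \<Omega>. \<bar>v x\<bar> \<le> L"
      using weak_pdiff_unique[OF \<Omega>(1) v w(1)] by eventually_elim (use w(2) in simp)
  qed (rule L)
  \<comment> \<open>The choice in \<open>tuple_pdiff_norm\<close> is meaningful because a minimal
    dominating function exists.\<close>
  have min: "dominates_pdiff \<Omega> Q f j (tuple_pdiff_norm \<Omega> Q f j) \<and>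
      (\<forall>\<psi>. dominates_pdiff \<Omega> Q f j \<psi> \<longrightarrow> (AE x in lebesgue_on \<Omega>. tuple_pdiff_norm \<Omega> Q f j x \<le> \<psi> x))" for j
    unfolding tuple_pdiff_norm_def by (rule someI_ex[OF minimal_dominating_exists[OF \<Omega> dom]])
  have le: "AE x in lebesgue_on \<Omega>. tuple_pdiff_norm \<Omega> Q f j x \<le> L" for j using min dom by blast
  have nn: "0 \<le> tuple_pdiff_norm \<Omega> Q f j x" if "x \<in> \<Omega>" for j x
    using min[of j] that by (auto simp: dominates_pdiff_def)
  have meas: "tuple_pdiff_norm \<Omega> Q f j \<in> borel_measurable (lebesgue_on \<Omega>)" for j
    using min[of j] by (auto simp: dominates_pdiff_def Linf_def)
  have "f \<in> W1inf_tuples \<Omega> Q"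
    unfolding W1inf_tuples_def W1inf_def using f Linf ex dom by blast
  moreover have "Linf_norm \<Omega> (tuple_diff_norm \<Omega> Q f) \<le> ennreal (sqrt (real CARD('m)) * L)"
  proof (rule Linf_AE_boundedI)
    show "tuple_diff_norm \<Omega> Q f \<in> borel_measurable (lebesgue_on \<Omega>)"
      unfolding tuple_diff_norm_def[abs_def]
      using meas by measurable
    have "AE x in lebesgue_on \<Omega>. \<forall>j\<in>UNIV. tuple_pdiff_norm \<Omega> Q f j x \<le> L"
      by (rule AE_finite_allI) (use le in auto)
    then show "AE x in lebesgue_on \<Omega>. \<bar>tuple_diff_norm \<Omega> Q f x\<bar> \<le> sqrt (real CARD('m)) * L"
      using AE_space
    proof eventually_elim
      case (elim x)
      have "(\<Sum>j\<in>UNIV. (tuple_pdiff_norm \<Omega> Q f j x)\<^sup>2) \<le> (\<Sum>j\<in>(UNIV::'m set). L\<^sup>2)"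
        using elim nn by (intro sum_mono power_mono) (auto simp: space_restrict_space)
      then have "sqrt (\<Sum>j\<in>UNIV. (tuple_pdiff_norm \<Omega> Q f j x)\<^sup>2) \<le> sqrt (real CARD('m) * L\<^sup>2)"
        by (simp only: real_sqrt_le_iff sum_constant)
      then show ?case
        using L by (simp add: tuple_diff_norm_def real_sqrt_mult sum_nonneg)
    qed
  qed
  ultimately show ?thesis by blast
qed


section \<open>Maps into the orbit space\<close>

definition rep_group :: "('g, 'z) monoid_scheme \<Rightarrow> ('g \<Rightarrow> real^'n \<Rightarrow> real^'n) \<Rightarrow> (real^'n \<Rightarrow> real^'n) set" where
  "rep_group G \<rho> = \<rho> ` carrier G"

lemma rep_mult:
  assumes "finite_group_rep G \<rho>" "g \<in> carrier G" "h \<in> carrier G"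
  shows "\<rho> (g \<otimes>\<^bsub>G\<^esub> h) x = \<rho> g (\<rho> h x)"
proof -
  interpret group_action G UNIV \<rho> using assms(1) by (simp add: finite_group_rep_def)
  show ?thesis using composition_rule assms(2,3) by simp
qed

lemma rep_one:
  assumes "finite_group_rep G \<rho>"
  shows "\<rho> \<one>\<^bsub>G\<^esub> = id"
proof -
  interpret group_action G UNIV \<rho> using assms(1) by (simp add: finite_group_rep_def)
  show ?thesis using id_eq_one by (metis UNIV_I eq_id_iff restrict_apply)
qed

lemma rep_is_group:
  assumes "finite_group_rep G \<rho>"
  shows "Group.group G"
proof -
  interpret group_action G UNIV \<rho> using assms(1) by (simp add: finite_group_rep_def)
  show ?thesis using group_hom by (simp add: group_hom_def)
qed

lemma finite_linear_group_rep:
  assumes rep: "finite_group_rep G \<rho>"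
  shows "finite_linear_group (rep_group G \<rho>)"
proof -
  interpret Group.group G by (rule rep_is_group[OF rep])
  show ?thesis
  proof (rule finite_linear_group.intro)
    show "finite (rep_group G \<rho>)" using rep by (simp add: rep_group_def finite_group_rep_def)
    show "id \<in> rep_group G \<rho>" unfolding rep_group_def using rep_one[OF rep] one_closed by (metis imageI)
    show "linear g" if "g \<in> rep_group G \<rho>" for g
      using that rep by (auto simp: rep_group_def finite_group_rep_def)
    show "g \<circ> h \<in> rep_group G \<rho>" if gh: "g \<in> rep_group G \<rho>" "h \<in> rep_group G \<rho>" for g h
    proof -
      obtain a b where ab: "a \<in> carrier G" "g = \<rho> a" "b \<in> carrier G" "h = \<rho> b"
        using gh by (auto simp: rep_group_def)
      then have "g \<circ> h = \<rho> (a \<otimes>\<^bsub>G\<^esub> b)" using rep_mult[OF rep] by (simp add: fun_eq_iff)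
      then show ?thesis using ab by (simp add: rep_group_def)
    qed
    show "\<exists>h\<in>rep_group G \<rho>. h \<circ> g = id" if g: "g \<in> rep_group G \<rho>" for g
    proof -
      obtain a where a: "a \<in> carrier G" "g = \<rho> a" using g by (auto simp: rep_group_def)
      have "\<rho> (inv\<^bsub>G\<^esub> a) \<circ> g = \<rho> (inv\<^bsub>G\<^esub> a \<otimes>\<^bsub>G\<^esub> a)"
        using a rep_mult[OF rep, of "inv\<^bsub>G\<^esub> a" a] by (simp add: fun_eq_iff)
      also have "\<dots> = id" using a rep_one[OF rep] by simp
      finally show ?thesis using a by (intro bexI[of _ "\<rho> (inv\<^bsub>G\<^esub> a)"]) (auto simp: rep_group_def)
    qed
  qed
qed

lemma homogeneous_polynomial_scaleR:
  assumes "homogeneous_polynomial k p"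
  shows "p (c *\<^sub>R x) = c ^ k * p x"
proof -
  obtain a where a: "\<And>x. p x = (\<Sum>\<alpha> | sum \<alpha> UNIV = k. a \<alpha> * (\<Prod>i\<in>UNIV. x $ i ^ \<alpha> i))"
    using assms unfolding homogeneous_polynomial_def by blast
  have "(\<Prod>i\<in>UNIV. (c *\<^sub>R x) $ i ^ \<alpha> i) = c ^ k * (\<Prod>i\<in>UNIV. x $ i ^ \<alpha> i)"
    if "sum \<alpha> UNIV = k" for \<alpha>
    using that by (simp add: power_mult_distrib prod.distrib flip: power_sum)
  then show ?thesis unfolding a sum_distrib_left by (intro sum.cong) (auto simp: mult_ac)
qed

lemma generating_system_rep:
  assumes gen: "homogeneous_generators G \<rho> \<sigma> dg"
  shows "generating_system (rep_group G \<rho>) (Max (range dg)) (range (\<sigma> :: 'r::finite \<Rightarrow> _))"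
proof -
  have "\<exists>e\<le>Max (range dg). \<forall>c x. \<sigma> j (c *\<^sub>R x) = c ^ e * \<sigma> j x" for j
    using gen homogeneous_polynomial_scaleR[of "dg j" "\<sigma> j"]
    by (intro exI[of _ "dg j"]) (auto simp: homogeneous_generators_def)
  moreover have "algebra_generated (range \<sigma>) = invariants (rep_group G \<rho>)"
    using gen by (auto simp: homogeneous_generators_def invariants_def invariant_polynomials_def rep_group_def)
  ultimately show ?thesis by (auto simp: generating_system_def)
qed

text \<open>Right multiplication by \<open>a\<close> permutes the group, so the points h (g q) form
  the orbit of \<open>q\<close> in another order. Pairing h p with h (g q) is an admissible
  matching, whose cost is at most the sum of the operator norms times the distance of
  \<open>p\<close> and \<open>g q\<close>.\<close>

lemma tuple_dist_orbit_le:
  assumes rep: "finite_group_rep G \<rho>"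
  shows "\<exists>K\<ge>0. \<forall>p q. \<forall>g\<in>rep_group G \<rho>. tuple_dist (orbit_tuple G \<rho> p) (orbit_tuple G \<rho> q) \<le> K * norm (p - g q)"
proof -
  interpret Group.group G by (rule rep_is_group[OF rep])
  have fin: "finite (carrier G)" using rep by (simp add: finite_group_rep_def)
  obtain hs where hs: "mset hs = mset_set (carrier G)" using ex_mset by blast
  have hs_in: "hs ! i \<in> carrier G" if "i < length hs" for i
    using nth_mem_mset[OF that] hs fin by simp
  have lin: "linear (\<rho> h)" if "h \<in> carrier G" for h using rep that by (simp add: finite_group_rep_def)
  define K where "K = (\<Sum>i<length hs. onorm (\<rho> (hs ! i)))"
  have on: "0 \<le> onorm (\<rho> (hs ! i))" if "i < length hs" for i
    using lin[OF hs_in[OF that]] by (simp add: onorm_pos_le linear_conv_bounded_linear)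
  show ?thesis
  proof (intro exI[of _ K] conjI allI ballI)
    show "0 \<le> K" unfolding K_def using on by (intro sum_nonneg) auto
    fix p q g assume "g \<in> rep_group G \<rho>"
    then obtain a where a: "a \<in> carrier G" "g = \<rho> a" by (auto simp: rep_group_def)
    define xs where "xs = map (\<lambda>h. \<rho> h p) hs"
    define ys where "ys = map (\<lambda>h. \<rho> h (g q)) hs"
    have xs: "mset xs = orbit_tuple G \<rho> p" by (simp add: xs_def orbit_tuple_def hs)
    have "mset ys = image_mset (\<lambda>h. \<rho> (h \<otimes>\<^bsub>G\<^esub> a) q) (mset_set (carrier G))"
      unfolding ys_def mset_map hs using a fin
      by (intro image_mset_cong) (simp add: rep_mult[OF rep])
    also have "\<dots> = image_mset (\<lambda>h. \<rho> h q) (image_mset (\<lambda>h. h \<otimes>\<^bsub>G\<^esub> a) (mset_set (carrier G)))"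
      by (simp add: image_mset.compositionality o_def)
    also have "image_mset (\<lambda>h. h \<otimes>\<^bsub>G\<^esub> a) (mset_set (carrier G)) = mset_set (carrier G)"
    proof -
      have "(\<lambda>h. h \<otimes>\<^bsub>G\<^esub> a) ` carrier G = carrier G"
        using a by (intro endo_inj_surj[OF fin _ inj_on_multc[OF a(1)]]) auto
      then show ?thesis using image_mset_mset_set[OF inj_on_multc[OF a(1)]] by simp
    qed
    finally have ys: "mset ys = orbit_tuple G \<rho> q" by (simp add: orbit_tuple_def)
    have len: "size (orbit_tuple G \<rho> p) = length hs" "size (orbit_tuple G \<rho> p) = size (orbit_tuple G \<rho> q)"
      by (simp_all add: orbit_tuple_def flip: hs)
    have "tuple_dist (orbit_tuple G \<rho> p) (orbit_tuple G \<rho> q) \<le> L2_set (\<lambda>i. norm (xs ! i - ys ! i)) {..<length hs}"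
      using tuple_dist_le[OF xs ys len(2)] len(1) by simp
    also have "\<dots> \<le> (\<Sum>i<length hs. norm (xs ! i - ys ! i))" by (rule L2_set_le_sum) simp
    also have "\<dots> \<le> (\<Sum>i<length hs. onorm (\<rho> (hs ! i)) * norm (p - g q))"
    proof (rule sum_mono)
      fix i assume i: "i \<in> {..<length hs}"
      then have l: "linear (\<rho> (hs ! i))" using lin hs_in by simp
      have "xs ! i - ys ! i = \<rho> (hs ! i) (p - g q)" using i by (simp add: xs_def ys_def linear_diff[OF l])
      then show "norm (xs ! i - ys ! i) \<le> onorm (\<rho> (hs ! i)) * norm (p - g q)"
        using onorm[of "\<rho> (hs ! i)" "p - g q"] l by (simp add: linear_conv_bounded_linear)
    qed
    finally show "tuple_dist (orbit_tuple G \<rho> p) (orbit_tuple G \<rho> q) \<le> K * norm (p - g q)"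
      by (simp add: K_def sum_distrib_right)
  qed
qed

text \<open>Each derivative in the parameter is a repeated derivative in the direction
  \<open>i\<close> times a power of \<open>\<delta> \<le> 1\<close>, so \<open>N\<close> is
  kept.\<close>

lemma ck1_axis_segment:
  fixes F :: "real^'m \<Rightarrow> real"
  assumes F: "Ck_on k \<Omega> F" and cball: "cball x \<delta> \<subseteq> \<Omega>" and \<delta>: "0 < \<delta>" "\<delta> \<le> 1"
    and bound: "\<And>is y. length is \<le> k \<Longrightarrow> y \<in> \<Omega> \<Longrightarrow> \<bar>pdiffs is F y\<bar> \<le> N"
    and lip: "\<And>is. length is = k \<Longrightarrow> N-lipschitz_on \<Omega> (pdiffs is F)"
  shows "ck1 k N (\<lambda>t. F (x + (\<delta> * t) *\<^sub>R axis i 1))"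
proof -
  define y where "y t = x + (\<delta> * t) *\<^sub>R (axis i 1 :: real^'m)" for t
  have y: "y t \<in> \<Omega>" if "t \<in> unit_interval" for t
  proof -
    have "\<bar>\<delta> * t\<bar> \<le> \<delta> * 1" unfolding abs_mult using \<delta> that by (intro mult_mono) auto
    then have "y t \<in> cball x \<delta>" by (simp add: y_def dist_norm)
    then show ?thesis using cball by blast
  qed
  define U where "U l t = \<delta> ^ l * pdiffs (replicate l i) F (y t)" for l t
  have N: "0 \<le> N" using lipschitz_on_nonneg[OF lip[of "replicate k i"]] by simp
  have "ck1 k N (U 0)"
  proof (rule derivatives_bounded_imp_ck1)
    show "\<forall>l<k. \<forall>t\<in>unit_interval. (U l has_real_derivative U (Suc l) t) (at t)"
    proof (intro allI impI ballI)
      fix l t assume l: "l < k" and t: "t \<in> unit_interval"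
      have "((\<lambda>s. pdiffs (replicate l i) F (y t + s *\<^sub>R axis i 1)) has_real_derivative
          pdiff i (pdiffs (replicate l i) F) (y t)) (at 0)"
        using F l y[OF t] by (intro has_derivative_pdiff) (simp add: Ck_on_def del: foldr_replicate)
      then have "((\<lambda>s. pdiffs (replicate l i) F (y t + (\<delta> * (s - t)) *\<^sub>R axis i 1)) has_real_derivative
          pdiff i (pdiffs (replicate l i) F) (y t) * \<delta>) (at t)"
        by (intro DERIV_chain2[of "\<lambda>s. pdiffs (replicate l i) F (y t + s *\<^sub>R axis i 1)" _ "\<lambda>s. \<delta> * (s - t)"])
          (auto intro!: derivative_eq_intros)
      moreover have "y t + (\<delta> * (s - t)) *\<^sub>R axis i 1 = y s" for s
        by (simp add: y_def algebra_simps)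
      ultimately have "((\<lambda>s. pdiffs (replicate l i) F (y s)) has_real_derivative
          pdiff i (pdiffs (replicate l i) F) (y t) * \<delta>) (at t)" by simp
      from DERIV_cmult[OF this, of "\<delta> ^ l"] show "(U l has_real_derivative U (Suc l) t) (at t)"
        by (simp add: U_def[abs_def] mult_ac)
    qed
    show "\<forall>l\<le>k. \<forall>t\<in>unit_interval. \<bar>U l t\<bar> \<le> N"
    proof (intro allI impI ballI)
      fix l t assume "l \<le> k" "t \<in> unit_interval"
      then have "\<bar>pdiffs (replicate l i) F (y t)\<bar> \<le> N"
        using bound[of "replicate l i" "y t"] y by (simp del: foldr_replicate)
      moreover have "\<delta> ^ l \<le> 1" using \<delta> by (simp add: power_le_one)
      ultimately have "\<bar>\<delta> ^ l\<bar> * \<bar>pdiffs (replicate l i) F (y t)\<bar> \<le> 1 * N"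
        using \<delta> by (intro mult_mono) auto
      then show "\<bar>U l t\<bar> \<le> N" by (simp only: U_def abs_mult mult_1)
    qed
    show "\<forall>s\<in>unit_interval. \<forall>t\<in>unit_interval. \<bar>U k s - U k t\<bar> \<le> N * \<bar>s - t\<bar>"
    proof (intro ballI)
      fix s t assume st: "s \<in> unit_interval" "t \<in> unit_interval"
      have "y s - y t = (\<delta> * (s - t)) *\<^sub>R axis i 1" by (simp add: y_def algebra_simps)
      then have "dist (y s) (y t) = \<delta> * \<bar>s - t\<bar>" using \<delta> by (simp add: dist_norm abs_mult)
      moreover have "\<bar>pdiffs (replicate k i) F (y s) - pdiffs (replicate k i) F (y t)\<bar> \<le> N * dist (y s) (y t)"
        using lipschitz_onD[OF lip[of "replicate k i"] y[OF st(1)] y[OF st(2)]] by (simp add: dist_real_def)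
      ultimately have 1: "\<bar>pdiffs (replicate k i) F (y s) - pdiffs (replicate k i) F (y t)\<bar> \<le> N * (\<delta> * \<bar>s - t\<bar>)"
        by simp
      have "\<bar>U k s - U k t\<bar> = \<bar>\<delta> ^ k\<bar> * \<bar>pdiffs (replicate k i) F (y s) - pdiffs (replicate k i) F (y t)\<bar>"
        unfolding U_def by (simp only: abs_mult flip: right_diff_distrib)
      also have "\<dots> \<le> 1 * (N * (1 * \<bar>s - t\<bar>))"
        using \<delta> N by (intro mult_mono order_trans[OF 1]) (auto simp: power_le_one intro!: mult_left_mono mult_right_mono mult_left_le_one_le)
      finally show "\<bar>U k s - U k t\<bar> \<le> N * \<bar>s - t\<bar>" by simp
    qed
  qed
  then show ?thesis by (simp add: U_def[abs_def] y_def)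
qed

text \<open>For two fixed points the difference quotient is a lower bound of all admissible
  constants, hence at most their infimum.\<close>

lemma Lip_const_lipschitz:
  assumes "L-lipschitz_on \<Omega> f"
  shows "(Lip_const \<Omega> f)-lipschitz_on \<Omega> f"
proof (rule lipschitz_onI)
  have ne: "{L. L-lipschitz_on \<Omega> f} \<noteq> {}" using assms by blast
  show "0 \<le> Lip_const \<Omega> f" unfolding Lip_const_def
    by (rule cInf_greatest[OF ne]) (use lipschitz_on_nonneg in blast)
  fix x y assume xy: "x \<in> \<Omega>" "y \<in> \<Omega>"
  show "dist (f x) (f y) \<le> Lip_const \<Omega> f * dist x y"
  proof (cases "x = y")
    case False
    then have d: "0 < dist x y" by simp
    have "dist (f x) (f y) / dist x y \<le> Lip_const \<Omega> f" unfolding Lip_const_def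
    proof (rule cInf_greatest[OF ne])
      fix M assume "M \<in> {L. L-lipschitz_on \<Omega> f}"
      then show "dist (f x) (f y) / dist x y \<le> M"
        using lipschitz_onD xy d by (simp add: pos_divide_le_eq)
    qed
    then show ?thesis using d by (simp add: pos_divide_le_eq)
  qed simp
qed

text \<open>The real suprema are meaningful because the derivatives extend continuously to the
  compact closure. Both maxima are nonnegative, so their sum dominates each of them.\<close>

lemma Ck1_norm_bounds:
  fixes F :: "real^'m \<Rightarrow> real"
  assumes F: "Ck1_closure k \<Omega> F" and \<Omega>: "bounded \<Omega>" "\<Omega> \<noteq> {}"
  shows "length is \<le> k \<Longrightarrow> y \<in> \<Omega> \<Longrightarrow> \<bar>pdiffs is F y\<bar> \<le> Ck1_norm k \<Omega> F"
    and "length is = k \<Longrightarrow> (Ck1_norm k \<Omega> F)-lipschitz_on \<Omega> (pdiffs is F)"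
proof -
  define A where "A = Max ((\<lambda>is. SUP x\<in>\<Omega>. \<bar>pdiffs is F x\<bar>) ` {is. length is \<le> k})"
  define B where "B = Max ((\<lambda>is. Lip_const \<Omega> (pdiffs is F)) ` {is. length is = k})"
  have norm: "Ck1_norm k \<Omega> F = A + B" by (simp add: Ck1_norm_def A_def B_def)
  have fin: "finite {is :: 'm list. length is \<le> k}" "finite {is :: 'm list. length is = k}"
    using finite_lists_length_le[of "UNIV :: 'm set" k] finite_lists_length_eq[of "UNIV :: 'm set" k] by simp_all
  have bdd: "bdd_above ((\<lambda>x. \<bar>pdiffs is F x\<bar>) ` \<Omega>)" if len: "length is \<le> k" for "is"
  proof -
    obtain h where h: "continuous_on (closure \<Omega>) h" "\<forall>x\<in>\<Omega>. h x = pdiffs is F x"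
      using F len unfolding Ck1_closure_def by blast
    have "compact (h ` closure \<Omega>)"
      using h(1) \<Omega>(1) by (intro compact_continuous_image) (auto simp: compact_closure)
    then obtain b where "\<forall>x\<in>closure \<Omega>. \<bar>h x\<bar> \<le> b" using compact_imp_bounded by (fastforce simp: bounded_iff)
    then show ?thesis using h(2) closure_subset[of \<Omega>] by (intro bdd_aboveI2[of _ _ b]) force
  qed
  have A: "\<bar>pdiffs is F x\<bar> \<le> A" if len: "length is \<le> k" and x: "x \<in> \<Omega>" for "is" x
  proof -
    have "\<bar>pdiffs is F x\<bar> \<le> (SUP x\<in>\<Omega>. \<bar>pdiffs is F x\<bar>)" by (rule cSUP_upper[OF x bdd[OF len]])
    also have "\<dots> \<le> A" unfolding A_def using fin(1) len by (intro Max_ge) auto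
    finally show ?thesis .
  qed
  have lip: "(Lip_const \<Omega> (pdiffs is F))-lipschitz_on \<Omega> (pdiffs is F)" if "length is = k" for "is"
  proof -
    have "length is \<le> k" using that by simp
    then obtain L where "L-lipschitz_on \<Omega> (pdiffs is F)" using F unfolding Ck1_closure_def by blast
    then show ?thesis by (rule Lip_const_lipschitz)
  qed
  have LB: "Lip_const \<Omega> (pdiffs is F) \<le> B" if "length is = k" for "is"
    unfolding B_def using fin(2) that by (intro Max_ge) auto
  have B0: "0 \<le> B"
    using LB[of "replicate k undefined"] lipschitz_on_nonneg[OF lip[of "replicate k undefined"]] by simp
  obtain x0 where "x0 \<in> \<Omega>" using \<Omega>(2) by blast
  then have A0: "0 \<le> A" using A[of "[]" x0] by simp
  show "length is \<le> k \<Longrightarrow> y \<in> \<Omega> \<Longrightarrow> \<bar>pdiffs is F y\<bar> \<le> Ck1_norm k \<Omega> F"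
    using A[of "is" y] B0 unfolding norm by linarith
  show "(Ck1_norm k \<Omega> F)-lipschitz_on \<Omega> (pdiffs is F)" if "length is = k"
    by (rule lipschitz_on_mono[OF lip[OF that]]) (use LB[OF that] A0 in \<open>auto simp: norm\<close>)
qed

text \<open>Increments are controlled only from the point \<open>t\<close> itself, within a radius
  depending on \<open>t\<close>. For an interval around \<open>t\<close> the increments on both
  sides add up, and bisection extends this additive estimate to the whole interval.\<close>

lemma locally_lipschitz_imp_lipschitz:
  fixes w :: "real \<Rightarrow> real"
  assumes "a \<le> b" and loc: "\<And>t. t \<in> {a..b} \<Longrightarrow> \<exists>\<delta>>0. \<forall>s\<in>{a..b}. \<bar>s - t\<bar> < \<delta> \<longrightarrow> \<bar>w s - w t\<bar> \<le> L * \<bar>s - t\<bar>"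
  shows "\<bar>w b - w a\<bar> \<le> L * (b - a)"
proof -
  have "a \<le> a \<longrightarrow> b \<le> b \<longrightarrow> \<bar>w b - w a\<bar> \<le> L * (b - a)"
  proof (rule Bolzano[OF \<open>a \<le> b\<close>, where P = "\<lambda>s t. a \<le> s \<longrightarrow> t \<le> b \<longrightarrow> \<bar>w t - w s\<bar> \<le> L * (t - s)"])
    fix r s t assume "a \<le> r \<longrightarrow> s \<le> b \<longrightarrow> \<bar>w s - w r\<bar> \<le> L * (s - r)"
      "a \<le> s \<longrightarrow> t \<le> b \<longrightarrow> \<bar>w t - w s\<bar> \<le> L * (t - s)" "r \<le> s" "s \<le> t"
    then show "a \<le> r \<longrightarrow> t \<le> b \<longrightarrow> \<bar>w t - w r\<bar> \<le> L * (t - r)"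
      by (auto simp: right_diff_distrib abs_le_iff)
  next
    fix x assume x: "a \<le> x" "x \<le> b"
    then obtain \<delta> where \<delta>: "0 < \<delta>" "\<And>s. s \<in> {a..b} \<Longrightarrow> \<bar>s - x\<bar> < \<delta> \<Longrightarrow> \<bar>w s - w x\<bar> \<le> L * \<bar>s - x\<bar>"
      using loc[of x] by auto
    have "\<bar>w t - w s\<bar> \<le> L * (t - s)"
      if st: "s \<le> x" "x \<le> t" "t - s < \<delta>" "a \<le> s" "t \<le> b" for s t
    proof -
      have "\<bar>w s - w x\<bar> \<le> L * (x - s)" using \<delta>(2)[of s] st x by simp
      moreover have "\<bar>w t - w x\<bar> \<le> L * (t - x)" using \<delta>(2)[of t] st x by simp
      ultimately show ?thesis by (auto simp: right_diff_distrib abs_le_iff)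
    qed
    then show "\<exists>d>0. \<forall>s t. s \<le> x \<and> x \<le> t \<and> t - s < d \<longrightarrow> a \<le> s \<longrightarrow> t \<le> b \<longrightarrow> \<bar>w t - w s\<bar> \<le> L * (t - s)"
      using \<delta>(1) by blast
  qed
  then show ?thesis by simp
qed

text \<open>Let \<open>A\<close> be the factor 1 + max in the claim. Dividing the lift by
  \<open>A\<close> divides the invariant of degree \<open>dg j\<close> by \<open>A ^ dg j\<close>,
  which is at least its norm; so all invariants have bound 1, and the constant of
  \<open>lifts_lipschitz\<close> for \<open>M = 1\<close> serves every \<open>f\<close>. Scaling
  back multiplies by \<open>A\<close>, whence the exponents 1 / \<open>dg j\<close>.\<close>

lemma orbit_tuples_axis_lipschitz:
  fixes \<sigma> :: "'r::finite \<Rightarrow> real^'n \<Rightarrow> real" and \<Omega> :: "(real^'m) set"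
  assumes rep: "finite_group_rep G \<rho>" and gen: "homogeneous_generators G \<rho> \<sigma> dg"
    and d: "d = Max (range dg)" and \<Omega>: "bounded \<Omega>" and \<delta>: "0 < \<delta>" "\<delta> \<le> 1"
  shows "\<exists>L\<ge>0. \<forall>f x i. (\<forall>y\<in>\<Omega>. f y \<in> orbit_tuples G \<rho>) \<longrightarrow>
    (\<forall>j. Ck1_closure (d - 1) \<Omega> (\<lambda>x. induced_map G \<rho> \<sigma> j (f x))) \<longrightarrow> cball x \<delta> \<subseteq> \<Omega> \<longrightarrow>
    (\<exists>\<epsilon>>0. \<forall>h. \<bar>h\<bar> < \<epsilon> \<longrightarrow> tuple_dist (f x) (f (x + h *\<^sub>R axis i 1)) \<le>
      L * (1 + Max (range (\<lambda>j. Ck1_norm (d - 1) \<Omega> (\<lambda>x. induced_map G \<rho> \<sigma> j (f x)) powr (1 / real (dg j))))) * \<bar>h\<bar>)"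
proof -
  have dg: "1 \<le> dg j" "dg j \<le> d" for j using gen d by (auto simp: homogeneous_generators_def)
  have d1: "Suc (d - 1) = d" using dg[of undefined] by simp
  have lin: "finite_linear_group (rep_group G \<rho>)" by (rule finite_linear_group_rep[OF rep])
  interpret finite_linear_group "rep_group G \<rho>" by (rule lin)
  have "generating_system (rep_group G \<rho>) (Suc (d - 1)) (range \<sigma>)"
    unfolding d1 unfolding d by (rule generating_system_rep[OF gen])
  then have "lifts_lipschitz (d - 1) (rep_group G \<rho>) (range \<sigma>)"
    by (rule lifts_lipschitz_of_generating_system[OF lin])
  then obtain C where C0: "\<forall>p. (\<forall>\<tau>\<in>range \<sigma>. ck1 (d - 1) 1 (\<lambda>t. \<tau> (p t))) \<longrightarrow>
    (\<exists>\<epsilon>>0. \<forall>t. \<bar>t\<bar> < \<epsilon> \<longrightarrow> (\<exists>g\<in>rep_group G \<rho>. norm (p 0 - g (p t)) \<le> C * \<bar>t\<bar>))"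
    unfolding lifts_lipschitz_def by blast
  have C: "\<exists>\<epsilon>>0. \<forall>t. \<bar>t\<bar> < \<epsilon> \<longrightarrow> (\<exists>g\<in>rep_group G \<rho>. norm (p 0 - g (p t)) \<le> C * \<bar>t\<bar>)"
    if "\<And>j. ck1 (d - 1) 1 (\<lambda>t. \<sigma> j (p t))" for p
    by (rule spec[OF C0, THEN mp]) (use that in blast)
  obtain K where K: "0 \<le> K" "\<And>p q g. g \<in> rep_group G \<rho> \<Longrightarrow>
      tuple_dist (orbit_tuple G \<rho> p) (orbit_tuple G \<rho> q) \<le> K * norm (p - g q)"
    using tuple_dist_orbit_le[OF rep] by blast
  show ?thesis
  proof (rule exI[of _ "K * \<bar>C\<bar> / \<delta>"], intro conjI allI impI)
    \<comment> \<open>\<open>K\<close> compares orbit distances with norms, and 1 /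
      \<open>\<delta>\<close> comes from parametrising a segment of radius \<open>\<delta>\<close>
      by the unit interval. The absolute value guards against a negative \<open>C\<close>.\<close>
    show "0 \<le> K * \<bar>C\<bar> / \<delta>" using K(1) \<delta> by simp
    fix f :: "real^'m \<Rightarrow> (real^'n) multiset" and x i
    assume f: "\<forall>y\<in>\<Omega>. f y \<in> orbit_tuples G \<rho>"
      and F: "\<forall>j. Ck1_closure (d - 1) \<Omega> (\<lambda>x. induced_map G \<rho> \<sigma> j (f x))"
      and cb: "cball x \<delta> \<subseteq> \<Omega>"
    define N where "N j = Ck1_norm (d - 1) \<Omega> (\<lambda>x. induced_map G \<rho> \<sigma> j (f x))" for j
    define A where "A = 1 + Max (range (\<lambda>j. N j powr (1 / real (dg j))))"
    have x: "x \<in> \<Omega>" using cb \<delta> by auto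
    then have ne: "\<Omega> \<noteq> {}" by blast
    note Nb = Ck1_norm_bounds[OF F[rule_format] \<Omega> ne, folded N_def]
    have A_ge: "N j powr (1 / real (dg j)) \<le> A" for j
    proof -
      have "N j powr (1 / real (dg j)) \<le> Max (range (\<lambda>j. N j powr (1 / real (dg j))))" by (intro Max_ge) auto
      then show ?thesis unfolding A_def by linarith
    qed
    have A1: "1 \<le> A"
    proof -
      have "0 \<le> N undefined powr (1 / real (dg undefined))" by simp
      also have "\<dots> \<le> Max (range (\<lambda>j. N j powr (1 / real (dg j))))" by (intro Max_ge) auto
      finally show ?thesis by (simp add: A_def)
    qed
    have N0: "0 \<le> N j" for j using Nb(1)[of "[]" x j] x by simp
    have NA: "N j \<le> A ^ dg j" for j
    proof -
      have "N j = (N j powr (1 / real (dg j))) ^ dg j"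
        using N0[of j] dg(1)[of j] by (cases "N j = 0") (simp_all add: powr_powr flip: powr_realpow')
      also have "\<dots> \<le> A ^ dg j" using A_ge by (intro power_mono) auto
      finally show ?thesis .
    qed
    \<comment> \<open>An arbitrary choice of lifts; nothing relates the choices at different
      points.\<close>
    have "\<forall>y. \<exists>p. y \<in> \<Omega> \<longrightarrow> f y = orbit_tuple G \<rho> p" using f by (auto simp: orbit_tuples_def)
    then obtain p where p: "\<And>y. y \<in> \<Omega> \<Longrightarrow> f y = orbit_tuple G \<rho> (p y)" by metis
    have \<sigma>p: "\<sigma> j (p y) = induced_map G \<rho> \<sigma> j (f y)" if "y \<in> \<Omega>" for j y
      using induced_map_orbit_tuple[OF rep gen] p[OF that] by simp
    define y where "y t = x + (\<delta> * t) *\<^sub>R (axis i 1 :: real^'m)" for t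
    have y: "y t \<in> \<Omega>" if "t \<in> unit_interval" for t
    proof -
      have "\<bar>\<delta> * t\<bar> \<le> \<delta> * 1" unfolding abs_mult using \<delta> that by (intro mult_mono) auto
      then have "y t \<in> cball x \<delta>" by (simp add: y_def dist_norm)
      then show ?thesis using cb by blast
    qed
    define q where "q t = (1 / A) *\<^sub>R p (y t)" for t
    have q: "ck1 (d - 1) 1 (\<lambda>t. \<sigma> j (q t))" for j
    proof -
      have "ck1 (d - 1) (N j) (\<lambda>t. induced_map G \<rho> \<sigma> j (f (y t)))"
        unfolding y_def
      proof (rule ck1_axis_segment[where F = "\<lambda>x. induced_map G \<rho> \<sigma> j (f x)", OF _ cb \<delta>])
        show "Ck_on (d - 1) \<Omega> (\<lambda>x. induced_map G \<rho> \<sigma> j (f x))" using F by (simp add: Ck1_closure_def)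
      qed (fact Nb)+
      then have "ck1 (d - 1) (\<bar>(1 / A) ^ dg j\<bar> * N j) (\<lambda>t. (1 / A) ^ dg j * induced_map G \<rho> \<sigma> j (f (y t)))"
        by (rule ck1_cmult)
      moreover have "\<bar>(1 / A) ^ dg j\<bar> * N j \<le> 1"
        using NA[of j] A1 by (simp add: power_divide pos_divide_le_eq)
      ultimately have "ck1 (d - 1) 1 (\<lambda>t. (1 / A) ^ dg j * induced_map G \<rho> \<sigma> j (f (y t)))" by (rule ck1_mono)
      then show ?thesis
      proof (rule ck1_cong)
        fix t assume "t \<in> unit_interval"
        then show "(1 / A) ^ dg j * induced_map G \<rho> \<sigma> j (f (y t)) = \<sigma> j (q t)"
          using gen homogeneous_polynomial_scaleR[of "dg j" "\<sigma> j"] \<sigma>p[OF y]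
          by (simp add: q_def homogeneous_generators_def)
      qed
    qed
    obtain \<epsilon> where \<epsilon>: "0 < \<epsilon>" "\<And>t. \<bar>t\<bar> < \<epsilon> \<Longrightarrow> \<exists>g\<in>rep_group G \<rho>. norm (q 0 - g (q t)) \<le> C * \<bar>t\<bar>"
      using C[OF q] by blast
    have "tuple_dist (f x) (f (x + h *\<^sub>R axis i 1)) \<le> K * \<bar>C\<bar> / \<delta> * A * \<bar>h\<bar>" if h: "\<bar>h\<bar> < \<delta> * min 1 \<epsilon>" for h
    proof -
      define t where "t = h / \<delta>"
      have "\<bar>t\<bar> < min 1 \<epsilon>" using h \<delta>(1) unfolding t_def abs_divide
        by (simp only: pos_divide_less_eq abs_of_pos mult.commute)
      then have t: "t \<in> unit_interval" "\<bar>t\<bar> < \<epsilon>" by (auto simp: abs_less_iff)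
      have h': "\<delta> * t = h" using \<delta>(1) by (simp add: t_def)
      obtain g where g: "g \<in> rep_group G \<rho>" "norm (q 0 - g (q t)) \<le> C * \<bar>t\<bar>" using \<epsilon>(2)[OF t(2)] by blast
      have "q 0 - g (q t) = (1 / A) *\<^sub>R (p (y 0) - g (p (y t)))"
        by (simp add: q_def linear_scale[OF linear_G[OF g(1)]] scaleR_diff_right)
      then have "norm (p (y 0) - g (p (y t))) = A * norm (q 0 - g (q t))" using A1 by simp
      also have "\<dots> \<le> A * (C * \<bar>t\<bar>)" using g(2) A1 by (intro mult_left_mono) auto
      also have "\<dots> \<le> A * (\<bar>C\<bar> * \<bar>t\<bar>)" using A1 by (intro mult_left_mono mult_right_mono) auto
      finally have n: "norm (p (y 0) - g (p (y t))) \<le> A * (\<bar>C\<bar> * \<bar>t\<bar>)" .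
      have "tuple_dist (f x) (f (x + h *\<^sub>R axis i 1)) = tuple_dist (f (y 0)) (f (y t))"
        by (simp add: y_def h')
      also have "\<dots> \<le> K * norm (p (y 0) - g (p (y t)))"
        using K(2)[OF g(1)] p[OF y[of 0]] p[OF y[OF t(1)]] by simp
      also have "\<dots> \<le> K * (A * (\<bar>C\<bar> * \<bar>t\<bar>))" by (rule mult_left_mono[OF n K(1)])
      also have "\<dots> = K * \<bar>C\<bar> / \<delta> * A * \<bar>h\<bar>" using \<delta>(1) by (simp add: t_def abs_divide)
      finally show ?thesis .
    qed
    then show "\<exists>\<epsilon>>0. \<forall>h. \<bar>h\<bar> < \<epsilon> \<longrightarrow> tuple_dist (f x) (f (x + h *\<^sub>R axis i 1)) \<le>
      K * \<bar>C\<bar> / \<delta> * (1 + Max (range (\<lambda>j. Ck1_norm (d - 1) \<Omega> (\<lambda>x. induced_map G \<rho> \<sigma> j (f x)) powr (1 / real (dg j))))) * \<bar>h\<bar>"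
      using \<epsilon>(1) \<delta>(1) unfolding A_def N_def by (intro exI[of _ "\<delta> * min 1 \<epsilon>"]) simp
  qed
qed

text \<open>The segment is parametrised over [0, 1], which treats both signs of \<open>k\<close>
  alike. The local hypothesis is relative to \<open>S\<close> because it will be applied to a
  function that is cut off outside \<open>S\<close> and may jump at its boundary.\<close>

lemma axis_segment_lipschitz:
  fixes u :: "real^'m \<Rightarrow> real"
  assumes loc: "\<And>y. y \<in> S \<Longrightarrow> \<exists>\<epsilon>>0. \<forall>h. \<bar>h\<bar> < \<epsilon> \<longrightarrow> y + h *\<^sub>R axis i 1 \<in> S \<longrightarrow> \<bar>u (y + h *\<^sub>R axis i 1) - u y\<bar> \<le> L * \<bar>h\<bar>"
    and seg: "\<And>h. \<bar>h\<bar> \<le> \<bar>k\<bar> \<Longrightarrow> x + h *\<^sub>R axis i 1 \<in> S"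
  shows "\<bar>u (x + k *\<^sub>R axis i 1) - u x\<bar> \<le> L * \<bar>k\<bar>"
proof -
  define w where "w t = u (x + (t * k) *\<^sub>R axis i 1)" for t
  have "\<bar>w 1 - w 0\<bar> \<le> L * \<bar>k\<bar> * (1 - 0)"
  proof (rule locally_lipschitz_imp_lipschitz)
    fix t :: real assume t: "t \<in> {0..1}"
    have inS: "x + (s * k) *\<^sub>R axis i 1 \<in> S" if "s \<in> {0..1}" for s
      using that by (intro seg) (auto simp: abs_mult mult_left_le_one_le)
    obtain \<epsilon> where \<epsilon>: "0 < \<epsilon>" "\<And>h. \<bar>h\<bar> < \<epsilon> \<Longrightarrow> x + (t * k) *\<^sub>R axis i 1 + h *\<^sub>R axis i 1 \<in> S \<Longrightarrow>
        \<bar>u (x + (t * k) *\<^sub>R axis i 1 + h *\<^sub>R axis i 1) - u (x + (t * k) *\<^sub>R axis i 1)\<bar> \<le> L * \<bar>h\<bar>"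
      using loc[OF inS[OF t]] by blast
    show "\<exists>\<delta>>0. \<forall>s\<in>{0..1}. \<bar>s - t\<bar> < \<delta> \<longrightarrow> \<bar>w s - w t\<bar> \<le> L * \<bar>k\<bar> * \<bar>s - t\<bar>"
    proof (rule exI[of _ "\<epsilon> / (\<bar>k\<bar> + 1)"], intro conjI ballI impI)
      show "0 < \<epsilon> / (\<bar>k\<bar> + 1)" using \<epsilon>(1) by simp
      fix s :: real assume s: "s \<in> {0..1}" "\<bar>s - t\<bar> < \<epsilon> / (\<bar>k\<bar> + 1)"
      have eq: "x + (t * k) *\<^sub>R axis i 1 + ((s - t) * k) *\<^sub>R axis i 1 = x + (s * k) *\<^sub>R axis i 1"
        by (simp add: algebra_simps)
      have "\<bar>(s - t) * k\<bar> \<le> \<bar>s - t\<bar> * (\<bar>k\<bar> + 1)" unfolding abs_mult by (intro mult_left_mono) auto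
      also have "\<dots> < \<epsilon>" using s(2) by (simp add: pos_less_divide_eq)
      finally have "\<bar>(s - t) * k\<bar> < \<epsilon>" .
      from \<epsilon>(2)[OF this] show "\<bar>w s - w t\<bar> \<le> L * \<bar>k\<bar> * \<bar>s - t\<bar>"
        unfolding eq using inS[OF s(1)] by (simp add: w_def abs_mult mult_ac)
    qed
  qed simp
  then show ?thesis by (simp add: w_def)
qed

theorem theorem10p3:
  fixes G :: "('g, 'z) monoid_scheme"
    and \<rho> :: "'g \<Rightarrow> real^'n \<Rightarrow> real^'n"
    and \<sigma> :: "'r::finite \<Rightarrow> real^'n \<Rightarrow> real"
    and dg :: "'r \<Rightarrow> nat" and d :: nat
    and \<Omega> \<Omega>' :: "(real^'m) set"
  assumes "finite_group_rep G \<rho>"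
    and "homogeneous_generators G \<rho> \<sigma> dg"
    and "d = Max (range dg)"
    and "open \<Omega>" and "bounded \<Omega>"
    and "open \<Omega>'" and "compact (closure \<Omega>')" and "closure \<Omega>' \<subseteq> \<Omega>"
  shows "\<exists>C>0. \<forall>f :: real^'m \<Rightarrow> (real^'n) multiset.
    continuous_map (top_of_set \<Omega>) (Metric_space.mtopology (orbit_tuples G \<rho>) tuple_dist) f \<longrightarrow>
    (\<forall>j. Ck1_closure (d - 1) \<Omega> (\<lambda>x. induced_map G \<rho> \<sigma> j (f x))) \<longrightarrow>
    f \<in> W1inf_orbit_tuples G \<rho> \<Omega>' \<and>
    Linf_norm \<Omega>' (tuple_diff_norm \<Omega>' (card (carrier G)) f)
      \<le> ennreal (C * (1 + Max (range (\<lambda>j.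
          Ck1_norm (d - 1) \<Omega> (\<lambda>x. induced_map G \<rho> \<sigma> j (f x)) powr (1 / real (dg j))))))"
proof -
  define Q where "Q = card (carrier G)"
  interpret U: Metric_space "unordered_tuples Q :: (real^'n) multiset set" tuple_dist
    by (rule Metric_space_unordered_tuples)
  interpret O: Metric_space "orbit_tuples G \<rho>" tuple_dist by (rule Metric_space_orbit_tuples)
  have OU: "orbit_tuples G \<rho> \<subseteq> unordered_tuples Q" unfolding Q_def by (rule orbit_tuples_subset)
  obtain \<delta>0 where \<delta>0: "0 < \<delta>0" "(\<Union>x\<in>closure \<Omega>'. cball x \<delta>0) \<subseteq> \<Omega>"
    using compact_subset_open_imp_cball_epsilon_subset[OF assms(7,4,8)] by blast
  \<comment> \<open>One \<open>\<delta>\<close> is spent on moving from \<open>\<Omega>'\<close>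
    into \<open>K\<close>, a second one on the balls around the points of \<open>K\<close>; hence
    half of \<open>\<delta>0\<close>.\<close>
  define \<delta> where "\<delta> = min 1 (\<delta>0 / 2)"
  have \<delta>: "0 < \<delta>" "\<delta> \<le> 1" "\<delta> + \<delta> \<le> \<delta>0" using \<delta>0(1) by (auto simp: \<delta>_def min_def)
  define K where "K = {x + z | x z. x \<in> closure \<Omega>' \<and> z \<in> cball (0 :: real^'m) \<delta>}"
  have K: "compact K" unfolding K_def by (intro compact_sums assms(7)) simp
  have cbK: "cball y \<delta> \<subseteq> \<Omega>" if y: "y \<in> K" for y
  proof
    fix w assume w: "w \<in> cball y \<delta>"
    obtain x z where xz: "y = x + z" "x \<in> closure \<Omega>'" "norm z \<le> \<delta>" using y by (auto simp: K_def)
    have "dist x w \<le> dist x y + dist y w" by (rule dist_triangle)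
    also have "dist x y = norm z" using xz(1) by (simp add: dist_norm)
    also have "norm z + dist y w \<le> \<delta>0" using xz(3) w \<delta>(3) by simp
    finally have "w \<in> cball x \<delta>0" by simp
    then show "w \<in> \<Omega>" using \<delta>0(2) xz(2) by blast
  qed
  have K\<Omega>: "K \<subseteq> \<Omega>" using cbK \<delta>(1) by fastforce
  have inK: "x + h *\<^sub>R axis i 1 \<in> K" if "x \<in> \<Omega>'" "\<bar>h\<bar> \<le> \<delta>" for x h i
  proof -
    have "x \<in> closure \<Omega>'" using that(1) closure_subset by blast
    moreover have "h *\<^sub>R axis i 1 \<in> cball (0 :: real^'m) \<delta>" using that(2) by simp
    ultimately show ?thesis unfolding K_def by blast
  qed
  obtain L where L: "0 \<le> L" "\<And>f x i. (\<forall>y\<in>\<Omega>. f y \<in> orbit_tuples G \<rho>) \<Longrightarrow>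
    (\<forall>j. Ck1_closure (d - 1) \<Omega> (\<lambda>x. induced_map G \<rho> \<sigma> j (f x))) \<Longrightarrow> cball x \<delta> \<subseteq> \<Omega> \<Longrightarrow>
    (\<exists>\<epsilon>>0. \<forall>h. \<bar>h\<bar> < \<epsilon> \<longrightarrow> tuple_dist (f x) (f (x + h *\<^sub>R axis i 1)) \<le>
      L * (1 + Max (range (\<lambda>j. Ck1_norm (d - 1) \<Omega> (\<lambda>x. induced_map G \<rho> \<sigma> j (f x)) powr (1 / real (dg j))))) * \<bar>h\<bar>)"
    using orbit_tuples_axis_lipschitz[OF assms(1,2,3,5) \<delta>(1,2)] by blast
  have b\<Omega>': "bounded \<Omega>'"
    using assms(7) closure_subset compact_imp_bounded bounded_subset by metis
  show ?thesis
  proof (rule exI[of _ "sqrt (real CARD('m)) * L + 1"], rule conjI, goal_cases)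
    case 1
    \<comment> \<open>The summand 1 in the constant makes it positive even if
      \<open>L = 0\<close>.\<close>
    show ?case using L(1) by (simp add: add_nonneg_pos)
  next
    case 2
    show ?case
    proof (intro allI impI)
      fix f :: "real^'m \<Rightarrow> (real^'n) multiset"
      assume cont: "continuous_map (top_of_set \<Omega>) O.mtopology f"
        and F: "\<forall>j. Ck1_closure (d - 1) \<Omega> (\<lambda>x. induced_map G \<rho> \<sigma> j (f x))"
      define A where "A = 1 + Max (range (\<lambda>j. Ck1_norm (d - 1) \<Omega> (\<lambda>x. induced_map G \<rho> \<sigma> j (f x)) powr (1 / real (dg j))))"
      have A1: "1 \<le> A"
      proof -
        have "0 \<le> Ck1_norm (d - 1) \<Omega> (\<lambda>x. induced_map G \<rho> \<sigma> undefined (f x)) powr (1 / real (dg undefined))" by simp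
        also have "\<dots> \<le> Max (range (\<lambda>j. Ck1_norm (d - 1) \<Omega> (\<lambda>x. induced_map G \<rho> \<sigma> j (f x)) powr (1 / real (dg j))))"
          by (intro Max_ge) auto
        finally show ?thesis by (simp add: A_def)
      qed
      have fO: "f y \<in> orbit_tuples G \<rho>" if "y \<in> \<Omega>" for y
        using continuous_map_image_subset_topspace[OF cont] that by auto
      then have fU: "f y \<in> unordered_tuples Q" if "y \<in> \<Omega>" for y using OU that by blast
      have near: "\<exists>e>0. \<forall>z\<in>\<Omega>. dist z y < e \<longrightarrow> tuple_dist (f y) (f z) < r" if y: "y \<in> \<Omega>" and r: "0 < r" for y r
      proof -
        obtain T where T: "openin (top_of_set \<Omega>) T" "y \<in> T" "\<And>z. z \<in> T \<Longrightarrow> f z \<in> O.mball (f y) r"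
          using cont y r unfolding O.continuous_map_to_metric by (metis topspace_euclidean_subtopology)
        obtain e where e: "0 < e" "\<forall>z\<in>\<Omega>. dist z y < e \<longrightarrow> z \<in> T"
          using T(1,2) unfolding openin_euclidean_subtopology_iff by blast
        then show ?thesis using T(3) by (intro exI[of _ e]) auto
      qed
      have contd: "continuous_on \<Omega> (\<lambda>y. tuple_dist (f y) P)" if P: "P \<in> unordered_tuples Q" for P
        unfolding continuous_on_iff
      proof (intro ballI allI impI)
        fix y r assume y: "y \<in> \<Omega>" and "0 < (r :: real)"
        then obtain e where e: "0 < e" "\<And>z. z \<in> \<Omega> \<Longrightarrow> dist z y < e \<Longrightarrow> tuple_dist (f y) (f z) < r"
          using near by blast
        have "dist (tuple_dist (f z) P) (tuple_dist (f y) P) < r" if z: "z \<in> \<Omega>" "dist z y < e" for z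
        proof -
          have "\<bar>tuple_dist (f z) P - tuple_dist P (f y)\<bar> \<le> tuple_dist (f z) (f y)"
            by (rule U.mdist_reverse_triangle[OF fU[OF z(1)] P fU[OF y]])
          then show ?thesis using e(2)[OF z] by (simp add: dist_real_def U.commute)
        qed
        then show "\<exists>e>0. \<forall>z\<in>\<Omega>. dist z y < e \<longrightarrow> dist (tuple_dist (f z) P) (tuple_dist (f y) P) < r"
          using e(1) by blast
      qed
      have W: "f \<in> W1inf_tuples \<Omega>' Q \<and>
        Linf_norm \<Omega>' (tuple_diff_norm \<Omega>' Q f) \<le> ennreal (sqrt (real CARD('m)) * (L * A))"
      proof (rule W1inf_tuples_criterion[OF assms(6) b\<Omega>'])
        show "0 \<le> L * A" using L(1) A1 by simp
        show "f \<in> lebesgue_on \<Omega>' \<rightarrow>\<^sub>M sigma (unordered_tuples Q) {V. openin U.mtopology V}"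
        proof (rule measurable_measure_of)
          show "{V. openin U.mtopology V} \<subseteq> Pow (unordered_tuples Q)"
            using openin_subset[of U.mtopology] by auto
          show "f \<in> space (lebesgue_on \<Omega>') \<rightarrow> unordered_tuples Q"
            using fU assms(8) closure_subset by (auto simp: space_restrict_space)
          fix V assume "V \<in> {V. openin U.mtopology V}"
          then have V: "openin U.mtopology V" by simp
          have "open (f -` V \<inter> \<Omega>')"
            unfolding open_dist
          proof
            fix y assume y: "y \<in> f -` V \<inter> \<Omega>'"
            then have y\<Omega>: "y \<in> \<Omega>" using assms(8) closure_subset by blast
            obtain r where r: "0 < r" "U.mball (f y) r \<subseteq> V" using V y unfolding U.openin_mtopology by auto
            obtain e where e: "0 < e" "\<forall>z\<in>\<Omega>. dist z y < e \<longrightarrow> tuple_dist (f y) (f z) < r"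
              using near[OF y\<Omega> r(1)] by blast
            obtain e' where e': "0 < e'" "\<forall>z. dist z y < e' \<longrightarrow> z \<in> \<Omega>'"
              using assms(6) y unfolding open_dist by blast
            have "z \<in> f -` V \<inter> \<Omega>'" if "dist z y < min e e'" for z
            proof -
              have z: "z \<in> \<Omega>'" "z \<in> \<Omega>" using e'(2) that assms(8) closure_subset by auto
              then have "f z \<in> U.mball (f y) r" using e(2) that fU y\<Omega> by simp
              then show ?thesis using r(2) z by blast
            qed
            then show "\<exists>e>0. \<forall>z. dist z y < e \<longrightarrow> z \<in> f -` V \<inter> \<Omega>'" using e(1) e'(1) by (intro exI[of _ "min e e'"]) simp
          qed
          then show "f -` V \<inter> space (lebesgue_on \<Omega>') \<in> sets (lebesgue_on \<Omega>')"
            using assms(6) by (simp add: space_restrict_space sets_restrict_space_iff)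
        qed
        fix P :: "(real^'n) multiset" assume P: "P \<in> unordered_tuples Q"
        \<comment> \<open>Cutting off at the compact set \<open>K\<close> gives a bounded Borel
          function on the whole space. Its jump at the boundary of \<open>K\<close> is never met:
          axis-parallel segments of length below \<open>\<delta>\<close> that start in
          \<open>\<Omega>'\<close> stay in \<open>K\<close>.\<close>
        define u where "u x = indicator K x *\<^sub>R tuple_dist (f x) P" for x
        have uK: "u x = tuple_dist (f x) P" if "x \<in> K" for x using that by (simp add: u_def)
        have cK: "continuous_on K (\<lambda>y. tuple_dist (f y) P)" by (rule continuous_on_subset[OF contd[OF P] K\<Omega>])
        have um: "u \<in> borel_measurable borel"
          unfolding u_def[abs_def] using compact_imp_closed[OF K] cK
          by (intro borel_measurable_continuous_on_indicator) auto
        have "bounded ((\<lambda>y. tuple_dist (f y) P) ` K)"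
          using compact_continuous_image[OF cK K] compact_imp_bounded by blast
        then obtain B where B: "\<forall>y\<in>K. \<bar>tuple_dist (f y) P\<bar> \<le> B" by (auto simp: bounded_iff)
        have uB: "\<bar>u x\<bar> \<le> \<bar>B\<bar>" for x using B by (cases "x \<in> K") (force simp: u_def)+
        have ulip: "\<bar>u (x + h *\<^sub>R axis i 1) - u x\<bar> \<le> L * A * \<bar>h\<bar>" if x: "x \<in> \<Omega>'" and h: "\<bar>h\<bar> < \<delta>" for x h i
        proof (rule axis_segment_lipschitz[where S = K])
          show "x + s *\<^sub>R axis i 1 \<in> K" if "\<bar>s\<bar> \<le> \<bar>h\<bar>" for s using inK[OF x] that h by simp
          fix y assume y: "y \<in> K"
          obtain \<epsilon> where \<epsilon>: "0 < \<epsilon>" "\<And>h. \<bar>h\<bar> < \<epsilon> \<Longrightarrow> tuple_dist (f y) (f (y + h *\<^sub>R axis i 1)) \<le> L * A * \<bar>h\<bar>"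
            using L(2)[OF _ F cbK[OF y], of i] fO unfolding A_def by blast
          have "\<bar>u (y + h *\<^sub>R axis i 1) - u y\<bar> \<le> L * A * \<bar>h\<bar>"
            if "\<bar>h\<bar> < \<epsilon>" and yh: "y + h *\<^sub>R axis i 1 \<in> K" for h
          proof -
            have "\<bar>tuple_dist (f (y + h *\<^sub>R axis i 1)) P - tuple_dist P (f y)\<bar> \<le> tuple_dist (f (y + h *\<^sub>R axis i 1)) (f y)"
              using P yh y K\<Omega> by (intro U.mdist_reverse_triangle fU) auto
            also have "\<dots> \<le> L * A * \<bar>h\<bar>" using \<epsilon>(2)[OF that(1)] by (simp add: U.commute)
            finally show ?thesis using uK[OF yh] uK[OF y] by (simp add: U.commute)
          qed
          then show "\<exists>\<epsilon>>0. \<forall>h. \<bar>h\<bar> < \<epsilon> \<longrightarrow> y + h *\<^sub>R axis i 1 \<in> K \<longrightarrow>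
              \<bar>u (y + h *\<^sub>R axis i 1) - u y\<bar> \<le> L * A * \<bar>h\<bar>"
            using \<epsilon>(1) by blast
        qed
        have u\<Omega>: "u x = tuple_dist (f x) P" if "x \<in> \<Omega>'" for x
          using uK inK[OF that, of 0] \<delta>(1) by simp
        show "\<exists>u B \<epsilon>. u \<in> borel_measurable borel \<and> (\<forall>x. \<bar>u x\<bar> \<le> B) \<and> 0 < \<epsilon> \<and>
          (\<forall>x\<in>\<Omega>'. u x = tuple_dist (f x) P) \<and>
          (\<forall>j. \<forall>x\<in>\<Omega>'. \<forall>h. \<bar>h\<bar> < \<epsilon> \<longrightarrow> \<bar>u (x + h *\<^sub>R axis j 1) - u x\<bar> \<le> L * A * \<bar>h\<bar>)"
        proof (intro exI conjI allI ballI impI)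
          show "u \<in> borel_measurable borel" by (rule um)
          show "\<bar>u x\<bar> \<le> \<bar>B\<bar>" for x by (rule uB)
          show "0 < \<delta>" by (rule \<delta>(1))
          show "u x = tuple_dist (f x) P" if "x \<in> \<Omega>'" for x by (rule u\<Omega>[OF that])
          show "\<bar>u (x + h *\<^sub>R axis j 1) - u x\<bar> \<le> L * A * \<bar>h\<bar>" if "x \<in> \<Omega>'" "\<bar>h\<bar> < \<delta>" for j x h
            by (rule ulip[OF that])
        qed
      qed
      have "ennreal (sqrt (real CARD('m)) * (L * A)) \<le> ennreal ((sqrt (real CARD('m)) * L + 1) * A)"
        using A1 by (intro ennreal_leI) (simp add: distrib_right mult.assoc)
      then have "Linf_norm \<Omega>' (tuple_diff_norm \<Omega>' Q f) \<le> ennreal ((sqrt (real CARD('m)) * L + 1) * A)"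
        by (rule order_trans[OF conjunct2[OF W]])
      moreover have "f ` \<Omega>' \<subseteq> orbit_tuples G \<rho>" using fO assms(8) closure_subset by blast
      ultimately show "f \<in> W1inf_orbit_tuples G \<rho> \<Omega>' \<and>
        Linf_norm \<Omega>' (tuple_diff_norm \<Omega>' (card (carrier G)) f)
        \<le> ennreal ((sqrt (real CARD('m)) * L + 1) * (1 + Max (range (\<lambda>j.
          Ck1_norm (d - 1) \<Omega> (\<lambda>x. induced_map G \<rho> \<sigma> j (f x)) powr (1 / real (dg j))))))"
        using W unfolding W1inf_orbit_tuples_def Q_def A_def by simp
    qed
  qed
qed

end
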